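(* Suppose $K$ is a finitely generated abelian group and $$1\to K\to G\to H\to 1$$ is a central extension (a short exact sequence of groups in which the image of $K$ is central in $G$) of an automatic group $H$. Then $G$ is a parallel poly-pushdown ($\mathcal P$) group.
   Context: **Automatic groups.** A group $H$ is automatic (in the usual sense of Epstein et al.) if there are a finite monoid generating set $A$ of $H$ closed under inverses, a regular language $L\subseteq A^*$ mapping onto $H$, and a constant $C$ such that whenever $u,v\in L$ satisfy $d(\overline u,\overline v)\le 1$, then $d(\overline{u(t)},\overline{v(t)})\le C$ for all $t\ge 0$, where $u(t)$ is the prefix of $u$ of length $t$ (or $u$ if $t\ge$ the length of $u$) and $d$ is the word metric. **Languages.** For a finite alphabet $A$, $A^*$ is the free monoid on $A$ (words), $\epsilon$ is the empty word, and a language is a subset of $A^*$. **Deterministic pushdown automata.** A deterministic pushdown automaton is a 7-tuple $M=(S,A,B,\tau,s_0,Z_0,Y)$ with $S$ a finite set of states, $A$ a finite input alphabet, $B$ a finite stack alphabet, $s_0\in S$ the start state, $Z_0\in B$ the start symbol, $Y\subseteq S$ the final states, and $\tau:\Sigma\to S\times B^*$ a map with $\Sigma\subseteq (A\cup\{\epsilon\})\times B\times S$ such that for every $(b,s)\in B\times S$ either $(\epsilon,b,s)\in\Sigma$ and $(a,b,s)\notin\Sigma$ for all $a\in A$, or $(\epsilon,b,s)\notin\Sigma$ and $(a,b,s)\in\Sigma$ for all $a\in A$. An instantaneous description is a triple $(u,z,s)\in A^*\times B^*\times S$ (unread input, stack with top at the right end, state). $M$ makes the transition $(av,yb,s)\to(v,y\alpha,t)$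 if $a\in A\cup\{\epsilon\}$, $b\in B$, $(a,b,s)\in \Sigma$ and $\tau(a,b,s)=(t,\alpha)$; $\to^*$ is the reflexive transitive closure. $M$ accepts $w$ by final state if $(w,Z_0,s_0)\to^*(\epsilon,z,s)$ for some $z\in B^*$, $s\in Y$; it accepts $w$ by empty stack if $(w,Z_0,s_0)\to^*(\epsilon,\epsilon,s)$ for some $s\in S$. A language is the language of a deterministic pushdown automaton if it is the set of words accepted by some such $M$ in either one of these two modes. **$\mathcal P$ languages.** $L\subseteq A^*$ is parallel poly-pushdown ($\mathcal P$) if it is an intersection of finitely many languages over $A$ of deterministic pushdown automata. **Two-tape version.** Let $\$$ be a symbol not in $A$, and let $(A\cup\{\$\})^\sharp$, $(A\cup\{\$\})^\flat$ be two disjoint copies of $A\cup\{\$\}$, with induced maps on words $u\mapsto u^\sharp$, $v\mapsto v^\flat$. A shuffle $\sigma(u,v)$ of words $u,v$ is a word $u_1^\sharp v_1^\flat\cdots u_k^\sharp v_k^\flat$ with $u=u_1\cdots u_k$, $v=v_1\cdots v_k$, $u_i\ne\epsilon$ for $i>1$, $v_j\neq\epsilon$ for $j<k$. An asynchronous two-tape pushdown automaton over $A$ is a deterministic pushdown automaton $T$ with input alphabet $(A\cup\{\$\})^\sharp\sqcup (A\cup\{\$\})^\flat$ whose states are partitioned into two sets $S_\sharp,S_\flat$. A pair $(u,v)\in A^*\times A^*$ is accepted by $T$ if some shuffle $\sigma(u\$,v\$)$ is accepted by $T$ and, while reading it, $T$ reads letters of $(A\cup\{\$\})^\sharp$ only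 in states of $S_\sharp$ and letters of $(A\cup\{\$\})^\flat$ only in states of $S_\flat$. The language of $T$ is the set of accepted pairs. A subset of $A^*\times A^*$ is AT$\mathcal P$ (asynchronous two-tape parallel poly-pushdown) if it is the intersection of the languages of finitely many asynchronous two-tape pushdown automata over $A$. **$\mathcal P$ groups.** Let $G$ be a group and $A$ a finite set with a map $A\to G$ such that the induced monoid homomorphism $A^*\to G$, $w\mapsto\overline w$, is surjective. A language $L\subseteq A^*$ is a parallel poly-pushdown structure for $G$ if (1) $w\mapsto \overline w$ restricts to a bijection $L\to G$; (2) $L$ is $\mathcal P$; (3) for each $a\in A$ the set $\{(w,w')\in L\times L: \overline{w'}=\overline{wa}\}$ is AT$\mathcal P$. $G$ is parallel poly-pushdown (a $\mathcal P$ group) if it has such a structure for some such $A$. *)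

theory Defs
  imports "HOL-Algebra.Elementary_Groups"
begin

section \<open>Deterministic pushdown automata\<close>

text \<open>
  The transition map is a partial function, its domain being the set \<open>\<Sigma>\<close> of the textbook
  definition; a letter \<^term>\<open>None\<close> stands for \<open>\<epsilon>\<close>.
\<close>

record ('s, 'a, 'b) dpda =
  states :: "'s set"
  input_alphabet :: "'a set"
  stack_alphabet :: "'b set"
  trans_map :: "'a option \<times> 'b \<times> 's \<Rightarrow> ('s \<times> 'b list) option"
  start_state :: 's
  start_symbol :: 'b
  final_states :: "'s set"

definition is_dpda :: "('s, 'a, 'b) dpda \<Rightarrow> bool" where
  "is_dpda M \<longleftrightarrow>
     finite (states M) \<and> finite (input_alphabet M) \<and> finite (stack_alphabet M) \<and>
     start_state M \<in> states M \<and> start_symbol M \<in> stack_alphabet M \<and>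
     final_states M \<subseteq> states M \<and>
     dom (trans_map M) \<subseteq>
       insert None (Some ` input_alphabet M) \<times> stack_alphabet M \<times> states M \<and>
     ran (trans_map M) \<subseteq> states M \<times> lists (stack_alphabet M) \<and>
     (\<forall>b \<in> stack_alphabet M. \<forall>s \<in> states M.
        (None, b, s) \<in> dom (trans_map M) \<and>
          (\<forall>a \<in> input_alphabet M. (Some a, b, s) \<notin> dom (trans_map M)) \<or>
        (None, b, s) \<notin> dom (trans_map M) \<and>
          (\<forall>a \<in> input_alphabet M. (Some a, b, s) \<in> dom (trans_map M)))"

text \<open>An instantaneous description: unread input, stack (top at the right end), state.\<close>

type_synonym ('s, 'a, 'b) description = "'a list \<times> 'b list \<times> 's"

definition option_word :: "'a option \<Rightarrow> 'a list" where
  "option_word a = (case a of None \<Rightarrow> [] | Some x \<Rightarrow> [x])"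

text \<open>The second argument records what is read from the input by the transition.\<close>

inductive dpda_move ::
    "('s, 'a, 'b) dpda \<Rightarrow> 'a option \<Rightarrow> ('s, 'a, 'b) description \<Rightarrow> ('s, 'a, 'b) description \<Rightarrow> bool"
  for M where
  "trans_map M (a, b, s) = Some (t, \<alpha>) \<Longrightarrow>
     dpda_move M a (option_word a @ v, y @ [b], s) (v, y @ \<alpha>, t)"

definition dpda_step ::
    "('s, 'a, 'b) dpda \<Rightarrow> ('s, 'a, 'b) description \<Rightarrow> ('s, 'a, 'b) description \<Rightarrow> bool" where
  "dpda_step M c c' \<longleftrightarrow> (\<exists>a. dpda_move M a c c')"

datatype acceptance_mode = Final_State | Empty_Stack

text \<open>
  Acceptance of a word by a run of \<open>M\<close> all of whose transitions lie in the relation \<open>R\<close>.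
  For one-tape automata \<open>R\<close> is \<^term>\<open>dpda_step M\<close>; two-tape automata restrict it.
\<close>

definition accepts_via ::
    "acceptance_mode \<Rightarrow> ('s, 'a, 'b) dpda \<Rightarrow>
     (('s, 'a, 'b) description \<Rightarrow> ('s, 'a, 'b) description \<Rightarrow> bool) \<Rightarrow> 'a list \<Rightarrow> bool" where
  "accepts_via m M R w \<longleftrightarrow>
     (\<exists>z s. R\<^sup>*\<^sup>* (w, [start_symbol M], start_state M) ([], z, s) \<and>
        (case m of Final_State \<Rightarrow> s \<in> final_states M | Empty_Stack \<Rightarrow> z = []))"

definition dpda_lang :: "acceptance_mode \<Rightarrow> ('s, 'a, 'b) dpda \<Rightarrow> 'a list set" where
  "dpda_lang m M = {w \<in> lists (input_alphabet M). accepts_via m M (dpda_step M) w}"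

text \<open>
  States and stack symbols form finite sets, so taking them to be natural numbers loses no
  automata up to renaming.
\<close>

definition is_dpda_language :: "'a set \<Rightarrow> 'a list set \<Rightarrow> bool" where
  "is_dpda_language A L \<longleftrightarrow>
     (\<exists>(M :: (nat, 'a, nat) dpda) m. is_dpda M \<and> input_alphabet M = A \<and> L = dpda_lang m M)"

definition is_P_language :: "'a set \<Rightarrow> 'a list set \<Rightarrow> bool" where
  "is_P_language A L \<longleftrightarrow>
     (\<exists>\<L>. finite \<L> \<and> \<L> \<noteq> {} \<and> (\<forall>X \<in> \<L>. is_dpda_language A X) \<and> L = \<Inter>\<L>)"


section \<open>Asynchronous two-tape pushdown automata\<close>

text \<open>
  \<open>Letter a\<close> and \<open>Endmark\<close> form \<open>A \<union> {$}\<close>. The \<open>\<sharp>\<close>-copy and the \<open>\<flat>\<close>-copy of a set are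
  its images under \<^term>\<open>Inl\<close> and \<^term>\<open>Inr\<close>.
\<close>

datatype 'a endmarked = Letter 'a | Endmark

definition endmarked_alphabet :: "'a set \<Rightarrow> 'a endmarked set" where
  "endmarked_alphabet A = insert Endmark (Letter ` A)"

definition endmark :: "'a list \<Rightarrow> 'a endmarked list" where
  "endmark u = map Letter u @ [Endmark]"

definition is_shuffle :: "'x list \<Rightarrow> 'x list \<Rightarrow> ('x + 'x) list \<Rightarrow> bool" where
  "is_shuffle u v w \<longleftrightarrow>
     (\<exists>ps. u = concat (map fst ps) \<and> v = concat (map snd ps) \<and>
        w = concat (map (\<lambda>(p, q). map Inl p @ map Inr q) ps) \<and>
        (\<forall>p \<in> set (tl ps). fst p \<noteq> []) \<and> (\<forall>p \<in> set (butlast ps). snd p \<noteq> []))"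

lemma is_shuffle_Nil: "is_shuffle [] [] []"
  unfolding is_shuffle_def by (rule exI[of _ "[]"]) simp

lemma is_shuffle_Inl: "is_shuffle u v w \<Longrightarrow> is_shuffle (x # u) v (Inl x # w)"
proof -
  assume "is_shuffle u v w"
  then obtain ps where ps: "u = concat (map fst ps)" "v = concat (map snd ps)"
    "w = concat (map (\<lambda>(p, q). map Inl p @ map Inr q) ps)"
    "\<forall>p \<in> set (tl ps). fst p \<noteq> []" "\<forall>p \<in> set (butlast ps). snd p \<noteq> []"
    unfolding is_shuffle_def by blast
  show ?thesis
  proof (cases ps)
    case Nil
    then show ?thesis
      using ps unfolding is_shuffle_def by (intro exI[of _ "[([x], [])]"]) simp
  next
    case (Cons r rs)
    then show ?thesis
      using ps unfolding is_shuffle_def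
      by (intro exI[of _ "(x # fst r, snd r) # rs"]) (auto split: prod.splits if_splits)
  qed
qed

lemma is_shuffle_Inr: "is_shuffle u v w \<Longrightarrow> is_shuffle u (y # v) (Inr y # w)"
proof -
  assume "is_shuffle u v w"
  then obtain ps where ps: "u = concat (map fst ps)" "v = concat (map snd ps)"
    "w = concat (map (\<lambda>(p, q). map Inl p @ map Inr q) ps)"
    "\<forall>p \<in> set (tl ps). fst p \<noteq> []" "\<forall>p \<in> set (butlast ps). snd p \<noteq> []"
    unfolding is_shuffle_def by blast
  show ?thesis
  proof (cases ps)
    case Nil
    then show ?thesis
      using ps unfolding is_shuffle_def by (intro exI[of _ "[([], [y])]"]) simp
  next
    case (Cons r rs)
    show ?thesis
    proof (cases "fst r = []")
      case True
      then show ?thesis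
        using ps Cons unfolding is_shuffle_def
        by (intro exI[of _ "([], y # snd r) # rs"]) (auto split: prod.splits if_splits)
    next
      case False
      then show ?thesis
        using ps Cons unfolding is_shuffle_def
        by (intro exI[of _ "([], [y]) # r # rs"]) (auto split: prod.splits if_splits)
    qed
  qed
qed

lemma map_Inl_append_in_shuffles:
  "w \<in> shuffles (map Inl u) vs \<Longrightarrow> map Inl p @ w \<in> shuffles (map Inl (p @ u)) vs"
  by (induction p) (auto intro: Cons_in_shuffles_leftI)

lemma map_Inr_append_in_shuffles:
  "w \<in> shuffles us (map Inr v) \<Longrightarrow> map Inr q @ w \<in> shuffles us (map Inr (q @ v))"
  by (induction q) (auto intro: Cons_in_shuffles_rightI)

lemma blocks_in_shuffles:
  "concat (map (\<lambda>(p, q). map Inl p @ map Inr q) ps)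
     \<in> shuffles (map Inl (concat (map fst ps))) (map Inr (concat (map snd ps)))"
proof (induction ps)
  case (Cons r rs)
  obtain p q where "r = (p, q)" by fastforce
  with map_Inl_append_in_shuffles[OF map_Inr_append_in_shuffles[OF Cons.IH]]
  show ?case by simp
qed simp

lemma shuffles_imp_is_shuffle:
  "w \<in> shuffles (map Inl u) (map Inr v) \<Longrightarrow> is_shuffle u v w"
proof (induction w arbitrary: u v)
  case Nil
  then show ?case by (simp add: is_shuffle_Nil)
next
  case (Cons z w)
  from Cons.prems consider
      (l) "u \<noteq> []" "hd (map Inl u) = z" "w \<in> shuffles (tl (map Inl u)) (map Inr v)"
    | (r) "v \<noteq> []" "hd (map Inr v) = z" "w \<in> shuffles (map Inl u) (tl (map Inr v))"
    by (auto simp: Cons_in_shuffles_iff)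
  then show ?case
  proof cases
    case l
    then obtain x u' where "u = x # u'" by (cases u) auto
    with l Cons.IH[of u' v] show ?thesis by (auto intro: is_shuffle_Inl)
  next
    case r
    then obtain y v' where "v = y # v'" by (cases v) auto
    with r Cons.IH[of u v'] show ?thesis by (auto intro: is_shuffle_Inr)
  qed
qed

lemma is_shuffle_iff_shuffles: "is_shuffle u v w \<longleftrightarrow> w \<in> shuffles (map Inl u) (map Inr v)"
  using shuffles_imp_is_shuffle blocks_in_shuffles unfolding is_shuffle_def by blast

text \<open>The pair \<open>(S1, S2)\<close> is the partition of the states into \<open>S\<^sub>\<sharp>\<close> and \<open>S\<^sub>\<flat>\<close>.\<close>

definition is_two_tape_dpda ::
    "'a set \<Rightarrow> ('s, 'a endmarked + 'a endmarked, 'b) dpda \<Rightarrow> 's set \<Rightarrow> 's set \<Rightarrow> bool" where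
  "is_two_tape_dpda A T S1 S2 \<longleftrightarrow>
     is_dpda T \<and> input_alphabet T = endmarked_alphabet A <+> endmarked_alphabet A \<and>
     S1 \<union> S2 = states T \<and> S1 \<inter> S2 = {}"

definition two_tape_step ::
    "('s, 'x + 'x, 'b) dpda \<Rightarrow> 's set \<Rightarrow> 's set \<Rightarrow>
     ('s, 'x + 'x, 'b) description \<Rightarrow> ('s, 'x + 'x, 'b) description \<Rightarrow> bool" where
  "two_tape_step T S1 S2 = (\<lambda>(w, z, s) c'.
     \<exists>a. dpda_move T a (w, z, s) c' \<and>
       (\<forall>x. a = Some (Inl x) \<longrightarrow> s \<in> S1) \<and> (\<forall>x. a = Some (Inr x) \<longrightarrow> s \<in> S2))"

definition two_tape_lang ::
    "acceptance_mode \<Rightarrow> 'a set \<Rightarrow> ('s, 'a endmarked + 'a endmarked, 'b) dpda \<Rightarrow> 's set \<Rightarrow> 's set \<Rightarrow>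
     ('a list \<times> 'a list) set" where
  "two_tape_lang m A T S1 S2 =
     {(u, v) \<in> lists A \<times> lists A.
        \<exists>w. is_shuffle (endmark u) (endmark v) w \<and> accepts_via m T (two_tape_step T S1 S2) w}"

definition is_two_tape_language :: "'a set \<Rightarrow> ('a list \<times> 'a list) set \<Rightarrow> bool" where
  "is_two_tape_language A R \<longleftrightarrow>
     (\<exists>(T :: (nat, 'a endmarked + 'a endmarked, nat) dpda) S1 S2 m.
        is_two_tape_dpda A T S1 S2 \<and> R = two_tape_lang m A T S1 S2)"

definition is_ATP :: "'a set \<Rightarrow> ('a list \<times> 'a list) set \<Rightarrow> bool" where
  "is_ATP A R \<longleftrightarrow>
     (\<exists>\<R>. finite \<R> \<and> \<R> \<noteq> {} \<and> (\<forall>X \<in> \<R>. is_two_tape_language A X) \<and> R = \<Inter>\<R>)"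


section \<open>Parallel poly-pushdown groups\<close>

text \<open>
  The monoid homomorphism from words over the domain of \<open>\<phi>\<close> that extends \<open>\<phi>\<close>.
\<close>

definition word_value :: "('g, 'm) monoid_scheme \<Rightarrow> ('a \<Rightarrow> 'g) \<Rightarrow> 'a list \<Rightarrow> 'g" where
  "word_value G \<phi> w = foldr (\<lambda>a g. \<phi> a \<otimes>\<^bsub>G\<^esub> g) w \<one>\<^bsub>G\<^esub>"

definition is_P_structure ::
    "('g, 'm) monoid_scheme \<Rightarrow> 'a set \<Rightarrow> ('a \<Rightarrow> 'g) \<Rightarrow> 'a list set \<Rightarrow> bool" where
  "is_P_structure G A \<phi> L \<longleftrightarrow>
     L \<subseteq> lists A \<and>
     bij_betw (word_value G \<phi>) L (carrier G) \<and>
     is_P_language A L \<and>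
     (\<forall>a \<in> A. is_ATP A
        {(w, w') \<in> L \<times> L. word_value G \<phi> w' = word_value G \<phi> (w @ [a])})"

text \<open>The letters form a finite set, so they may be taken to be natural numbers.\<close>

definition P_group :: "('g, 'm) monoid_scheme \<Rightarrow> bool" where
  "P_group G \<longleftrightarrow>
     group G \<and>
     (\<exists>(A :: nat set) \<phi> L. finite A \<and> \<phi> \<in> A \<rightarrow> carrier G \<and>
        word_value G \<phi> ` lists A = carrier G \<and> is_P_structure G A \<phi> L)"


section \<open>Automatic groups\<close>

definition regular_language :: "'a set \<Rightarrow> 'a list set \<Rightarrow> bool" where
  "regular_language A L \<longleftrightarrow>
     (\<exists>(Q :: nat set) \<delta> q0 F. finite Q \<and> q0 \<in> Q \<and> F \<subseteq> Q \<and>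
        (\<forall>q \<in> Q. \<forall>a \<in> A. \<delta> q a \<in> Q) \<and>
        L = {w \<in> lists A. foldl \<delta> q0 w \<in> F})"

definition word_metric :: "('g, 'm) monoid_scheme \<Rightarrow> 'g set \<Rightarrow> 'g \<Rightarrow> 'g \<Rightarrow> nat" where
  "word_metric G A g h =
     (LEAST n. \<exists>w \<in> lists A. length w = n \<and> g \<otimes>\<^bsub>G\<^esub> word_value G id w = h)"

definition automatic_group :: "('g, 'm) monoid_scheme \<Rightarrow> bool" where
  "automatic_group G \<longleftrightarrow>
     group G \<and>
     (\<exists>A L (C :: nat).
        finite A \<and> A \<subseteq> carrier G \<and> (\<forall>a \<in> A. inv\<^bsub>G\<^esub> a \<in> A) \<and>
        word_value G id ` lists A = carrier G \<and>
        regular_language A L \<and>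
        word_value G id ` L = carrier G \<and>
        (\<forall>u \<in> L. \<forall>v \<in> L.
           word_metric G A (word_value G id u) (word_value G id v) \<le> 1 \<longrightarrow>
           (\<forall>t. word_metric G A (word_value G id (take t u)) (word_value G id (take t v)) \<le> C)))"


section \<open>Central extensions\<close>

definition finitely_generated_group :: "('g, 'm) monoid_scheme \<Rightarrow> bool" where
  "finitely_generated_group G \<longleftrightarrow>
     group G \<and> (\<exists>X. finite X \<and> X \<subseteq> carrier G \<and> generate G X = carrier G)"

text \<open>
  The library constant \<open>short_exact_sequence\<close> would force the three groups to have elements of
  one and the same type; the conditions on \<open>\<iota>\<close> and \<open>\<pi>\<close> below are its
  characterisation \<open>short_exact_sequence_iff\<close>.
\<close>

definition central_extension ::
    "('k, 'l) monoid_scheme \<Rightarrow> ('g, 'm) monoid_scheme \<Rightarrow> ('h, 'n) monoid_scheme \<Rightarrow>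
     ('k \<Rightarrow> 'g) \<Rightarrow> ('g \<Rightarrow> 'h) \<Rightarrow> bool" where
  "central_extension K G H \<iota> \<pi> \<longleftrightarrow>
     group K \<and> group G \<and> group H \<and>
     \<iota> \<in> mon K G \<and> \<pi> \<in> epi G H \<and> kernel G H \<pi> = \<iota> ` carrier K \<and>
     (\<forall>k \<in> carrier K. \<forall>g \<in> carrier G. \<iota> k \<otimes>\<^bsub>G\<^esub> g = g \<otimes>\<^bsub>G\<^esub> \<iota> k)"

end

theory Submission
  imports Defs
begin

text \<open>
  Normal forms in \<open>G\<close> are products of a lift of a normal form in \<open>H\<close> and a normal form in \<open>K\<close>. Multiplying
  by a generator changes the normal form in \<open>H\<close> to a fellow traveller, and the difference between the
  two lifts is then an element of \<open>K\<close> (a cocycle value) that is a sum of increments from a finite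
  set, one for each position of the two words: since \<open>K\<close> is central, the increment at a position
  depends only on the current difference in \<open>H\<close>, which ranges over a finite set, and on the two
  letters read there. The group \<open>K\<close> has a free abelian subgroup \<open>F\<close> of finite index. The part of the sum
  outside \<open>F\<close> fits into the states of a finite automaton, and each integer coordinate of the part in
  \<open>F\<close> is a counter, for which one pushdown stack is enough. So one automaton for each coordinate, run
  in parallel, verifies the multiplication.

  Three facts carry the argument. Theorem \<open>counter_dpda\<close> turns a finite control with bounded integer
  outputs into a deterministic pushdown automaton; \<open>synchronous_counter_relation\<close> runs such a control
  on two tapes, read alternately. Theorem \<open>automatic_group_unique_representatives\<close> replaces the language
  of an automatic group by a regular language with unique representatives, namely the least words
  for their values. Theorem \<open>finitely_generated_abelian_structure\<close> provides \<open>F\<close>, its coordinates and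
  normal forms for \<open>K\<close>. In \<open>P_group_of_normal_form\<close> these are combined into multiplier relations; letters
  from \<open>H\<close> and from \<open>K\<close> are treated alike there, because two words over both kinds of letters have
  differences in finitely many cosets of \<open>F\<close> when their images in \<open>H\<close> are fellow travellers.
\<close>

section \<open>Pushdown automata with one counter\<close>

fun total_output :: "('s \<Rightarrow> 'x \<Rightarrow> 's) \<Rightarrow> ('s \<Rightarrow> 'x \<Rightarrow> int) \<Rightarrow> 's \<Rightarrow> 'x list \<Rightarrow> int" where
  "total_output \<delta> out s [] = 0"
| "total_output \<delta> out s (x # w) = out s x + total_output \<delta> out (\<delta> s x) w"

text \<open>
  Guards treat one-tape and two-tape automata at the same time: with the trivial guard every run is
  allowed, and on two tapes the guard says that the letter comes from the tape that the current
  state reads.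
\<close>

fun guarded_run :: "('s \<Rightarrow> 'x \<Rightarrow> 's) \<Rightarrow> ('s \<Rightarrow> 'x \<Rightarrow> bool) \<Rightarrow> 's \<Rightarrow> 'x list \<Rightarrow> bool" where
  "guarded_run \<delta> P s [] = True"
| "guarded_run \<delta> P s (x # w) = (P s x \<and> guarded_run \<delta> P (\<delta> s x) w)"

definition guarded_step ::
    "('s, 'x, 'b) dpda \<Rightarrow> ('s \<Rightarrow> 'x \<Rightarrow> bool) \<Rightarrow>
     ('s, 'x, 'b) description \<Rightarrow> ('s, 'x, 'b) description \<Rightarrow> bool" where
  "guarded_step M P = (\<lambda>(w, z, s) c'.
     \<exists>a. dpda_move M a (w, z, s) c' \<and> (\<forall>x. a = Some x \<longrightarrow> P s x))"

lemma dpda_step_eq_guarded_step: "dpda_step M = guarded_step M (\<lambda>s x. True)"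
  by (auto simp: fun_eq_iff dpda_step_def guarded_step_def)

definition clamp :: "int \<Rightarrow> int" where
  "clamp n = max (-2) (min 2 n)"

text \<open>
  A height \<open>n\<close> is stored in unary, but the entry at level \<open>j\<close> shows \<open>\<plusminus>j\<close> cut off at \<open>\<plusminus>2\<close>. Hence the top
  entry tells apart the absolute values \<open>0\<close>, \<open>1\<close> and \<open>\<ge> 2\<close>, so the automaton foresees that a pop will
  bring the height back to \<open>0\<close>. This makes zero visible in the state without any \<open>\<epsilon>\<close>-transition,
  and the run on a word is then determined letter by letter.
\<close>

definition height_stack :: "int \<Rightarrow> int list" where
  "height_stack n = map (\<lambda>j. clamp (sgn n * int j)) [0..<Suc (nat \<bar>n\<bar>)]"

text \<open>
  The word that replaces the top entry \<open>b\<close> when the height changes by \<open>k \<in> {-1, 0, 1}\<close>. For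
  nonzero \<open>k\<close> the height moves away from \<open>0\<close> exactly if \<open>b\<close> and \<open>k\<close> do not have opposite signs.
\<close>

definition replace_top :: "int \<Rightarrow> int \<Rightarrow> int list" where
  "replace_top b k = (if k = 0 then [b] else if b * k \<ge> 0 then [b, clamp (b + k)] else [])"

lemma height_stack_snoc: "height_stack n = butlast (height_stack n) @ [clamp n]"
  by (simp add: height_stack_def mult.commute abs_mult_sgn)

lemma butlast_height_stack:
  "butlast (height_stack n) = map (\<lambda>j. clamp (sgn n * int j)) [0..<nat \<bar>n\<bar>]"
  by (simp add: height_stack_def)

lemma height_stack_add:
  assumes "k \<in> {-1, 0, 1}"
  shows "height_stack (n + k) = butlast (height_stack n) @ replace_top (clamp n) k"
proof -
  consider "k = 0" | "k \<noteq> 0" "clamp n * k \<ge> 0" | "k \<noteq> 0" "clamp n * k < 0" by linarith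
  then show ?thesis
  proof cases
    case 1
    then show ?thesis using height_stack_snoc[of n] by (simp add: replace_top_def)
  next
    case 2
    have k: "k = 1 \<and> n \<ge> 0 \<or> k = -1 \<and> n \<le> 0"
      using assms 2 by (auto simp: clamp_def max_def min_def split: if_splits)
    have abs: "nat \<bar>n + k\<bar> = Suc (nat \<bar>n\<bar>)" using k by auto
    have "height_stack (n + k) =
      map (\<lambda>j. clamp (sgn (n + k) * int j)) [0..<Suc (nat \<bar>n\<bar>)] @ [clamp (n + k)]"
      using height_stack_snoc[of "n + k"] abs butlast_height_stack[of "n + k"] by simp
    also have "map (\<lambda>j. clamp (sgn (n + k) * int j)) [0..<Suc (nat \<bar>n\<bar>)] = height_stack n"
      unfolding height_stack_def using k by (cases "n = 0") (auto simp: sgn_if)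
    also have "clamp (n + k) = clamp (clamp n + k)"
      using k by (auto simp: clamp_def)
    finally have "height_stack (n + k) = height_stack n @ [clamp (clamp n + k)]" .
    also have "height_stack n = butlast (height_stack n) @ [clamp n]"
      by (rule height_stack_snoc)
    finally show ?thesis using 2 by (simp add: replace_top_def)
  next
    case 3
    have k: "k = 1 \<and> n < 0 \<or> k = -1 \<and> n > 0"
      using assms 3 by (auto simp: clamp_def max_def min_def split: if_splits)
    have "Suc (nat \<bar>n + k\<bar>) = nat \<bar>n\<bar>" using k by auto
    moreover have "map (\<lambda>j. clamp (sgn (n + k) * int j)) [0..<nat \<bar>n\<bar>] =
       map (\<lambda>j. clamp (sgn n * int j)) [0..<nat \<bar>n\<bar>]"
      proof (cases "n + k = 0")
      case True
      then have "\<bar>n\<bar> = 1" using k by linarith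
      then have "nat \<bar>n\<bar> = Suc 0" by simp
      then show ?thesis by simp
    next
      case False
      then have "sgn (n + k) = sgn n" using k by (auto simp: sgn_if)
      then show ?thesis by simp
    qed
    ultimately have "height_stack (n + k) = butlast (height_stack n)"
      unfolding butlast_height_stack unfolding height_stack_def by (simp only:)
    then show ?thesis using 3 by (simp add: replace_top_def)
  qed
qed

text \<open>
  A counter value \<open>v\<close> is written as \<open>v = 2 N n + r\<close> with \<open>-N \<le> r < N\<close>; the height \<open>n\<close> lives on the
  stack and the remainder \<open>r\<close> in the state. Adding an output \<open>d\<close> with \<open>\<bar>d\<bar> \<le> N\<close> turns \<open>r\<close> into
  \<open>s = r + d\<close>, with \<open>s\<close> at most \<open>N\<close> outside the range of remainders, so that the height changes by at
  most one. A single transition pops only one stack symbol, and this is what makes it enough.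
\<close>

definition carry :: "int \<Rightarrow> int \<Rightarrow> int" where
  "carry N s = (if s < - N then -1 else if s \<ge> N then 1 else 0)"

text \<open>
  A finite control with integer outputs, to be accepted when its final state lies in \<open>Fin\<close> and its
  outputs sum to \<open>c\<close>. A state of the pushdown automaton carries the control state, the remainder, and
  the truth value of \<open>n = 0\<close>. As \<open>\<bar>c\<bar> < N\<close>, the total \<open>c\<close> means height \<open>0\<close> and remainder \<open>c\<close>, which
  final states can express.
\<close>

locale counter_automaton =
  fixes X :: "'x set" and Q :: "'s set" and \<delta> :: "'s \<Rightarrow> 'x \<Rightarrow> 's" and out :: "'s \<Rightarrow> 'x \<Rightarrow> int"
    and q0 :: 's and Fin :: "'s set" and c :: int and N :: int and enc :: "'s \<times> int \<times> bool \<Rightarrow> nat"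
  assumes finX: "finite X" and finQ: "finite Q" and q0: "q0 \<in> Q"
    and closed: "\<And>q x. q \<in> Q \<Longrightarrow> x \<in> X \<Longrightarrow> \<delta> q x \<in> Q"
    and N: "\<And>q x. q \<in> Q \<Longrightarrow> x \<in> X \<Longrightarrow> \<bar>out q x\<bar> \<le> N" "\<bar>c\<bar> < N"
    and enc: "inj_on enc (Q \<times> {-N..<N} \<times> UNIV)"
begin

definition machine_states :: "('s \<times> int \<times> bool) set" where
  "machine_states = Q \<times> {-N..<N} \<times> UNIV"

definition dec :: "nat \<Rightarrow> 's \<times> int \<times> bool" where
  "dec = inv_into machine_states enc"

definition stack_code :: "int \<Rightarrow> nat" where
  "stack_code b = nat (b + 2)"

definition machine :: "(nat, 'x, nat) dpda" where
  "machine = \<lparr>states = enc ` machine_states, input_alphabet = X, stack_alphabet = stack_code ` {-2..2},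
     trans_map = (\<lambda>(a, \<beta>, \<sigma>). case a of None \<Rightarrow> None | Some x \<Rightarrow>
       if x \<in> X \<and> \<beta> \<in> stack_code ` {-2..2} \<and> \<sigma> \<in> enc ` machine_states then
         (let (q, r, z) = dec \<sigma>; b = int \<beta> - 2; s = r + out q x; k = carry N s in
           Some (enc (\<delta> q x, s - 2 * N * k, b + k = 0), map stack_code (replace_top b k)))
       else None),
     start_state = enc (q0, 0, True), start_symbol = stack_code 0,
     final_states = enc ` (machine_states \<inter> Fin \<times> {c} \<times> {True})\<rparr>"

lemma dec_enc [simp]: "x \<in> machine_states \<Longrightarrow> dec (enc x) = x"
  using enc by (simp add: dec_def machine_states_def inv_into_f_f)

lemma stack_code_inverse [simp]: "b \<in> {-2..2} \<Longrightarrow> int (stack_code b) - 2 = b"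
  by (simp add: stack_code_def)

lemma carry_cases: "carry N s \<in> {-1, 0, 1}"
  by (simp add: carry_def)

lemma remainder_range:
  assumes "r \<in> {-N..<N}" "q \<in> Q" "x \<in> X"
  shows "r + out q x - 2 * N * carry N (r + out q x) \<in> {-N..<N}"
  using assms(1) N(1)[OF assms(2,3)] by (auto simp: carry_def)

lemma clamp_range [simp]: "clamp n \<in> {-2..2}"
  by (auto simp: clamp_def)

lemma replace_top_range: "b \<in> {-2..2} \<Longrightarrow> set (replace_top b k) \<subseteq> {-2..2}"
  using clamp_range[of "b + k"] by (auto simp: replace_top_def simp del: clamp_range)

lemma step_in_machine_states:
  assumes "(q, r, z) \<in> machine_states" "x \<in> X"
  shows "(\<delta> q x, r + out q x - 2 * N * carry N (r + out q x), z') \<in> machine_states"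
  using assms closed[of q x] remainder_range[of r q x] by (simp add: machine_states_def)

lemma trans_machine:
  assumes "(q, r, z) \<in> machine_states" "x \<in> X" "b \<in> {-2..2}"
  shows "trans_map machine (Some x, stack_code b, enc (q, r, z)) =
    (let s = r + out q x; k = carry N s in
      Some (enc (\<delta> q x, s - 2 * N * k, b + k = 0), map stack_code (replace_top b k)))"
  using assms by (simp add: machine_def Let_def)

lemma is_dpda_machine: "is_dpda machine"
proof -
  have ran: "ran (trans_map machine) \<subseteq> enc ` machine_states \<times> lists (stack_code ` {-2..2})"
  proof
    fix y assume "y \<in> ran (trans_map machine)"
    then obtain a \<beta> \<sigma> where y: "trans_map machine (a, \<beta>, \<sigma>) = Some y"
      by (auto simp: ran_def)
    then obtain x where x: "a = Some x" "x \<in> X" "\<beta> \<in> stack_code ` {-2..2}" "\<sigma> \<in> enc ` machine_states"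
      by (auto simp: machine_def split: option.splits if_splits)
    then obtain b q r z where b: "\<beta> = stack_code b" "b \<in> {-2..2}" and s: "\<sigma> = enc (q, r, z)" "(q, r, z) \<in> machine_states"
      by auto
    have y': "y = (let s = r + out q x; k = carry N s in
      (enc (\<delta> q x, s - 2 * N * k, b + k = 0), map stack_code (replace_top b k)))"
      using y x b s trans_machine[OF s(2) x(2) b(2)] by (simp add: Let_def)
    have m: "map stack_code (replace_top b k) \<in> lists (stack_code ` {-2..2})" for k
    proof -
      have "set (map stack_code (replace_top b k)) \<subseteq> stack_code ` {-2..2}"
        unfolding set_map by (rule image_mono[OF replace_top_range[OF b(2)]])
      then show ?thesis by (simp only: in_lists_conv_set subset_iff Ball_def simp_thms)
    qed
    show "y \<in> enc ` machine_states \<times> lists (stack_code ` {-2..2})"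
      unfolding y' Let_def by (intro SigmaI imageI step_in_machine_states[OF s(2) x(2)] m)
  qed
  have fin: "finite machine_states" using finQ by (simp add: machine_states_def)
  have start: "(q0, 0, True) \<in> machine_states" using q0 N(2) by (auto simp: machine_states_def)
  have dom: "(a, \<beta>, \<sigma>) \<in> dom (trans_map machine) \<longleftrightarrow>
      (\<exists>x. a = Some x \<and> x \<in> X \<and> \<beta> \<in> stack_code ` {-2..2} \<and> \<sigma> \<in> enc ` machine_states)" for a \<beta> \<sigma>
    by (auto simp: machine_def Let_def split: option.splits if_splits prod.splits)
  have dom': "dom (trans_map machine) \<subseteq> insert None (Some ` X) \<times> stack_code ` {-2..2} \<times> enc ` machine_states"
  proof
    fix p assume p: "p \<in> dom (trans_map machine)"
    obtain a \<beta> \<sigma> where "p = (a, \<beta>, \<sigma>)" by (cases p)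
    with p dom[of a \<beta> \<sigma>] show "p \<in> insert None (Some ` X) \<times> stack_code ` {-2..2} \<times> enc ` machine_states"
      by (simp only: mem_Times_iff fst_conv snd_conv) blast
  qed
  have sel: "states machine = enc ` machine_states" "input_alphabet machine = X"
      "stack_alphabet machine = stack_code ` {-2..2}" "start_state machine = enc (q0, 0, True)"
      "start_symbol machine = stack_code 0" "final_states machine = enc ` (machine_states \<inter> Fin \<times> {c} \<times> {True})"
    by (simp_all add: machine_def)
  show ?thesis
    unfolding is_dpda_def sel
  proof (intro conjI ballI)
    fix b s assume "b \<in> stack_code ` {-2..2}" "s \<in> enc ` machine_states"
    then show "(None, b, s) \<in> dom (trans_map machine) \<and>
        (\<forall>a\<in>X. (Some a, b, s) \<notin> dom (trans_map machine)) \<or>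
        (None, b, s) \<notin> dom (trans_map machine) \<and>
        (\<forall>a\<in>X. (Some a, b, s) \<in> dom (trans_map machine))"
      unfolding dom by blast
  next
    show "stack_code 0 \<in> stack_code ` {-2..2}" by (rule imageI) simp
    show "enc (q0, 0, True) \<in> enc ` machine_states" using start by (rule imageI)
    show "enc ` (machine_states \<inter> Fin \<times> {c} \<times> {True}) \<subseteq> enc ` machine_states" by (rule image_mono) (rule Int_lower1)
    show "finite (enc ` machine_states)" "finite X" "finite (stack_code ` {-2..2})" using fin finX by simp_all
    show "dom (trans_map machine) \<subseteq> insert None (Some ` X) \<times> stack_code ` {- 2..2} \<times> enc ` machine_states" by (rule dom')
    show "ran (trans_map machine) \<subseteq> enc ` machine_states \<times> lists (stack_code ` {- 2..2})" by (rule ran)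
  qed
qed

abbreviation conf :: "'s \<Rightarrow> int \<Rightarrow> int \<Rightarrow> nat list \<times> nat" where
  "conf q n r \<equiv> (map stack_code (height_stack n), enc (q, r, n = 0))"

lemma step_machine:
  assumes "q \<in> Q" "r \<in> {-N..<N}" "x \<in> X"
  shows "guarded_step machine P (x # w, conf q n r) c' \<longleftrightarrow>
    P (enc (q, r, n = 0)) x \<and>
    c' = (w, conf (\<delta> q x) (n + carry N (r + out q x)) (r + out q x - 2 * N * carry N (r + out q x)))"
proof -
  let ?k = "carry N (r + out q x)"
  have st: "(q, r, n = 0) \<in> machine_states" using assms by (simp add: machine_states_def)
  have zero: "clamp n + ?k = 0 \<longleftrightarrow> n + ?k = 0"
    using carry_cases[of "r + out q x"] by (auto simp: clamp_def)
  have tr: "trans_map machine (Some x, stack_code (clamp n), enc (q, r, n = 0)) =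
     Some (enc (\<delta> q x, r + out q x - 2 * N * ?k, n + ?k = 0), map stack_code (replace_top (clamp n) ?k))"
    using trans_machine[OF st assms(3) clamp_range] zero by (simp add: Let_def)
  have no_eps: "trans_map machine (None, b, s) = None" for b s
    by (simp add: machine_def)
  have stk: "map stack_code (height_stack n) = map stack_code (butlast (height_stack n)) @ [stack_code (clamp n)]"
    using height_stack_snoc[of n] by (metis list.simps(8,9) map_append)
  have move: "dpda_move machine a (x # w, conf q n r) c' \<longleftrightarrow> a = Some x \<and>
     c' = (w, conf (\<delta> q x) (n + ?k) (r + out q x - 2 * N * ?k))" for a
  proof
    assume "dpda_move machine a (x # w, conf q n r) c'"
    then show "a = Some x \<and> c' = (w, conf (\<delta> q x) (n + ?k) (r + out q x - 2 * N * ?k))"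
    proof cases
      case (1 b t \<alpha> v y)
      then have "a \<noteq> None" using no_eps[of b] by (metis option.distinct(1))
      then have a: "a = Some x" "v = w" using 1(1) by (auto simp: option_word_def)
      have "y = map stack_code (butlast (height_stack n))" "b = stack_code (clamp n)"
        using 1 stk by auto
      then show ?thesis
        using 1 tr a height_stack_add[OF carry_cases, of n "r + out q x"] by simp
    qed
  next
    assume *: "a = Some x \<and> c' = (w, conf (\<delta> q x) (n + ?k) (r + out q x - 2 * N * ?k))"
    have "dpda_move machine (Some x) (option_word (Some x) @ w,
        map stack_code (butlast (height_stack n)) @ [stack_code (clamp n)], enc (q, r, n = 0))
      (w, map stack_code (butlast (height_stack n)) @ map stack_code (replace_top (clamp n) ?k),
       enc (\<delta> q x, r + out q x - 2 * N * ?k, n + ?k = 0))"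
      by (rule dpda_move.intros[OF tr])
    then show "dpda_move machine a (x # w, conf q n r) c'"
      using * stk height_stack_add[OF carry_cases, of n "r + out q x"] by (simp add: option_word_def)
  qed
  show ?thesis by (auto simp: guarded_step_def move)
qed

lemma no_step_Nil: "\<not> guarded_step machine P ([], z, s) c'"
proof
  assume "guarded_step machine P ([], z, s) c'"
  then obtain a where "dpda_move machine a ([], z, s) c'"
    by (auto simp: guarded_step_def)
  then show False
    by cases (auto simp: option_word_def machine_def split: option.splits)
qed

definition ctl :: "nat \<Rightarrow> 's" where
  "ctl s = fst (dec s)"

text \<open>
  The counter value is read off from the height and the remainder; the remainder being centred, this
  representation of an integer is unique, which identifies the final configuration.
\<close>

lemma run_machine:
  assumes "w \<in> lists X" "q \<in> Q" "r \<in> {-N..<N}"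
  shows "(guarded_step machine (\<lambda>s. P (ctl s)))\<^sup>*\<^sup>* (w, conf q n r) ([], z, s) \<longleftrightarrow>
    guarded_run \<delta> P q w \<and> (\<exists>n' r'. r' \<in> {-N..<N} \<and>
      2 * N * n' + r' = 2 * N * n + r + total_output \<delta> out q w \<and> (z, s) = conf (foldl \<delta> q w) n' r')"
  using assms
proof (induction w arbitrary: q n r rule: list.induct)
  case Nil
  have uniq: "n' = n \<and> r' = r"
    if "r' \<in> {-N..<N}" "2 * N * n' + r' = 2 * N * n + r" for n' r'
  proof -
    have "N > 0" using N(2) by linarith
    have "2 * N * (n' - n) = r - r'" using that by (simp add: algebra_simps)
    moreover have "\<bar>r - r'\<bar> < 2 * N" using that Nil by auto
    ultimately have "\<bar>2 * N * (n' - n)\<bar> < 2 * N" by simp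
    then have "2 * N * \<bar>n' - n\<bar> < 2 * N * 1" using \<open>N > 0\<close> by (simp add: abs_mult)
    then have "\<bar>n' - n\<bar> < 1" using \<open>N > 0\<close> by (simp only: mult_less_cancel_left_pos)
    then show ?thesis using that by auto
  qed
  have "(guarded_step machine (\<lambda>s. P (ctl s)))\<^sup>*\<^sup>* ([], conf q n r) ([], z, s) \<longleftrightarrow> (z, s) = conf q n r"
    using no_step_Nil by (auto elim: converse_rtranclpE)
  then show ?case using Nil uniq by auto
next
  case (Cons x w)
  let ?R = "guarded_step machine (\<lambda>s. P (ctl s))"
  let ?k = "carry N (r + out q x)"
  let ?r = "r + out q x - 2 * N * ?k"
  have x: "x \<in> X" "w \<in> lists X" using Cons.prems(1) by simp_all
  have st: "(q, r, n = 0) \<in> machine_states" using Cons.prems by (simp add: machine_states_def)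
  have step: "?R (x # w, conf q n r) c' \<longleftrightarrow> P q x \<and> c' = (w, conf (\<delta> q x) (n + ?k) ?r)" for c'
    using step_machine[OF Cons.prems(2,3) x(1), of _ w n] st by (simp add: ctl_def)
  have "?R\<^sup>*\<^sup>* (x # w, conf q n r) ([], z, s) \<longleftrightarrow>
      P q x \<and> ?R\<^sup>*\<^sup>* (w, conf (\<delta> q x) (n + ?k) ?r) ([], z, s)"
    using step by (auto elim: converse_rtranclpE intro: converse_rtranclp_into_rtranclp)
  also have "\<dots> \<longleftrightarrow> P q x \<and> guarded_run \<delta> P (\<delta> q x) w \<and> (\<exists>n' r'. r' \<in> {-N..<N} \<and>
      2 * N * n' + r' = 2 * N * (n + ?k) + ?r + total_output \<delta> out (\<delta> q x) w \<and>
      (z, s) = conf (foldl \<delta> (\<delta> q x) w) n' r')"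
    using Cons.IH[OF x(2) closed[OF Cons.prems(2) x(1)] remainder_range[OF Cons.prems(3,2) x(1)], of "n + ?k"]
    by simp
  also have "2 * N * (n + ?k) + ?r + total_output \<delta> out (\<delta> q x) w =
      2 * N * n + r + total_output \<delta> out q (x # w)" by (simp add: algebra_simps)
  finally show ?case by simp
qed

lemma foldl_in_Q: "w \<in> lists X \<Longrightarrow> q \<in> Q \<Longrightarrow> foldl \<delta> q w \<in> Q"
  by (induction w arbitrary: q rule: list.induct) (auto simp: closed)

lemma accepts_machine:
  assumes "w \<in> lists X"
  shows "accepts_via Final_State machine (guarded_step machine (\<lambda>s. P (ctl s))) w \<longleftrightarrow>
    guarded_run \<delta> P q0 w \<and> foldl \<delta> q0 w \<in> Fin \<and> total_output \<delta> out q0 w = c"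
proof -
  have N0: "0 \<in> {-N..<N}" "c \<in> {-N..<N}" using N(2) by auto
  have init: "([start_symbol machine], start_state machine) = conf q0 0 0"
    by (simp add: machine_def height_stack_def clamp_def)
  have Q: "foldl \<delta> q0 w \<in> Q" using assms q0 by (rule foldl_in_Q)
  have fin: "enc (foldl \<delta> q0 w, r', n' = 0) \<in> final_states machine \<longleftrightarrow>
     foldl \<delta> q0 w \<in> Fin \<and> r' = c \<and> n' = 0" if "r' \<in> {-N..<N}" for n' r'
  proof -
    have "(foldl \<delta> q0 w, r', n' = 0) \<in> machine_states" using that Q by (simp add: machine_states_def)
    then have "enc (foldl \<delta> q0 w, r', n' = 0) \<in> final_states machine \<longleftrightarrow>
       (foldl \<delta> q0 w, r', n' = 0) \<in> machine_states \<inter> Fin \<times> {c} \<times> {True}"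
      using enc by (auto simp: machine_def machine_states_def[symmetric] inj_on_def)
    with \<open>_ \<in> machine_states\<close> show ?thesis by auto
  qed
  have "accepts_via Final_State machine (guarded_step machine (\<lambda>s. P (ctl s))) w \<longleftrightarrow>
    (\<exists>z s. (guarded_step machine (\<lambda>s. P (ctl s)))\<^sup>*\<^sup>* (w, conf q0 0 0) ([], z, s) \<and> s \<in> final_states machine)"
    unfolding accepts_via_def using init by simp
  also have "\<dots> \<longleftrightarrow> guarded_run \<delta> P q0 w \<and> (\<exists>n' r'. r' \<in> {-N..<N} \<and>
      2 * N * n' + r' = total_output \<delta> out q0 w \<and> foldl \<delta> q0 w \<in> Fin \<and> r' = c \<and> n' = 0)"
  proof -
    have run: "(guarded_step machine (\<lambda>s. P (ctl s)))\<^sup>*\<^sup>* (w, conf q0 0 0) ([], z, s) \<longleftrightarrow>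
      guarded_run \<delta> P q0 w \<and> (\<exists>n' r'. r' \<in> {-N..<N} \<and>
      2 * N * n' + r' = total_output \<delta> out q0 w \<and> (z, s) = conf (foldl \<delta> q0 w) n' r')" for z s
      using run_machine[OF assms q0 N0(1), of P 0] by simp
    show ?thesis
    proof
      assume "\<exists>z s. (guarded_step machine (\<lambda>s. P (ctl s)))\<^sup>*\<^sup>* (w, conf q0 0 0) ([], z, s) \<and>
        s \<in> final_states machine"
      then obtain n' r' where "guarded_run \<delta> P q0 w" "r' \<in> {-N..<N}"
        "2 * N * n' + r' = total_output \<delta> out q0 w"
        "enc (foldl \<delta> q0 w, r', n' = 0) \<in> final_states machine"
        unfolding run prod.inject by blast
      then show "guarded_run \<delta> P q0 w \<and> (\<exists>n' r'. r' \<in> {-N..<N} \<and>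
        2 * N * n' + r' = total_output \<delta> out q0 w \<and> foldl \<delta> q0 w \<in> Fin \<and> r' = c \<and> n' = 0)"
        using fin[of r' n'] by blast
    next
      assume "guarded_run \<delta> P q0 w \<and> (\<exists>n' r'. r' \<in> {-N..<N} \<and>
        2 * N * n' + r' = total_output \<delta> out q0 w \<and> foldl \<delta> q0 w \<in> Fin \<and> r' = c \<and> n' = 0)"
      then obtain n' r' where "guarded_run \<delta> P q0 w" "r' \<in> {-N..<N}"
        "2 * N * n' + r' = total_output \<delta> out q0 w" "foldl \<delta> q0 w \<in> Fin" "r' = c" "n' = 0"
        by blast
      moreover from this have "enc (foldl \<delta> q0 w, r', n' = 0) \<in> final_states machine"
        using fin[of r' n'] by blast
      ultimately have "(guarded_step machine (\<lambda>s. P (ctl s)))\<^sup>*\<^sup>* (w, conf q0 0 0)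
          ([], conf (foldl \<delta> q0 w) n' r')"
        by (intro run[THEN iffD2]) blast
      then show "\<exists>z s. (guarded_step machine (\<lambda>s. P (ctl s)))\<^sup>*\<^sup>* (w, conf q0 0 0) ([], z, s) \<and>
        s \<in> final_states machine"
        using \<open>enc (foldl \<delta> q0 w, r', n' = 0) \<in> final_states machine\<close> by blast
    qed
  qed
  also have "\<dots> \<longleftrightarrow> guarded_run \<delta> P q0 w \<and> foldl \<delta> q0 w \<in> Fin \<and> total_output \<delta> out q0 w = c"
    using N0 by auto
  finally show ?thesis .
qed

end

text \<open>
  The total output of a finite control is a single integer, updated by bounded amounts, so one stack
  suffices to keep it. The guard is a parameter of the conclusion: one automaton serves all ways of
  restricting its moves by the control state.
\<close>

theorem counter_dpda:
  fixes Q :: "'s set" and X :: "'x set"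
  assumes "finite X" "finite Q" "q0 \<in> Q" and "\<And>q x. q \<in> Q \<Longrightarrow> x \<in> X \<Longrightarrow> \<delta> q x \<in> Q"
  obtains M :: "(nat, 'x, nat) dpda" and ctl :: "nat \<Rightarrow> 's"
  where "is_dpda M" "input_alphabet M = X"
    "\<And>P w. w \<in> lists X \<Longrightarrow> accepts_via Final_State M (guarded_step M (\<lambda>s. P (ctl s))) w \<longleftrightarrow>
      guarded_run \<delta> P q0 w \<and> foldl \<delta> q0 w \<in> Fin \<and> total_output \<delta> out q0 w = c"
proof -
  \<comment> \<open>Bounds all outputs and exceeds \<open>\<bar>c\<bar>\<close>.\<close>
  define N where "N = Max (insert (\<bar>c\<bar> + 1) ((\<lambda>(q, x). \<bar>out q x\<bar>) ` (Q \<times> X)))"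
  have fin: "finite (insert (\<bar>c\<bar> + 1) ((\<lambda>(q, x). \<bar>out q x\<bar>) ` (Q \<times> X)))" using assms by simp
  have N1: "\<bar>out q x\<bar> \<le> N" if "q \<in> Q" "x \<in> X" for q x
    unfolding N_def using fin that by (intro Max_ge) auto
  have "\<bar>c\<bar> + 1 \<le> N" unfolding N_def using fin by (intro Max_ge) auto
  then have N2: "\<bar>c\<bar> < N" by simp
  have "finite (Q \<times> {-N..<N} \<times> (UNIV :: bool set))" using assms by simp
  then obtain enc :: "'s \<times> int \<times> bool \<Rightarrow> nat" where enc: "inj_on enc (Q \<times> {-N..<N} \<times> UNIV)"
    using finite_imp_inj_to_nat_seg by metis
  interpret counter_automaton X Q \<delta> out q0 Fin c N enc
    using assms N1 N2 enc by unfold_locales auto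
  show thesis
    by (rule that[OF is_dpda_machine _ accepts_machine]) (simp add: machine_def)
qed

section \<open>Synchronous two-tape relations with a counter\<close>

text \<open>
  The shorter word is padded at its end.
\<close>

fun convolution :: "'a list \<Rightarrow> 'a list \<Rightarrow> ('a option \<times> 'a option) list" where
  "convolution (a # u) (b # v) = (Some a, Some b) # convolution u v"
| "convolution [] v = map (\<lambda>b. (None, Some b)) v"
| "convolution u [] = map (\<lambda>a. (Some a, None)) u"

text \<open>
  How a device that consumes pairs of letters is run on two tapes: a letter of the left tape is
  remembered until the letter of the right tape at the same position is known, and once the end mark
  of one tape has been seen, the other tape alone is read.
\<close>

datatype ('q, 'a) control =
  Both 'q | Pending 'q 'a | LeftOnly 'q | RightOnly 'q | Done 'q | Dead

fun control_step ::
    "('q \<Rightarrow> 'a option \<times> 'a option \<Rightarrow> 'q) \<Rightarrow>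
     ('q, 'a) control \<Rightarrow> 'a endmarked + 'a endmarked \<Rightarrow> ('q, 'a) control" where
  "control_step \<delta> (Both q) (Inl (Letter a)) = Pending q a"
| "control_step \<delta> (Both q) (Inl Endmark) = RightOnly q"
| "control_step \<delta> (Pending q a) (Inr (Letter b)) = Both (\<delta> q (Some a, Some b))"
| "control_step \<delta> (Pending q a) (Inr Endmark) = LeftOnly (\<delta> q (Some a, None))"
| "control_step \<delta> (LeftOnly q) (Inl (Letter a)) = LeftOnly (\<delta> q (Some a, None))"
| "control_step \<delta> (LeftOnly q) (Inl Endmark) = Done q"
| "control_step \<delta> (RightOnly q) (Inr (Letter b)) = RightOnly (\<delta> q (None, Some b))"
| "control_step \<delta> (RightOnly q) (Inr Endmark) = Done q"
| "control_step \<delta> _ _ = Dead"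

fun control_output ::
    "('q \<Rightarrow> 'a option \<times> 'a option \<Rightarrow> int) \<Rightarrow>
     ('q, 'a) control \<Rightarrow> 'a endmarked + 'a endmarked \<Rightarrow> int" where
  "control_output out (Pending q a) (Inr (Letter b)) = out q (Some a, Some b)"
| "control_output out (Pending q a) (Inr Endmark) = out q (Some a, None)"
| "control_output out (LeftOnly q) (Inl (Letter a)) = out q (Some a, None)"
| "control_output out (RightOnly q) (Inr (Letter b)) = out q (None, Some b)"
| "control_output out _ _ = 0"

fun reads_left :: "('q, 'a) control \<Rightarrow> bool" where
  "reads_left (Both q) = True"
| "reads_left (LeftOnly q) = True"
| "reads_left _ = False"

text \<open>
  The states \<open>Done\<close> and \<open>Dead\<close>, too, must lie on one side of the partition; they are put on the right,
  which does no harm as no letter is left after \<open>Done\<close> and \<open>Dead\<close> is never left.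
\<close>

definition right_tape :: "('q, 'a) control \<Rightarrow> 'x + 'x \<Rightarrow> bool" where
  "right_tape s x = (case x of Inl _ \<Rightarrow> reads_left s | Inr _ \<Rightarrow> \<not> reads_left s)"

lemma right_tape_simps [simp]:
  "right_tape s (Inl x) = reads_left s" "right_tape s (Inr x) = (\<not> reads_left s)"
  by (simp_all add: right_tape_def)

text \<open>
  The only shuffle of the two words with end marks that the control can follow.
\<close>

fun schedule :: "'a list \<Rightarrow> 'a list \<Rightarrow> ('a endmarked + 'a endmarked) list" where
  "schedule (a # u) (b # v) = Inl (Letter a) # Inr (Letter b) # schedule u v"
| "schedule [] v = Inl Endmark # map Inr (endmark v)"
| "schedule u [] = Inl (Letter (hd u)) # Inr Endmark # map Inl (endmark (tl u))"

lemma endmark_simps [simp]: "endmark [] = [Endmark]" "endmark (a # u) = Letter a # endmark u"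
  by (simp_all add: endmark_def)

lemma shuffles_left_cases:
  assumes "w \<in> shuffles (Inl x # xs) (map Inr ys)"
  obtains w' where "w = Inl x # w'" "w' \<in> shuffles xs (map Inr ys)" | y w' where "w = Inr y # w'"
  using assms by (cases w) (auto simp: Cons_in_shuffles_iff hd_map)

lemma shuffles_right_cases:
  assumes "w \<in> shuffles (map Inl xs) (Inr y # ys)"
  obtains w' where "w = Inr y # w'" "w' \<in> shuffles (map Inl xs) ys" | x w' where "w = Inl x # w'"
  using assms by (cases w) (auto simp: Cons_in_shuffles_iff hd_map)

lemma guarded_RightOnly: "guarded_run (control_step \<delta>) right_tape (RightOnly q) (map Inr (endmark v))"
  by (induction v arbitrary: q) simp_all

lemma guarded_LeftOnly: "guarded_run (control_step \<delta>) right_tape (LeftOnly q) (map Inl (endmark v))"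
  by (induction v arbitrary: q) simp_all

lemma schedule_in_shuffles:
  "schedule u v \<in> shuffles (map Inl (endmark u)) (map Inr (endmark v))"
  by (induction u v rule: schedule.induct) (simp_all add: Cons_in_shuffles_iff)

lemma guarded_schedule: "guarded_run (control_step \<delta>) right_tape (Both q) (schedule u v)"
proof (induction u v arbitrary: q rule: schedule.induct)
  case (2 v)
  then show ?case using guarded_RightOnly by simp
next
  case (3 a u)
  then show ?case using guarded_LeftOnly by simp
qed simp_all

text \<open>
  The control state determines the tape of the next letter, and a shuffle is determined by the
  sequence of tapes. So although acceptance of a pair asks for some shuffle, only one can be read.
\<close>

lemma guarded_shuffle_unique:
  assumes "w \<in> shuffles (map Inl (endmark u)) (map Inr (endmark v))"
    and "guarded_run (control_step \<delta>) right_tape (Both q) w"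
  shows "w = schedule u v"
  using assms
proof (induction u v arbitrary: q w rule: schedule.induct)
  case (1 a u b v)
  from 1(2) have "w \<in> shuffles (Inl (Letter a) # map Inl (endmark u)) (map Inr (endmark (b # v)))"
    by simp
  then obtain w' where w': "w = Inl (Letter a) # w'"
    "w' \<in> shuffles (map Inl (endmark u)) (map Inr (endmark (b # v)))"
    by (cases rule: shuffles_left_cases) (use 1(3) in \<open>simp_all\<close>)
  then have "w' \<in> shuffles (map Inl (endmark u)) (Inr (Letter b) # map Inr (endmark v))" by simp
  then obtain w'' where "w' = Inr (Letter b) # w''"
    "w'' \<in> shuffles (map Inl (endmark u)) (map Inr (endmark v))"
    by (cases rule: shuffles_right_cases) (use 1(3) w' in \<open>simp_all\<close>)
  then show ?case using 1(1)[of w'' "\<delta> q (Some a, Some b)"] 1(3) w' by simp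
next
  case (2 v)
  then have "w \<in> shuffles (Inl Endmark # []) (map Inr (endmark v))" by simp
  then show ?case
    by (cases rule: shuffles_left_cases) (use 2 in \<open>simp_all\<close>)
next
  case (3 a u)
  then have "w \<in> shuffles (Inl (Letter a) # map Inl (endmark u)) (map Inr [Endmark])" by simp
  then obtain w' where w': "w = Inl (Letter a) # w'"
    "w' \<in> shuffles (map Inl (endmark u)) (map Inr [Endmark])"
    by (cases rule: shuffles_left_cases) (use 3 in \<open>simp_all\<close>)
  then have "w' \<in> shuffles (map Inl (endmark u)) (Inr Endmark # [])" by simp
  then show ?case
    by (cases rule: shuffles_right_cases) (use 3 w' in \<open>simp_all\<close>)
qed

lemma foldl_RightOnly:
  "foldl (control_step \<delta>) (RightOnly q) (map Inr (endmark v)) =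
     Done (foldl \<delta> q (map (\<lambda>b. (None, Some b)) v))"
  by (induction v arbitrary: q) simp_all

lemma foldl_LeftOnly:
  "foldl (control_step \<delta>) (LeftOnly q) (map Inl (endmark v)) =
     Done (foldl \<delta> q (map (\<lambda>b. (Some b, None)) v))"
  by (induction v arbitrary: q) simp_all

lemma total_output_RightOnly:
  "total_output (control_step \<delta>) (control_output out) (RightOnly q) (map Inr (endmark v)) =
     total_output \<delta> out q (map (\<lambda>b. (None, Some b)) v)"
  by (induction v arbitrary: q) simp_all

lemma total_output_LeftOnly:
  "total_output (control_step \<delta>) (control_output out) (LeftOnly q) (map Inl (endmark v)) =
     total_output \<delta> out q (map (\<lambda>b. (Some b, None)) v)"
  by (induction v arbitrary: q) simp_all

lemma run_schedule:
  "foldl (control_step \<delta>) (Both q) (schedule u v) = Done (foldl \<delta> q (convolution u v))"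
  "total_output (control_step \<delta>) (control_output out) (Both q) (schedule u v) =
     total_output \<delta> out q (convolution u v)"
  by (induction u v arbitrary: q rule: schedule.induct)
    (simp_all add: foldl_RightOnly foldl_LeftOnly total_output_RightOnly total_output_LeftOnly)

definition pair_letters :: "'a set \<Rightarrow> ('a option \<times> 'a option) set" where
  "pair_letters A = (insert None (Some ` A) \<times> insert None (Some ` A)) - {(None, None)}"

lemma convolution_in_lists:
  "u \<in> lists A \<Longrightarrow> v \<in> lists A \<Longrightarrow> convolution u v \<in> lists (pair_letters A)"
  by (induction u v rule: convolution.induct) (auto simp: pair_letters_def)

text \<open>
  Thus a two-tape relation is recognised as soon as a finite control that reads the padded pairs of
  letters, with an integer output at each step, ends in the right state with the right total.
\<close>

theorem synchronous_counter_relation: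
  fixes Q :: "'q set" and A :: "'a set"
  assumes "finite A" "finite Q" "q0 \<in> Q"
    and closed: "\<And>q p. q \<in> Q \<Longrightarrow> p \<in> pair_letters A \<Longrightarrow> \<delta> q p \<in> Q"
  shows "is_two_tape_language A {(u, v) \<in> lists A \<times> lists A.
    foldl \<delta> q0 (convolution u v) \<in> Fin \<and> total_output \<delta> out q0 (convolution u v) = c}"
proof -
  let ?X = "endmarked_alphabet A <+> endmarked_alphabet A"
  let ?C = "insert Dead (Both ` Q \<union> (\<lambda>(q, a). Pending q a) ` (Q \<times> A) \<union> LeftOnly ` Q \<union> RightOnly ` Q \<union> Done ` Q)"
  have fin: "finite ?X" "finite ?C" using assms by (simp_all add: endmarked_alphabet_def)
  have start: "Both q0 \<in> ?C" using assms by simp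
  have cl: "control_step \<delta> s x \<in> ?C" if s: "s \<in> ?C" and x: "x \<in> ?X" for s x
    using s x
    by (cases "(\<delta>, s, x)" rule: control_step.cases)
      (auto simp: endmarked_alphabet_def pair_letters_def intro!: closed)
  obtain T :: "(nat, 'a endmarked + 'a endmarked, nat) dpda" and ctl :: "nat \<Rightarrow> ('q, 'a) control"
    where T: "is_dpda T" "input_alphabet T = ?X"
    and acc: "\<And>P w. w \<in> lists ?X \<Longrightarrow>
      accepts_via Final_State T (guarded_step T (\<lambda>s. P (ctl s))) w \<longleftrightarrow>
      guarded_run (control_step \<delta>) P (Both q0) w \<and>
      foldl (control_step \<delta>) (Both q0) w \<in> Done ` Fin \<and>
      total_output (control_step \<delta>) (control_output out) (Both q0) w = c"
    by (rule counter_dpda[OF fin start cl, where Fin = "Done ` Fin" and out = "control_output out" and c = c]) blast+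
  define S1 where "S1 = {s \<in> states T. reads_left (ctl s)}"
  define S2 where "S2 = states T - S1"
  have two: "is_two_tape_dpda A T S1 S2"
    using T by (auto simp: is_two_tape_dpda_def S1_def S2_def)
  have state: "s \<in> states T" if "dpda_move T a (w, z, s) c'" for a w z s c'
    using that
  proof cases
    case (1 b t \<alpha> v y)
    then have "(a, b, s) \<in> dom (trans_map T)" by auto
    then show ?thesis using T(1) by (auto simp: is_dpda_def)
  qed
  have step: "two_tape_step T S1 S2 = guarded_step T (\<lambda>s. right_tape (ctl s))"
    unfolding two_tape_step_def guarded_step_def
    using state by (auto simp: fun_eq_iff S1_def S2_def right_tape_def split: sum.splits)
  have lists: "w \<in> lists ?X"
    if "is_shuffle (endmark u) (endmark v) w" "u \<in> lists A" "v \<in> lists A" for u v w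
  proof -
    have "set w = Inl ` set (endmark u) \<union> Inr ` set (endmark v)"
      using that(1) set_shuffles[of w "map Inl (endmark u)" "map Inr (endmark v)"]
      by (simp add: is_shuffle_iff_shuffles)
    then show ?thesis using that(2,3) by (auto simp: endmark_def endmarked_alphabet_def)
  qed
  have "two_tape_lang Final_State A T S1 S2 = {(u, v) \<in> lists A \<times> lists A.
    foldl \<delta> q0 (convolution u v) \<in> Fin \<and> total_output \<delta> out q0 (convolution u v) = c}"
  proof -
    have "(\<exists>w. is_shuffle (endmark u) (endmark v) w \<and>
           accepts_via Final_State T (two_tape_step T S1 S2) w) \<longleftrightarrow>
       foldl \<delta> q0 (convolution u v) \<in> Fin \<and> total_output \<delta> out q0 (convolution u v) = c"
      if uv: "u \<in> lists A" "v \<in> lists A" for u v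
    proof -
      have "is_shuffle (endmark u) (endmark v) w \<and> accepts_via Final_State T (two_tape_step T S1 S2) w
        \<longleftrightarrow> w = schedule u v \<and> foldl (control_step \<delta>) (Both q0) w \<in> Done ` Fin \<and>
          total_output (control_step \<delta>) (control_output out) (Both q0) w = c" for w
        using acc[OF lists[OF _ uv], of w right_tape] guarded_shuffle_unique[of w u v \<delta> q0]
          schedule_in_shuffles[of u v] guarded_schedule[of \<delta> q0 u v]
        unfolding step is_shuffle_iff_shuffles by blast
      then show ?thesis by (auto simp: run_schedule)
    qed
    then show ?thesis unfolding two_tape_lang_def by blast
  qed
  with two show ?thesis unfolding is_two_tape_language_def by metis
qed

lemma is_ATP_Int:
  assumes "is_ATP A R" "is_ATP A S"
  shows "is_ATP A (R \<inter> S)"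
proof -
  obtain \<R> \<S> where "finite \<R>" "\<R> \<noteq> {}" "\<forall>X \<in> \<R>. is_two_tape_language A X" "R = \<Inter>\<R>"
    "finite \<S>" "\<S> \<noteq> {}" "\<forall>X \<in> \<S>. is_two_tape_language A X" "S = \<Inter>\<S>"
    using assms unfolding is_ATP_def by auto
  then show ?thesis
    unfolding is_ATP_def by (intro exI[of _ "\<R> \<union> \<S>"]) auto
qed

lemma is_ATP_INT:
  assumes "finite I" "I \<noteq> {}" "\<And>i. i \<in> I \<Longrightarrow> is_two_tape_language A (R i)"
  shows "is_ATP A (\<Inter>i\<in>I. R i)"
  unfolding is_ATP_def using assms by (intro exI[of _ "R ` I"]) auto

section \<open>Regular languages\<close>

lemma regular_languageI:
  fixes Q :: "'q set"
  assumes "finite Q" "q0 \<in> Q" and closed: "\<And>q a. q \<in> Q \<Longrightarrow> a \<in> A \<Longrightarrow> \<delta> q a \<in> Q"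
  shows "regular_language A {w \<in> lists A. foldl \<delta> q0 w \<in> F}"
proof -
  obtain e :: "'q \<Rightarrow> nat" where e: "inj_on e Q"
    using finite_imp_inj_to_nat_seg[OF assms(1)] by metis
  define d where "d n a = e (\<delta> (inv_into Q e n) a)" for n a
  have run: "q \<in> Q \<Longrightarrow> w \<in> lists A \<Longrightarrow> foldl \<delta> q w \<in> Q \<and> foldl d (e q) w = e (foldl \<delta> q w)" for q w
    by (induction w arbitrary: q rule: list.induct) (use e closed in \<open>auto simp: d_def\<close>)
  have "{w \<in> lists A. foldl \<delta> q0 w \<in> F} = {w \<in> lists A. foldl d (e q0) w \<in> e ` (F \<inter> Q)}"
  proof (rule Collect_cong, rule conj_cong[OF refl])
    fix w assume "w \<in> lists A"
    then have "foldl \<delta> q0 w \<in> Q" "foldl d (e q0) w = e (foldl \<delta> q0 w)"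
      using run[OF assms(2)] by blast+
    then show "foldl \<delta> q0 w \<in> F \<longleftrightarrow> foldl d (e q0) w \<in> e ` (F \<inter> Q)"
      using e by (auto dest: inj_onD)
  qed
  moreover have "\<forall>q \<in> e ` Q. \<forall>a \<in> A. d q a \<in> e ` Q"
    using e closed by (auto simp: d_def)
  ultimately show ?thesis
    unfolding regular_language_def using assms(1,2)
    by (intro exI[of _ "e ` Q"] exI[of _ d] exI[of _ "e q0"] exI[of _ "e ` (F \<inter> Q)"]) auto
qed

lemma regular_languageE:
  assumes "regular_language A L"
  obtains Q :: "nat set" and \<delta> q0 F where "finite Q" "q0 \<in> Q"
    "\<And>q a. q \<in> Q \<Longrightarrow> a \<in> A \<Longrightarrow> \<delta> q a \<in> Q" "L = {w \<in> lists A. foldl \<delta> q0 w \<in> F}"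
  using assms unfolding regular_language_def by blast

lemma regular_language_subset: "regular_language A L \<Longrightarrow> L \<subseteq> lists A"
  by (auto simp: regular_language_def)

lemma total_output_zero [simp]: "total_output \<delta> (\<lambda>_ _. 0) q w = 0"
  by (induction w arbitrary: q) simp_all

lemma guarded_run_True [simp]: "guarded_run \<delta> (\<lambda>_ _. True) q w"
  by (induction w arbitrary: q) simp_all

lemma regular_imp_P_language:
  fixes A :: "'a set"
  assumes "finite A" "regular_language A L"
  shows "is_P_language A L"
proof -
  obtain Q :: "nat set" and \<delta> q0 F where Q: "finite Q" "q0 \<in> Q"
    "\<And>q a. q \<in> Q \<Longrightarrow> a \<in> A \<Longrightarrow> \<delta> q a \<in> Q" and L: "L = {w \<in> lists A. foldl \<delta> q0 w \<in> F}"
    by (rule regular_languageE[OF assms(2)]) blast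
  obtain M :: "(nat, 'a, nat) dpda" and ctl :: "nat \<Rightarrow> nat"
    where M: "is_dpda M" "input_alphabet M = A" and acc:
      "\<And>P w. w \<in> lists A \<Longrightarrow> accepts_via Final_State M (guarded_step M (\<lambda>s. P (ctl s))) w \<longleftrightarrow>
      guarded_run \<delta> P q0 w \<and> foldl \<delta> q0 w \<in> F \<and> total_output \<delta> (\<lambda>_ _. 0) q0 w = 0"
    by (rule counter_dpda[OF assms(1) Q, where Fin = F and out = "\<lambda>_ _. 0" and c = 0]) blast+
  have "L = dpda_lang Final_State M"
    using acc[of _ "\<lambda>_ _. True"]
    by (auto simp: L dpda_lang_def M dpda_step_eq_guarded_step)
  then have "is_dpda_language A L"
    using M unfolding is_dpda_language_def by blast
  then show ?thesis
    unfolding is_P_language_def by (intro exI[of _ "{L}"]) simp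
qed

lemma foldl_convolution_fst:
  "foldl (\<lambda>q p. case fst p of None \<Rightarrow> q | Some a \<Rightarrow> \<delta> q a) q (convolution u v) = foldl \<delta> q u"
proof (induction u v arbitrary: q rule: convolution.induct)
  case (2 v)
  show ?case by (induction v) simp_all
qed (simp_all add: foldl_map)

lemma foldl_convolution_snd:
  "foldl (\<lambda>q p. case snd p of None \<Rightarrow> q | Some a \<Rightarrow> \<delta> q a) q (convolution u v) = foldl \<delta> q v"
proof (induction u v arbitrary: q rule: convolution.induct)
  case (3 a u)
  have "foldl (\<lambda>q p. case snd p of None \<Rightarrow> q | Some a \<Rightarrow> \<delta> q a) q (map (\<lambda>a. (Some a, None)) w) = q" for w
    by (induction w) simp_all
  from this[of "a # u"] show ?case by simp
qed (simp_all add: foldl_map)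

text \<open>
  A condition on one of the two words is a synchronous relation with zero output: the other tape is
  ignored.
\<close>

lemma is_ATP_regular_components:
  assumes "finite A" "regular_language A L"
  shows "is_ATP A {(u, v) \<in> lists A \<times> lists A. u \<in> L}" "is_ATP A {(u, v) \<in> lists A \<times> lists A. v \<in> L}"
proof -
  obtain Q :: "nat set" and \<delta> q0 F where Q: "finite Q" "q0 \<in> Q"
    "\<And>q a. q \<in> Q \<Longrightarrow> a \<in> A \<Longrightarrow> \<delta> q a \<in> Q" and L: "L = {w \<in> lists A. foldl \<delta> q0 w \<in> F}"
    by (rule regular_languageE[OF assms(2)]) blast
  have "is_two_tape_language A {(u, v) \<in> lists A \<times> lists A.
    foldl (\<lambda>q p. case sel p of None \<Rightarrow> q | Some a \<Rightarrow> \<delta> q a) q0 (convolution u v) \<in> F \<and>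
    total_output (\<lambda>q p. case sel p of None \<Rightarrow> q | Some a \<Rightarrow> \<delta> q a) (\<lambda>_ _. 0) q0 (convolution u v) = 0}"
    if "sel \<in> {fst, snd}" for sel
    by (rule synchronous_counter_relation[OF assms(1) Q(1,2)])
      (use that Q(3) in \<open>auto simp: pair_letters_def split: option.splits\<close>)
  note two = this
  have "is_two_tape_language A {(u, v) \<in> lists A \<times> lists A. u \<in> L}"
    using two[of fst] by (simp add: foldl_convolution_fst L conj_commute cong: conj_cong)
  moreover have "is_two_tape_language A {(u, v) \<in> lists A \<times> lists A. v \<in> L}"
    using two[of snd] by (simp add: foldl_convolution_snd L conj_commute cong: conj_cong)
  ultimately show "is_ATP A {(u, v) \<in> lists A \<times> lists A. u \<in> L}" "is_ATP A {(u, v) \<in> lists A \<times> lists A. v \<in> L}"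
    using is_ATP_INT[of "{()}" A] by auto
qed

lemma regular_language_image:
  assumes "regular_language A L" "inj_on f A"
  shows "regular_language (f ` A) (map f ` L)"
proof -
  obtain Q :: "nat set" and \<delta> q0 F where Q: "finite Q" "q0 \<in> Q"
    "\<And>q a. q \<in> Q \<Longrightarrow> a \<in> A \<Longrightarrow> \<delta> q a \<in> Q" and L: "L = {w \<in> lists A. foldl \<delta> q0 w \<in> F}"
    by (rule regular_languageE[OF assms(1)]) blast
  define d where "d q b = \<delta> q (inv_into A f b)" for q b
  have run: "foldl d q (map f w) = foldl \<delta> q w" if "w \<in> lists A" for w q
    using that by (induction w arbitrary: q rule: list.induct) (use assms(2) in \<open>auto simp: d_def\<close>)
  have "map f ` L = {w \<in> lists (f ` A). foldl d q0 w \<in> F}"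
  proof (intro equalityI subsetI)
    fix w assume "w \<in> {w \<in> lists (f ` A). foldl d q0 w \<in> F}"
    then obtain v where "v \<in> lists A" "w = map f v" "foldl d q0 w \<in> F"
      by (auto simp: lists_image)
    then show "w \<in> map f ` L" using run[of v q0] by (simp add: L)
  next
    fix w assume "w \<in> map f ` L"
    then obtain v where "v \<in> lists A" "w = map f v" "foldl \<delta> q0 v \<in> F" by (auto simp: L)
    then show "w \<in> {w \<in> lists (f ` A). foldl d q0 w \<in> F}" using run[of v q0] by auto
  qed
  moreover have "regular_language (f ` A) \<dots>"
    by (rule regular_languageI[OF Q(1,2)]) (use Q(3) assms(2) in \<open>auto simp: d_def\<close>)
  ultimately show ?thesis by simp
qed

text \<open>
  Because the alphabets are disjoint, the first letter from \<open>B\<close> reveals where the second factor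
  starts, and the automaton for the product needs no guessing. Its state is \<open>Inl q\<close> in the first
  factor, \<open>Inr q\<close> in the second and \<open>None\<close> after a violation.
\<close>

lemma regular_language_append:
  assumes "regular_language A L" "regular_language B M" "A \<inter> B = {}"
  shows "regular_language (A \<union> B) ((\<lambda>(u, v). u @ v) ` (L \<times> M))"
proof -
  obtain Q :: "nat set" and \<delta> q0 F where Q: "finite Q" "q0 \<in> Q"
    "\<And>q a. q \<in> Q \<Longrightarrow> a \<in> A \<Longrightarrow> \<delta> q a \<in> Q" and L: "L = {w \<in> lists A. foldl \<delta> q0 w \<in> F}"
    by (rule regular_languageE[OF assms(1)]) blast
  obtain Q' :: "nat set" and \<delta>' q0' F' where Q': "finite Q'" "q0' \<in> Q'"
    "\<And>q a. q \<in> Q' \<Longrightarrow> a \<in> B \<Longrightarrow> \<delta>' q a \<in> Q'" and M: "M = {w \<in> lists B. foldl \<delta>' q0' w \<in> F'}"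
    by (rule regular_languageE[OF assms(2)]) blast
  define d where "d s a = (case s of None \<Rightarrow> None
    | Some (Inl q) \<Rightarrow> if a \<in> A then Some (Inl (\<delta> q a))
        else if q \<in> F then Some (Inr (\<delta>' q0' a)) else None
    | Some (Inr q) \<Rightarrow> if a \<in> A then None else Some (Inr (\<delta>' q a)))" for s a
  define Fin where "Fin = Some ` (Inl ` (if q0' \<in> F' then F else {}) \<union> Inr ` F')"
  have d [simp]: "d None a = None"
    "d (Some (Inl q)) a = (if a \<in> A then Some (Inl (\<delta> q a))
        else if q \<in> F then Some (Inr (\<delta>' q0' a)) else None)"
    "d (Some (Inr q)) a = (if a \<in> A then None else Some (Inr (\<delta>' q a)))" for a q
    by (simp_all add: d_def)
  have dead: "foldl d None w \<notin> Fin" for w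
    by (induction w) (auto simp: Fin_def)
  have right: "foldl d (Some (Inr q)) w \<in> Fin \<longleftrightarrow> w \<in> lists B \<and> foldl \<delta>' q w \<in> F'"
    if "w \<in> lists (A \<union> B)" for q w
    using that
  proof (induction w arbitrary: q rule: list.induct)
    case Nil
    then show ?case by (auto simp: Fin_def)
  next
    case (Cons a w)
    then show ?case using assms(3) dead by (cases "a \<in> A") auto
  qed
  have left: "foldl d (Some (Inl q)) w \<in> Fin \<longleftrightarrow>
    (\<exists>u v. w = u @ v \<and> u \<in> lists A \<and> v \<in> lists B \<and> foldl \<delta> q u \<in> F \<and> foldl \<delta>' q0' v \<in> F')"
    if "w \<in> lists (A \<union> B)" for q w
    using that
  proof (induction w arbitrary: q rule: list.induct)
    case Nil
    then show ?case by (auto simp: Fin_def)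
  next
    case (Cons a w)
    then have w: "w \<in> lists (A \<union> B)" "a \<in> A \<union> B" by auto
    show ?case
    proof (cases "a \<in> A")
      case True
      then have "foldl d (Some (Inl q)) (a # w) \<in> Fin \<longleftrightarrow> (\<exists>u v. w = u @ v \<and> u \<in> lists A \<and>
        v \<in> lists B \<and> foldl \<delta> (\<delta> q a) u \<in> F \<and> foldl \<delta>' q0' v \<in> F')"
        using Cons.IH[OF w(1)] by simp
      also have "\<dots> \<longleftrightarrow> (\<exists>u v. a # w = u @ v \<and> u \<in> lists A \<and> v \<in> lists B \<and>
        foldl \<delta> q u \<in> F \<and> foldl \<delta>' q0' v \<in> F')"
      proof
        assume "\<exists>u v. w = u @ v \<and> u \<in> lists A \<and>
          v \<in> lists B \<and> foldl \<delta> (\<delta> q a) u \<in> F \<and> foldl \<delta>' q0' v \<in> F'"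
        then obtain u v where "w = u @ v" "u \<in> lists A" "v \<in> lists B"
          "foldl \<delta> (\<delta> q a) u \<in> F" "foldl \<delta>' q0' v \<in> F'" by blast
        then show "\<exists>u v. a # w = u @ v \<and> u \<in> lists A \<and> v \<in> lists B \<and>
          foldl \<delta> q u \<in> F \<and> foldl \<delta>' q0' v \<in> F'"
          using True by (intro exI[of _ "a # u"] exI[of _ v]) auto
      next
        assume "\<exists>u v. a # w = u @ v \<and> u \<in> lists A \<and> v \<in> lists B \<and>
          foldl \<delta> q u \<in> F \<and> foldl \<delta>' q0' v \<in> F'"
        then obtain u v where uv: "a # w = u @ v" "u \<in> lists A" "v \<in> lists B"
          "foldl \<delta> q u \<in> F" "foldl \<delta>' q0' v \<in> F'" by blast
        then obtain u' where "u = a # u'" using True assms(3) by (cases u) auto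
        with uv show "\<exists>u v. w = u @ v \<and> u \<in> lists A \<and>
          v \<in> lists B \<and> foldl \<delta> (\<delta> q a) u \<in> F \<and> foldl \<delta>' q0' v \<in> F'"
          by (intro exI[of _ u'] exI[of _ v]) auto
      qed
      finally show ?thesis .
    next
      case False
      then have "foldl d (Some (Inl q)) (a # w) \<in> Fin \<longleftrightarrow>
        q \<in> F \<and> w \<in> lists B \<and> foldl \<delta>' (\<delta>' q0' a) w \<in> F'"
        using right[OF w(1)] dead by simp
      moreover have "(\<exists>u v. a # w = u @ v \<and> u \<in> lists A \<and> v \<in> lists B \<and>
          foldl \<delta> q u \<in> F \<and> foldl \<delta>' q0' v \<in> F') \<longleftrightarrow>
        q \<in> F \<and> w \<in> lists B \<and> foldl \<delta>' (\<delta>' q0' a) w \<in> F'"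
      proof
        assume "q \<in> F \<and> w \<in> lists B \<and> foldl \<delta>' (\<delta>' q0' a) w \<in> F'"
        then show "\<exists>u v. a # w = u @ v \<and> u \<in> lists A \<and> v \<in> lists B \<and>
            foldl \<delta> q u \<in> F \<and> foldl \<delta>' q0' v \<in> F'"
          using False w(2) by (intro exI[of _ "[]"] exI[of _ "a # w"]) auto
      qed (use False w(2) in \<open>auto simp: Cons_eq_append_conv\<close>)
      ultimately show ?thesis by simp
    qed
  qed
  have "regular_language (A \<union> B) {w \<in> lists (A \<union> B). foldl d (Some (Inl q0)) w \<in> Fin}"
  proof (rule regular_languageI)
    show "finite (insert None (Some ` (Q <+> Q')))" using Q(1) Q'(1) by simp
    show "Some (Inl q0) \<in> insert None (Some ` (Q <+> Q'))" using Q(2) by auto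
    show "d s a \<in> insert None (Some ` (Q <+> Q'))"
      if "s \<in> insert None (Some ` (Q <+> Q'))" "a \<in> A \<union> B" for s a
      using that Q(2,3) Q'(2,3) by (cases "a \<in> A") (auto simp: inj_image_mem_iff)
  qed
  also have "{w \<in> lists (A \<union> B). foldl d (Some (Inl q0)) w \<in> Fin} = (\<lambda>(u, v). u @ v) ` (L \<times> M)"
  proof (intro equalityI subsetI)
    fix w assume "w \<in> {w \<in> lists (A \<union> B). foldl d (Some (Inl q0)) w \<in> Fin}"
    then obtain u v where "w = u @ v" "u \<in> L" "v \<in> M"
      using left[of w q0] unfolding L M by blast
    then show "w \<in> (\<lambda>(u, v). u @ v) ` (L \<times> M)" by auto
  next
    fix w assume "w \<in> (\<lambda>(u, v). u @ v) ` (L \<times> M)"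
    then obtain u v where uv: "w = u @ v" "u \<in> L" "v \<in> M" by auto
    then have "w \<in> lists (A \<union> B)" by (auto simp: L M)
    with left[of w q0] uv show "w \<in> {w \<in> lists (A \<union> B). foldl d (Some (Inl q0)) w \<in> Fin}"
      unfolding L M by blast
  qed
  finally show ?thesis .
qed

text \<open>
  Only the length matters; it is counted up to \<open>2\<close>.
\<close>

lemma regular_language_letters: "regular_language T ((\<lambda>t. [t]) ` T)"
proof -
  define d where "d n a = min 2 (Suc n)" for n :: nat and a :: 'a
  have run: "foldl d n w = min 2 (n + length w)" if "n \<le> 2" for n w
    using that
  proof (induction w arbitrary: n)
    case (Cons a w)
    then show ?case using Cons.IH[of "d n a"] by (simp add: d_def)
  qed simp
  have "regular_language T {w \<in> lists T. foldl d 0 w \<in> {1}}"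
    by (rule regular_languageI[of "{..2}"]) (auto simp: d_def)
  also have "{w \<in> lists T. foldl d 0 w \<in> {1}} = (\<lambda>t. [t]) ` T"
    by (auto simp: run length_Suc_conv min_def split: if_splits)
  finally show ?thesis .
qed

text \<open>
  A word over two letters is a power of one of them if it does not contain both, so it is enough
  to remember the set of letters seen; \<open>None\<close> stands for the empty word.
\<close>

lemma regular_language_powers:
  assumes "a \<noteq> b"
  shows "regular_language {a, b} (range (\<lambda>n. replicate n a) \<union> range (\<lambda>n. replicate n b))"
proof -
  define d where "d s x = (case s of None \<Rightarrow> Some {x} | Some X \<Rightarrow> Some (insert x X))" for s and x :: 'a
  have run: "foldl d None w = (if w = [] then None else Some (set w))" for w
    by (induction w rule: rev_induct) (auto simp: d_def)
  have "regular_language {a, b} {w \<in> lists {a, b}. foldl d None w \<in> {None, Some {a}, Some {b}}}"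
    by (rule regular_languageI[of "insert None (Some ` Pow {a, b})"])
      (auto simp: d_def split: option.splits)
  also have "{w \<in> lists {a, b}. foldl d None w \<in> {None, Some {a}, Some {b}}} =
      range (\<lambda>n. replicate n a) \<union> range (\<lambda>n. replicate n b)"
  proof -
    have rep: "(\<exists>n. w = replicate n x) \<longleftrightarrow> w = [] \<or> set w = {x}" for w and x :: 'a
      by (metis replicate_0 replicate_length_same set_replicate_conv_if singletonD)
    have "{w \<in> lists {a, b}. foldl d None w \<in> {None, Some {a}, Some {b}}} =
        {w. w = [] \<or> set w = {a} \<or> set w = {b}}"
      by (auto simp: run)
    also have "\<dots> = {w. (\<exists>n. w = replicate n a) \<or> (\<exists>n. w = replicate n b)}"
      unfolding rep by blast
    finally show ?thesis by auto
  qed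
  finally show ?thesis .
qed

section \<open>Unique representatives in automatic groups\<close>

lemma word_value_simps [simp]:
  "word_value G \<phi> [] = \<one>\<^bsub>G\<^esub>"
  "word_value G \<phi> (a # w) = \<phi> a \<otimes>\<^bsub>G\<^esub> word_value G \<phi> w"
  by (simp_all add: word_value_def)

lemma word_value_map: "word_value G \<phi> (map f w) = word_value G (\<phi> \<circ> f) w"
  by (induction w) simp_all

lemma word_value_cong:
  "(\<And>a. a \<in> set w \<Longrightarrow> \<phi> a = \<psi> a) \<Longrightarrow> word_value G \<phi> w = word_value G \<psi> w"
  by (induction w) simp_all

lemma (in group) word_value_closed [intro]:
  "\<phi> \<in> A \<rightarrow> carrier G \<Longrightarrow> w \<in> lists A \<Longrightarrow> word_value G \<phi> w \<in> carrier G"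
  by (induction w rule: list.induct) auto

lemma (in group) word_value_append:
  "\<phi> \<in> A \<rightarrow> carrier G \<Longrightarrow> u \<in> lists A \<Longrightarrow> v \<in> lists A \<Longrightarrow>
    word_value G \<phi> (u @ v) = word_value G \<phi> u \<otimes> word_value G \<phi> v"
  by (induction u rule: list.induct) (auto simp: m_assoc word_value_closed Pi_iff)

lemma (in group_hom) hom_word_value:
  "\<phi> \<in> A \<rightarrow> carrier G \<Longrightarrow> w \<in> lists A \<Longrightarrow>
    h (word_value G \<phi> w) = word_value H (h \<circ> \<phi>) w"
  by (induction w rule: list.induct) (auto simp: G.word_value_closed Pi_iff)

lemma take_in_lists [simp]: "w \<in> lists A \<Longrightarrow> take t w \<in> lists A"
  by (auto dest: in_set_takeD)

lemma word_metric_le_imp_short: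
  assumes "group G" "A \<subseteq> carrier G" "word_value G id ` lists A = carrier G"
    and gh: "g \<in> carrier G" "h \<in> carrier G" and "word_metric G A g h \<le> n"
  shows "inv\<^bsub>G\<^esub> g \<otimes>\<^bsub>G\<^esub> h \<in> word_value G id ` {w. w \<in> lists A \<and> length w \<le> n}"
proof -
  interpret group G by fact
  have closed: "word_value G id w \<in> carrier G" if "w \<in> lists A" for w
    using assms(2) that by (intro word_value_closed[of id A]) auto
  define P where "P k \<longleftrightarrow> (\<exists>w \<in> lists A. length w = k \<and> g \<otimes>\<^bsub>G\<^esub> word_value G id w = h)" for k
  have "inv\<^bsub>G\<^esub> g \<otimes>\<^bsub>G\<^esub> h \<in> carrier G" using gh by simp
  then obtain w where "w \<in> lists A" "word_value G id w = inv\<^bsub>G\<^esub> g \<otimes>\<^bsub>G\<^esub> h"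
    using assms(3) by (metis (mono_tags) imageE)
  then have "P (length w)" using gh unfolding P_def by (auto simp: m_assoc[symmetric])
  then have "P (word_metric G A g h)" unfolding word_metric_def P_def[symmetric] by (rule LeastI)
  then obtain w where w: "w \<in> lists A" "length w = word_metric G A g h" "g \<otimes>\<^bsub>G\<^esub> word_value G id w = h"
    unfolding P_def by blast
  then have "inv\<^bsub>G\<^esub> g \<otimes>\<^bsub>G\<^esub> h = word_value G id w" using gh closed[OF w(1)] by (auto simp: m_assoc[symmetric])
  with w assms(6) show ?thesis by auto
qed

lemma word_metric_le_one:
  assumes "group G" "g \<in> carrier G" "h = g \<or> (\<exists>a \<in> A. a \<in> carrier G \<and> h = g \<otimes>\<^bsub>G\<^esub> a)"
  shows "word_metric G A g h \<le> 1"
proof -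
  interpret group G by fact
  obtain w where w: "w \<in> lists A" "length w \<le> 1" "g \<otimes>\<^bsub>G\<^esub> word_value G id w = h"
  proof -
    from assms(3) consider "h = g" | a where "a \<in> A" "a \<in> carrier G" "h = g \<otimes>\<^bsub>G\<^esub> a" by blast
    then show thesis
      by cases (use assms(2) in \<open>auto intro: that[of "[]"] that[of "[_]"]\<close>)
  qed
  then have "word_metric G A g h \<le> length w"
    unfolding word_metric_def by (intro Least_le) auto
  with w show ?thesis by simp
qed

text \<open>
  The fellow-traveller property in the form that automata can use: along two words whose values are
  equal or differ by a letter, all differences lie in one finite set \<open>B\<close>.
\<close>

locale fellow_travelling_language = group H for H :: "('h, 'n) monoid_scheme" (structure) +
  fixes A :: "'h set" and L :: "'h list set" and B :: "'h set"
  assumes finite_A: "finite A" and A_carrier: "A \<subseteq> carrier H"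
    and regular_L: "regular_language A L"
    and finite_B: "finite B" and one_B: "\<one> \<in> B"
    and fellow_equal: "\<And>u v t. u \<in> L \<Longrightarrow> v \<in> L \<Longrightarrow> word_value H id v = word_value H id u \<Longrightarrow>
      inv (word_value H id (take t u)) \<otimes> word_value H id (take t v) \<in> B"
    and fellow_letter: "\<And>u v a t. u \<in> L \<Longrightarrow> v \<in> L \<Longrightarrow> a \<in> A \<Longrightarrow>
      word_value H id v = word_value H id u \<otimes> a \<Longrightarrow>
      inv (word_value H id (take t u)) \<otimes> word_value H id (take t v) \<in> B"
begin

abbreviation val :: "'h list \<Rightarrow> 'h" where
  "val \<equiv> word_value H id"

lemma val_closed [simp]: "w \<in> lists A \<Longrightarrow> val w \<in> carrier H"
  using A_carrier by (intro word_value_closed[of id A]) auto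

lemma val_append: "u \<in> lists A \<Longrightarrow> v \<in> lists A \<Longrightarrow> val (u @ v) = val u \<otimes> val v"
  using A_carrier by (intro word_value_append[of id A]) auto

end

text \<open>
  To select one word for each value, words are compared by their value as a numeral in base \<open>K\<close>, with
  a leading digit \<open>1\<close> in front of the digits of the letters. This is the order by length and then
  lexicographically, but it is an order of natural numbers, and it grows at the right end, where
  automata read.
\<close>

locale ranked_language = fellow_travelling_language H A L B
  for H :: "('h, 'n) monoid_scheme" (structure) and A L B +
  fixes digit :: "'h \<Rightarrow> nat" and K :: nat
  assumes inj_digit: "inj_on digit A" and digit_less: "\<And>a. a \<in> A \<Longrightarrow> digit a < K"
    and two_le_K: "2 \<le> K"
begin

definition rank :: "'h list \<Rightarrow> nat" where
  "rank = foldl (\<lambda>n a. K * n + digit a) 1"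

lemma rank_Nil [simp]: "rank [] = 1"
  by (simp add: rank_def)

lemma rank_snoc [simp]: "rank (w @ [a]) = K * rank w + digit a"
  by (simp add: rank_def)

lemma rank_bounds: "w \<in> lists A \<Longrightarrow> K ^ length w \<le> rank w \<and> rank w < 2 * K ^ length w"
proof (induction w rule: rev_induct)
  case (snoc a w)
  then have IH: "K ^ length w \<le> rank w" "Suc (rank w) \<le> 2 * K ^ length w" and a: "digit a < K"
    by (auto simp: digit_less)
  have "K ^ length (w @ [a]) \<le> rank (w @ [a])"
    by (simp add: trans_le_add1[OF mult_le_mono2[OF IH(1)]])
  moreover have "rank (w @ [a]) < 2 * K ^ length (w @ [a])"
    using mult_le_mono2[OF IH(2), of K] a by (simp del: mult_le_cancel1)
  ultimately show ?case by simp
qed simp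

lemma rank_less_snoc:
  assumes "v \<in> lists A" "u \<in> lists A" "length v \<le> length u" "a \<in> A"
  shows "rank v < rank (u @ [a])"
proof -
  have "rank v < 2 * K ^ length v" using rank_bounds[OF assms(1)] by simp
  also have "\<dots> \<le> K * K ^ length u"
    using two_le_K assms(3) by (intro mult_le_mono power_increasing) auto
  also have "\<dots> \<le> rank (u @ [a])" using rank_bounds[OF assms(2)] by (simp add: trans_le_add1)
  finally show ?thesis .
qed

lemma rank_le_imp_length_le:
  assumes "v \<in> lists A" "u \<in> lists A" "rank v \<le> rank u"
  shows "length v \<le> length u"
proof (rule ccontr)
  assume "\<not> length v \<le> length u"
  then obtain w a where v: "v = w @ [a]" "length u \<le> length w"
    by (cases v rule: rev_exhaust) auto
  then have "rank u < rank v" using rank_less_snoc[of u w a] assms by auto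
  with assms(3) show False by simp
qed

lemma rank_snoc_less_iff:
  assumes "a \<in> A" "b \<in> A"
  shows "rank (v @ [b]) < rank (u @ [a]) \<longleftrightarrow> rank v < rank u \<or> rank v = rank u \<and> digit b < digit a"
proof -
  have lt: "K * m + digit x < K * n + digit y" if "m < n" "x \<in> A" for m n x y
  proof -
    have "K * m + digit x < K * Suc m" using digit_less[OF that(2)] by simp
    also have "\<dots> \<le> K * n" using that(1) by (intro mult_le_mono2) simp
    finally show ?thesis by simp
  qed
  show ?thesis
    using lt[of "rank v" "rank u" b a] lt[of "rank u" "rank v" a b] assms
    by (cases "rank v" "rank u" rule: linorder_cases) auto
qed

lemma rank_inj: "v \<in> lists A \<Longrightarrow> u \<in> lists A \<Longrightarrow> rank v = rank u \<Longrightarrow> v = u"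
proof (induction u arbitrary: v rule: rev_induct)
  case Nil
  then have "length v \<le> length ([] :: 'h list)" by (intro rank_le_imp_length_le) auto
  then show ?case by simp
next
  case (snoc a u)
  then have ua: "u \<in> lists A" "a \<in> A" by auto
  have "length (u @ [a]) \<le> length v" using snoc by (intro rank_le_imp_length_le) auto
  then obtain w b where v: "v = w @ [b]" by (cases v rule: rev_exhaust) auto
  with snoc.prems have wb: "w \<in> lists A" "b \<in> A" by auto
  have "rank (w @ [b]) = rank (u @ [a])" using snoc.prems(3) v by (simp only:)
  then have "\<not> rank (w @ [b]) < rank (u @ [a])" "\<not> rank (u @ [a]) < rank (w @ [b])"
    by (simp_all only: less_irrefl not_False_eq_True)
  then have "rank w = rank u \<and> digit b = digit a"
    unfolding rank_snoc_less_iff[OF ua(2) wb(2)] rank_snoc_less_iff[OF wb(2) ua(2)] by linarith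
  then show ?case using snoc.IH[OF wb(1) ua(1)] inj_digit ua wb v by (auto dest: inj_onD)
qed

text \<open>
  Passing to a sublanguage keeps the fellow-traveller property, so only regularity of this language
  has to be proved.
\<close>

definition least_words :: "'h list set" where
  "least_words = {u \<in> L. \<forall>v \<in> L. val v = val u \<longrightarrow> rank u \<le> rank v}"

lemma L_subset_lists: "L \<subseteq> lists A"
  using regular_L by (rule regular_language_subset)

lemma least_words_bij:
  assumes "val ` L = carrier H"
  shows "bij_betw val least_words (carrier H)"
  unfolding bij_betw_def
proof
  show "inj_on val least_words"
  proof (rule inj_onI)
    fix u v assume "u \<in> least_words" "v \<in> least_words" "val u = val v"
    then have "rank u \<le> rank v" "rank v \<le> rank u" "u \<in> L" "v \<in> L"
      unfolding least_words_def by simp_all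
    then have "rank u = rank v" "u \<in> lists A" "v \<in> lists A"
      using subsetD[OF L_subset_lists] by (simp_all only: order_antisym)
    then show "u = v" by (intro rank_inj)
  qed
  show "val ` least_words = carrier H"
  proof (intro equalityI subsetI)
    fix g assume "g \<in> carrier H"
    then have "g \<in> val ` L" using assms by simp
    then obtain v where v: "v \<in> L" "val v = g" by blast
    define P where "P v \<longleftrightarrow> v \<in> L \<and> val v = g" for v
    have Pv: "P v" using v by (simp add: P_def)
    have "P (arg_min rank P)" by (rule arg_min_natI[where P = P, OF Pv])
    moreover have "rank (arg_min rank P) \<le> rank w" if "P w" for w
      by (rule arg_min_nat_le[where P = P, OF that])
    ultimately have "arg_min rank P \<in> least_words" "val (arg_min rank P) = g"
      unfolding least_words_def P_def by simp_all
    then show "g \<in> val ` least_words" by blast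
  next
    fix g assume "g \<in> val ` least_words"
    then have "g \<in> val ` L" unfolding least_words_def by blast
    then show "g \<in> carrier H" using assms by simp
  qed
qed

text \<open>
  Whether \<open>u\<close> is least is decided by the words \<open>v\<close> that could beat it. Such a \<open>v\<close> is no longer than \<open>u\<close>
  and, having the same value, stays within \<open>B\<close> of \<open>u\<close>. For the words \<open>v\<close> that have done so up to now,
  this finite set collects all that matters for the future: the state of \<open>v\<close> in an automaton for \<open>L\<close>,
  the difference of the values, whether \<open>v\<close> is as long as \<open>u\<close> (and so may still grow), whether it
  equals \<open>u\<close>, and whether its rank is smaller. It is the state of a subset construction.
\<close>

definition shadows :: "(nat \<Rightarrow> 'h \<Rightarrow> nat) \<Rightarrow> nat \<Rightarrow> 'h list \<Rightarrow> (nat \<times> 'h \<times> bool \<times> bool \<times> bool) set" where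
  "shadows \<delta> q0 u =
    (\<lambda>v. (foldl \<delta> q0 v, inv (val u) \<otimes> val v, length v = length u, v = u, rank v < rank u)) `
      {v \<in> lists A. length v \<le> length u \<and> (\<forall>t. inv (val (take t u)) \<otimes> val (take t v) \<in> B)}"

text \<open>
  When \<open>u\<close> grows by \<open>a\<close>, a word \<open>v\<close> either stays behind for good, and then has smaller rank by its
  length, or grows by a letter \<open>b\<close>.
\<close>

definition shadow_step ::
    "(nat \<Rightarrow> 'h \<Rightarrow> nat) \<Rightarrow> (nat \<times> 'h \<times> bool \<times> bool \<times> bool) set \<Rightarrow> 'h \<Rightarrow>
      (nat \<times> 'h \<times> bool \<times> bool \<times> bool) set" where
  "shadow_step \<delta> X a =
    {(q, inv a \<otimes> h, False, False, True) | q h l e s. (q, h, l, e, s) \<in> X \<and> inv a \<otimes> h \<in> B} \<union>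
    {(\<delta> q b, inv a \<otimes> h \<otimes> b, True, e \<and> b = a, s \<or> e \<and> digit b < digit a) | q h e s b.
       (q, h, True, e, s) \<in> X \<and> b \<in> A \<and> inv a \<otimes> h \<otimes> b \<in> B}"

lemma shadows_Nil: "shadows \<delta> q0 [] = {(q0, \<one>, True, True, False)}"
  using one_B by (auto simp: shadows_def)

lemma fellow_snoc_left:
  assumes "u \<in> lists A" "a \<in> A" "v \<in> lists A" "length v \<le> length u"
  shows "(\<forall>t. inv (val (take t (u @ [a]))) \<otimes> val (take t v) \<in> B) \<longleftrightarrow>
    (\<forall>t. inv (val (take t u)) \<otimes> val (take t v) \<in> B) \<and> inv (val (u @ [a])) \<otimes> val v \<in> B"
    (is "?l \<longleftrightarrow> ?r")
proof
  assume l: ?l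
  have "inv (val (take t u)) \<otimes> val (take t v) \<in> B" for t
    using l[rule_format, of "min t (length u)"] assms(4) by (simp add: min_def split: if_splits)
  moreover have "inv (val (u @ [a])) \<otimes> val v \<in> B"
    using l[rule_format, of "Suc (length u)"] assms(4) by simp
  ultimately show ?r by simp
next
  assume r: ?r
  show ?l
  proof
    fix t
    show "inv (val (take t (u @ [a]))) \<otimes> val (take t v) \<in> B"
      using r assms(4) by (cases "t \<le> length u") auto
  qed
qed

lemma fellow_snoc_both:
  assumes "u \<in> lists A" "a \<in> A" "v \<in> lists A" "b \<in> A" "length v = length u"
  shows "(\<forall>t. inv (val (take t (u @ [a]))) \<otimes> val (take t (v @ [b])) \<in> B) \<longleftrightarrow>
    (\<forall>t. inv (val (take t u)) \<otimes> val (take t v) \<in> B) \<and> inv (val (u @ [a])) \<otimes> val (v @ [b]) \<in> B"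
    (is "?l \<longleftrightarrow> ?r")
proof
  assume l: ?l
  have "inv (val (take t u)) \<otimes> val (take t v) \<in> B" for t
    using l[rule_format, of "min t (length u)"] assms(5) by (simp add: min_def split: if_splits)
  moreover have "inv (val (u @ [a])) \<otimes> val (v @ [b]) \<in> B"
    using l[rule_format, of "Suc (length u)"] assms(5) by simp
  ultimately show ?r by simp
next
  assume r: ?r
  show ?l
  proof
    fix t
    show "inv (val (take t (u @ [a]))) \<otimes> val (take t (v @ [b])) \<in> B"
      using r assms(5) by (cases "t \<le> length u") auto
  qed
qed

lemma shift_left:
  assumes "u \<in> lists A" "a \<in> A" "v \<in> lists A"
  shows "inv (val (u @ [a])) \<otimes> val v = inv a \<otimes> (inv (val u) \<otimes> val v)"
proof -
  have "a \<in> carrier H" using assms A_carrier by auto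
  then show ?thesis using assms by (simp add: val_append inv_mult_group m_assoc)
qed

lemma shift_both:
  assumes "u \<in> lists A" "a \<in> A" "v \<in> lists A" "b \<in> A"
  shows "inv (val (u @ [a])) \<otimes> val (v @ [b]) = inv a \<otimes> (inv (val u) \<otimes> val v) \<otimes> b"
proof -
  have "a \<in> carrier H" "b \<in> carrier H" using assms A_carrier by auto
  then show ?thesis using assms by (simp add: val_append inv_mult_group m_assoc)
qed

lemma shadows_snoc:
  assumes u: "u \<in> lists A" "a \<in> A"
  shows "shadows \<delta> q0 (u @ [a]) = shadow_step \<delta> (shadows \<delta> q0 u) a"
proof (intro equalityI subsetI)
  fix x assume "x \<in> shadows \<delta> q0 (u @ [a])"
  then obtain v where v: "v \<in> lists A" "length v \<le> Suc (length u)"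
    and B: "\<forall>t. inv (val (take t (u @ [a]))) \<otimes> val (take t v) \<in> B"
    and x: "x = (foldl \<delta> q0 v, inv (val (u @ [a])) \<otimes> val v, length v = Suc (length u),
      v = u @ [a], rank v < rank (u @ [a]))"
    unfolding shadows_def by auto
  show "x \<in> shadow_step \<delta> (shadows \<delta> q0 u) a"
  proof (cases "length v \<le> length u")
    case True
    note B' = B[unfolded fellow_snoc_left[OF u v(1) True]]
    have "x = (foldl \<delta> q0 v, inv a \<otimes> (inv (val u) \<otimes> val v), False, False, True)"
      using True x shift_left[OF u v(1)] rank_less_snoc[OF v(1) u(1) True u(2)] by auto
    moreover have "(foldl \<delta> q0 v, inv (val u) \<otimes> val v, length v = length u, v = u, rank v < rank u)
        \<in> shadows \<delta> q0 u"
      unfolding shadows_def using True B' v(1) by blast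
    moreover have "inv a \<otimes> (inv (val u) \<otimes> val v) \<in> B"
      using B' shift_left[OF u v(1)] by simp
    ultimately show ?thesis unfolding shadow_step_def by blast
  next
    case False
    then obtain w b where vw: "v = w @ [b]" "length w = length u"
      using v(2) by (cases v rule: rev_exhaust) auto
    with v have wb: "w \<in> lists A" "b \<in> A" by auto
    note B' = B[unfolded vw(1) fellow_snoc_both[OF u wb vw(2)]]
    have "x = (\<delta> (foldl \<delta> q0 w) b, inv a \<otimes> (inv (val u) \<otimes> val w) \<otimes> b, True, w = u \<and> b = a,
        rank w < rank u \<or> w = u \<and> digit b < digit a)"
      using x vw shift_both[OF u wb] rank_snoc_less_iff[OF u(2) wb(2), of w u] rank_inj[OF wb(1) u(1)]
      by auto
    moreover have "(foldl \<delta> q0 w, inv (val u) \<otimes> val w, True, w = u, rank w < rank u) \<in> shadows \<delta> q0 u"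
      unfolding shadows_def using vw(2) B' wb(1) by (intro image_eqI[of _ _ w]) auto
    moreover have "inv a \<otimes> (inv (val u) \<otimes> val w) \<otimes> b \<in> B"
      using B' shift_both[OF u wb] by simp
    ultimately show ?thesis using wb(2) unfolding shadow_step_def by blast
  qed
next
  fix x assume "x \<in> shadow_step \<delta> (shadows \<delta> q0 u) a"
  then consider (short) q h l e s where "(q, h, l, e, s) \<in> shadows \<delta> q0 u" "inv a \<otimes> h \<in> B"
      "x = (q, inv a \<otimes> h, False, False, True)"
    | (equal) q h e s b where "(q, h, True, e, s) \<in> shadows \<delta> q0 u" "b \<in> A" "inv a \<otimes> h \<otimes> b \<in> B"
      "x = (\<delta> q b, inv a \<otimes> h \<otimes> b, True, e \<and> b = a, s \<or> e \<and> digit b < digit a)"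
    unfolding shadow_step_def by blast
  then show "x \<in> shadows \<delta> q0 (u @ [a])"
  proof cases
    case short
    then obtain v where v: "v \<in> lists A" "length v \<le> length u"
      "\<forall>t. inv (val (take t u)) \<otimes> val (take t v) \<in> B" "q = foldl \<delta> q0 v" "h = inv (val u) \<otimes> val v"
      unfolding shadows_def by blast
    have "x = (foldl \<delta> q0 v, inv (val (u @ [a])) \<otimes> val v, length v = length (u @ [a]),
      v = u @ [a], rank v < rank (u @ [a]))"
      using short v shift_left[OF u v(1)] rank_less_snoc[OF v(1) u(1) v(2) u(2)] by auto
    moreover have "\<forall>t. inv (val (take t (u @ [a]))) \<otimes> val (take t v) \<in> B"
      unfolding fellow_snoc_left[OF u v(1,2)] using v short shift_left[OF u v(1)] by simp
    ultimately show ?thesis unfolding shadows_def using v by (intro image_eqI[of _ _ v]) auto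
  next
    case equal
    then obtain v where v: "v \<in> lists A" "length v = length u"
      "\<forall>t. inv (val (take t u)) \<otimes> val (take t v) \<in> B" "q = foldl \<delta> q0 v" "h = inv (val u) \<otimes> val v"
      "e \<longleftrightarrow> v = u" "s \<longleftrightarrow> rank v < rank u"
      unfolding shadows_def by blast
    have "x = (foldl \<delta> q0 (v @ [b]), inv (val (u @ [a])) \<otimes> val (v @ [b]),
      length (v @ [b]) = length (u @ [a]), v @ [b] = u @ [a], rank (v @ [b]) < rank (u @ [a]))"
      using equal v shift_both[OF u v(1) equal(2)] rank_inj[OF v(1) u(1)]
        rank_snoc_less_iff[OF u(2) equal(2), of v u] by auto
    moreover have "\<forall>t. inv (val (take t (u @ [a]))) \<otimes> val (take t (v @ [b])) \<in> B"
      unfolding fellow_snoc_both[OF u v(1) equal(2) v(2)]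
      using v equal shift_both[OF u v(1) equal(2)] by simp
    ultimately show ?thesis unfolding shadows_def using v equal(2)
      by (intro image_eqI[of _ _ "v @ [b]"]) auto
  qed
qed

lemma regular_least_words: "regular_language A least_words"
proof -
  obtain Q :: "nat set" and \<delta> q0 F where Q: "finite Q" "q0 \<in> Q"
    "\<And>q a. q \<in> Q \<Longrightarrow> a \<in> A \<Longrightarrow> \<delta> q a \<in> Q" and L: "L = {w \<in> lists A. foldl \<delta> q0 w \<in> F}"
    by (rule regular_languageE[OF regular_L]) blast
  have Lmem: "w \<in> L \<longleftrightarrow> w \<in> lists A \<and> foldl \<delta> q0 w \<in> F" for w
    unfolding L by simp
  let ?U = "Q \<times> B \<times> (UNIV :: bool set) \<times> (UNIV :: bool set) \<times> (UNIV :: bool set)"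
  define d where "d = (\<lambda>(q, X) a. (\<delta> q a, shadow_step \<delta> X a))"
  define s0 where "s0 = (q0, shadows \<delta> q0 [])"
  define Fin where "Fin = {(q, X :: (nat \<times> 'h \<times> bool \<times> bool \<times> bool) set). q \<in> F \<and> (\<forall>(q', h, l, e, s) \<in> X. \<not> (q' \<in> F \<and> h = \<one> \<and> s))}"
  have run: "foldl d s0 u = (foldl \<delta> q0 u, shadows \<delta> q0 u)" if "u \<in> lists A" for u
    using that
  proof (induction u rule: rev_induct)
    case (snoc a u)
    then show ?case using shadows_snoc[of u a \<delta> q0] by (simp add: d_def)
  qed (simp add: s0_def)
  have "least_words = {u \<in> lists A. foldl d s0 u \<in> Fin}"
  proof (intro equalityI subsetI)
    fix u assume u: "u \<in> least_words"
    then have uL: "u \<in> L" unfolding least_words_def by simp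
    then have uA: "u \<in> lists A" and uF: "foldl \<delta> q0 u \<in> F" using Lmem by simp_all
    have "\<not> (foldl \<delta> q0 v \<in> F \<and> inv (val u) \<otimes> val v = \<one> \<and> rank v < rank u)"
      if v: "v \<in> lists A" for v
    proof
      assume *: "foldl \<delta> q0 v \<in> F \<and> inv (val u) \<otimes> val v = \<one> \<and> rank v < rank u"
      then have "val v = val u"
        using v uA by (metis inv_solve_left r_one val_closed one_closed)
      moreover have "v \<in> L" using * v Lmem by simp
      ultimately have "rank u \<le> rank v" using u unfolding least_words_def by simp
      with * show False by simp
    qed
    then show "u \<in> {u \<in> lists A. foldl d s0 u \<in> Fin}"
      using uA uF by (auto simp: run[OF uA] Fin_def shadows_def)
  next
    fix u assume "u \<in> {u \<in> lists A. foldl d s0 u \<in> Fin}"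
    then have u: "u \<in> lists A" and Fin: "(foldl \<delta> q0 u, shadows \<delta> q0 u) \<in> Fin"
      using run[of u] by simp_all
    then have uL: "u \<in> L" using Lmem by (simp add: Fin_def)
    have "rank u \<le> rank v" if v: "v \<in> L" "val v = val u" for v
    proof (rule ccontr)
      assume less: "\<not> rank u \<le> rank v"
      have vA: "v \<in> lists A" "foldl \<delta> q0 v \<in> F" using v Lmem by simp_all
      have "length v \<le> length u" using rank_le_imp_length_le[OF vA(1) u] less by simp
      then have "(foldl \<delta> q0 v, inv (val u) \<otimes> val v, length v = length u, v = u, rank v < rank u)
          \<in> shadows \<delta> q0 u"
        unfolding shadows_def using vA(1) fellow_equal[OF uL v] by blast
      moreover have "inv (val u) \<otimes> val v = \<one>" using v(2) u by simp
      ultimately show False using Fin less vA(2) unfolding Fin_def by fastforce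
    qed
    then show "u \<in> least_words" using uL unfolding least_words_def by simp
  qed
  moreover have "regular_language A {u \<in> lists A. foldl d s0 u \<in> Fin}"
  proof (rule regular_languageI)
    show "finite (Q \<times> Pow ?U)" using Q(1) finite_B by simp
    show "s0 \<in> Q \<times> Pow ?U" using Q(2) one_B by (simp add: s0_def shadows_Nil)
    show "d s a \<in> Q \<times> Pow ?U" if sa: "s \<in> Q \<times> Pow ?U" "a \<in> A" for s a
    proof -
      obtain q X where s: "s = (q, X)" "q \<in> Q" "X \<subseteq> ?U"
        using sa(1) by auto
      have QB: "q \<in> Q \<and> h \<in> B" if "(q, h, l, e, r) \<in> X" for q h l e r
        using subsetD[OF s(3) that] by simp
      have "shadow_step \<delta> X a \<subseteq> ?U"
        unfolding shadow_step_def
      proof (intro Un_least subsetI; elim CollectE exE conjE)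
        fix x q' h l e r
        assume "x = (q', inv a \<otimes> h, False, False, True)" "(q', h, l, e, r) \<in> X" "inv a \<otimes> h \<in> B"
        then show "x \<in> ?U" using QB by simp
      next
        fix x q' h e r b
        assume "x = (\<delta> q' b, inv a \<otimes> h \<otimes> b, True, e \<and> b = a, r \<or> e \<and> digit b < digit a)"
          "(q', h, True, e, r) \<in> X" "b \<in> A" "inv a \<otimes> h \<otimes> b \<in> B"
        then show "x \<in> ?U" using QB Q(3) by simp
      qed
      then show ?thesis using s Q(3) sa(2) by (simp add: d_def)
    qed
  qed
  ultimately show ?thesis by simp
qed

end

text \<open>
  Differences of fellow travellers have length at most \<open>C\<close> in the generators, so they form a finite set;
  the least word of each value then gives unique representatives.
\<close>

theorem automatic_group_unique_representatives:
  fixes H :: "('h, 'n) monoid_scheme"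
  assumes "automatic_group H"
  obtains A L B where "fellow_travelling_language H A L B"
    "bij_betw (word_value H id) L (carrier H)"
proof -
  interpret group H using assms by (simp add: automatic_group_def)
  obtain A L C where A: "finite A" "A \<subseteq> carrier H" "word_value H id ` lists A = carrier H"
    and L: "regular_language A L" "word_value H id ` L = carrier H"
    and fellow_all: "\<forall>u \<in> L. \<forall>v \<in> L.
      word_metric H A (word_value H id u) (word_value H id v) \<le> 1 \<longrightarrow>
      (\<forall>t. word_metric H A (word_value H id (take t u)) (word_value H id (take t v)) \<le> C)"
    using assms unfolding automatic_group_def by (elim conjE exE) (rule that)
  have fellow: "word_metric H A (word_value H id (take t u)) (word_value H id (take t v)) \<le> C"
    if "u \<in> L" "v \<in> L" "word_metric H A (word_value H id u) (word_value H id v) \<le> 1" for u v t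
    using fellow_all that by blast
  define B where "B = insert \<one>\<^bsub>H\<^esub> (word_value H id ` {w. w \<in> lists A \<and> length w \<le> C})"
  have finB: "finite B"
    unfolding B_def using finite_lists_length_le[OF A(1), of C] by (simp add: lists_eq_set Collect_conj_eq)
  have closed: "word_value H id w \<in> carrier H" if "w \<in> lists A" for w
    using A(2) that by (intro word_value_closed[of id A]) auto
  have LA: "L \<subseteq> lists A" using L(1) by (rule regular_language_subset)
  have B: "inv\<^bsub>H\<^esub> (word_value H id (take t u)) \<otimes>\<^bsub>H\<^esub> word_value H id (take t v) \<in> B"
    if uv: "u \<in> L" "v \<in> L" and near: "word_value H id v = word_value H id u \<or>
      (\<exists>a \<in> A. a \<in> carrier H \<and> word_value H id v = word_value H id u \<otimes>\<^bsub>H\<^esub> a)" for u v t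
  proof -
    have uvA: "u \<in> lists A" "v \<in> lists A" using uv LA by auto
    have "word_metric H A (word_value H id u) (word_value H id v) \<le> 1"
      using closed[OF uvA(1)] near by (intro word_metric_le_one group_axioms)
    then have "word_metric H A (word_value H id (take t u)) (word_value H id (take t v)) \<le> C"
      by (rule fellow[OF uv])
    then show ?thesis
      unfolding B_def using uvA by (intro insertI2 word_metric_le_imp_short group_axioms A closed take_in_lists)
  qed
  obtain digit0 :: "'h \<Rightarrow> nat" where dig: "inj_on digit0 A"
    using finite_imp_inj_to_nat_seg[OF A(1)] by metis
  \<comment> \<open>The base must be at least \<open>2\<close> for longer words to have larger rank, even if \<open>A\<close> is a singleton.\<close>
  define K where "K = 2 + Max (insert 0 (digit0 ` A))"
  have K: "digit0 a < K" if "a \<in> A" for a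
  proof -
    have "digit0 a \<le> Max (insert 0 (digit0 ` A))" using A(1) that by (intro Max_ge) auto
    then show ?thesis by (simp only: K_def)
  qed
  interpret ranked_language H A L B digit0 K
  proof unfold_locales
    show "inv\<^bsub>H\<^esub> word_value H id (take t u) \<otimes>\<^bsub>H\<^esub> word_value H id (take t v) \<in> B"
      if "u \<in> L" "v \<in> L" "word_value H id v = word_value H id u" for u v t
      using B[OF that(1,2)] that(3) by simp
    show "inv\<^bsub>H\<^esub> word_value H id (take t u) \<otimes>\<^bsub>H\<^esub> word_value H id (take t v) \<in> B"
      if "u \<in> L" "v \<in> L" "a \<in> A" "word_value H id v = word_value H id u \<otimes>\<^bsub>H\<^esub> a" for u v a t
      using B[OF that(1,2)] that(3,4) A(2) by blast
  qed (use A L finB dig K in \<open>auto simp: B_def K_def\<close>)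
  have "fellow_travelling_language H A least_words B"
    using regular_least_words fellow_equal fellow_letter
    by unfold_locales (auto simp: finite_A A_carrier finite_B one_B least_words_def)
  then show thesis
    by (rule that) (rule least_words_bij[OF L(2)])
qed

section \<open>Finitely generated abelian groups\<close>

definition has_regular_normal_form :: "('g, 'm) monoid_scheme \<Rightarrow> 'g set \<Rightarrow> bool" where
  "has_regular_normal_form G X \<longleftrightarrow>
     (\<exists>(E :: nat set) \<psi> L. finite E \<and> \<psi> \<in> E \<rightarrow> carrier G \<and> regular_language E L \<and>
        bij_betw (word_value G \<psi>) L X)"

lemma has_regular_normal_formI:
  fixes E :: "nat set"
  assumes "bij_betw (word_value G \<psi>) L X" "regular_language E L" "finite E" "\<psi> \<in> E \<rightarrow> carrier G"
  shows "has_regular_normal_form G X"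
  unfolding has_regular_normal_form_def using assms by blast

text \<open>
  If every element of \<open>X Y\<close> is uniquely a product of an element of \<open>X\<close> and one of \<open>Y\<close>, then
  concatenating normal forms over disjoint alphabets gives normal forms for \<open>X Y\<close>. The maps \<open>f1\<close> and
  \<open>f2\<close> make the alphabets disjoint. They are kept visible because prefixes of the concatenated words
  are analysed later.
\<close>

lemma (in group) product_normal_form:
  fixes E1 :: "'a1 set" and E2 :: "'a2 set" and L1 L2
  assumes fin: "finite E1" "finite E2"
    and \<psi>: "\<psi>1 \<in> E1 \<rightarrow> carrier G" "\<psi>2 \<in> E2 \<rightarrow> carrier G"
    and reg: "regular_language E1 L1" "regular_language E2 L2"
    and bij: "bij_betw (word_value G \<psi>1) L1 X" "bij_betw (word_value G \<psi>2) L2 Y"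
    and unique: "inj_on (\<lambda>(x, y). x \<otimes> y) (X \<times> Y)"
  obtains f1 f2 and \<phi> :: "nat \<Rightarrow> 'a" where
    "\<forall>a \<in> E1. \<phi> (f1 a) = \<psi>1 a" "\<forall>b \<in> E2. \<phi> (f2 b) = \<psi>2 b"
    "regular_language (f1 ` E1 \<union> f2 ` E2) ((\<lambda>(u, v). map f1 u @ map f2 v) ` (L1 \<times> L2))"
    "bij_betw (word_value G \<phi>) ((\<lambda>(u, v). map f1 u @ map f2 v) ` (L1 \<times> L2))
       ((\<lambda>(x, y). x \<otimes> y) ` (X \<times> Y))"
proof -
  have "finite (E1 <+> E2)" using fin by simp
  then obtain e :: "'a1 + 'a2 \<Rightarrow> nat" where e: "inj_on e (E1 <+> E2)"
    using finite_imp_inj_to_nat_seg by metis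
  define f1 where "f1 a = e (Inl a)" for a
  define f2 where "f2 b = e (Inr b)" for b
  define \<phi> where "\<phi> n = case_sum \<psi>1 \<psi>2 (inv_into (E1 <+> E2) e n)" for n
  have \<phi>1: "\<phi> (f1 a) = \<psi>1 a" if "a \<in> E1" for a
    using inv_into_f_f[OF e, of "Inl a"] that by (simp add: \<phi>_def f1_def InlI)
  have \<phi>2: "\<phi> (f2 b) = \<psi>2 b" if "b \<in> E2" for b
    using inv_into_f_f[OF e, of "Inr b"] that by (simp add: \<phi>_def f2_def InrI)
  have inj: "inj_on f1 E1" "inj_on f2 E2"
    using e by (auto simp: inj_on_def f1_def f2_def)
  have disj: "f1 ` E1 \<inter> f2 ` E2 = {}"
    using e by (auto simp: inj_on_def f1_def f2_def)
  let ?join = "\<lambda>(u, v). map f1 u @ map f2 v"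
  have reg': "regular_language (f1 ` E1 \<union> f2 ` E2) (?join ` (L1 \<times> L2))"
  proof -
    have "(\<lambda>(u, v). u @ v) ` (map f1 ` L1 \<times> map f2 ` L2) = ?join ` (L1 \<times> L2)"
      by (auto simp: image_iff)
    with regular_language_append[OF regular_language_image[OF reg(1) inj(1)]
        regular_language_image[OF reg(2) inj(2)] disj]
    show ?thesis by simp
  qed
  have sub: "L1 \<subseteq> lists E1" "L2 \<subseteq> lists E2"
    using reg by (auto dest: regular_language_subset)
  have \<phi>: "\<phi> \<in> f1 ` E1 \<union> f2 ` E2 \<rightarrow> carrier G"
    using \<psi> \<phi>1 \<phi>2 by (auto simp: Pi_iff)
  have val_join: "word_value G \<phi> (map f1 u @ map f2 v) = word_value G \<psi>1 u \<otimes> word_value G \<psi>2 v"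
    if uv: "u \<in> L1" "v \<in> L2" for u v
  proof -
    have "set u \<subseteq> E1" "set v \<subseteq> E2" using uv sub by auto
    then have "map f1 u \<in> lists (f1 ` E1 \<union> f2 ` E2)" "map f2 v \<in> lists (f1 ` E1 \<union> f2 ` E2)"
      by (auto simp: in_lists_conv_set)
    then have "word_value G \<phi> (map f1 u @ map f2 v) =
        word_value G (\<phi> \<circ> f1) u \<otimes> word_value G (\<phi> \<circ> f2) v"
      by (simp only: word_value_append[OF \<phi>] word_value_map)
    also have "word_value G (\<phi> \<circ> f1) u = word_value G \<psi>1 u"
      using \<open>set u \<subseteq> E1\<close> \<phi>1 by (intro word_value_cong) auto
    also have "word_value G (\<phi> \<circ> f2) v = word_value G \<psi>2 v"
      using \<open>set v \<subseteq> E2\<close> \<phi>2 by (intro word_value_cong) auto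
    finally show ?thesis .
  qed
  have "bij_betw (word_value G \<phi>) (?join ` (L1 \<times> L2)) ((\<lambda>(x, y). x \<otimes> y) ` (X \<times> Y))"
    unfolding bij_betw_def
  proof
    have XY: "word_value G \<psi>1 u \<in> X" "word_value G \<psi>2 v \<in> Y" if "u \<in> L1" "v \<in> L2" for u v
      using bij that by (auto simp: bij_betw_def)
    show "inj_on (word_value G \<phi>) (?join ` (L1 \<times> L2))"
    proof (rule inj_onI)
      fix w w' assume "w \<in> ?join ` (L1 \<times> L2)" "w' \<in> ?join ` (L1 \<times> L2)"
        and eq: "word_value G \<phi> w = word_value G \<phi> w'"
      then obtain u v u' v' where w: "w = map f1 u @ map f2 v" "u \<in> L1" "v \<in> L2"
        and w': "w' = map f1 u' @ map f2 v'" "u' \<in> L1" "v' \<in> L2" by auto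
      have "(word_value G \<psi>1 u, word_value G \<psi>2 v) = (word_value G \<psi>1 u', word_value G \<psi>2 v')"
        using eq w w' val_join XY by (intro inj_onD[OF unique]) auto
      then have "u = u'" "v = v'"
        using bij w w' by (auto simp: bij_betw_def dest: inj_onD)
      then show "w = w'" using w w' by simp
    qed
    show "word_value G \<phi> ` (?join ` (L1 \<times> L2)) = (\<lambda>(x, y). x \<otimes> y) ` (X \<times> Y)"
    proof (intro equalityI subsetI)
      fix g assume "g \<in> word_value G \<phi> ` (?join ` (L1 \<times> L2))"
      then obtain u v where "u \<in> L1" "v \<in> L2" "g = word_value G \<psi>1 u \<otimes> word_value G \<psi>2 v"
        using val_join by auto
      then show "g \<in> (\<lambda>(x, y). x \<otimes> y) ` (X \<times> Y)" using XY by auto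
    next
      fix g assume "g \<in> (\<lambda>(x, y). x \<otimes> y) ` (X \<times> Y)"
      then obtain x y where xy: "x \<in> X" "y \<in> Y" "g = x \<otimes> y" by auto
      then obtain u v where "u \<in> L1" "v \<in> L2" "x = word_value G \<psi>1 u" "y = word_value G \<psi>2 v"
        using bij unfolding bij_betw_def by (metis imageE)
      then show "g \<in> word_value G \<phi> ` (?join ` (L1 \<times> L2))"
        using val_join[of u v] xy(3) by force
    qed
  qed
  from \<phi>1 \<phi>2 reg' this show thesis by (intro that[of \<phi> f1 f2] ballI)
qed

lemma (in group) has_regular_normal_form_product:
  assumes "has_regular_normal_form G X" "has_regular_normal_form G Y"
    and "inj_on (\<lambda>(x, y). x \<otimes> y) (X \<times> Y)"
  shows "has_regular_normal_form G ((\<lambda>(x, y). x \<otimes> y) ` (X \<times> Y))"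
proof -
  obtain E1 :: "nat set" and \<psi>1 L1 where 1: "finite E1" "\<psi>1 \<in> E1 \<rightarrow> carrier G"
    "regular_language E1 L1" "bij_betw (word_value G \<psi>1) L1 X"
    using assms(1) unfolding has_regular_normal_form_def by (elim exE conjE) (rule that)
  obtain E2 :: "nat set" and \<psi>2 L2 where 2: "finite E2" "\<psi>2 \<in> E2 \<rightarrow> carrier G"
    "regular_language E2 L2" "bij_betw (word_value G \<psi>2) L2 Y"
    using assms(2) unfolding has_regular_normal_form_def by (elim exE conjE) (rule that)
  obtain f1 f2 and \<phi> :: "nat \<Rightarrow> 'a" where \<phi>:
    "\<forall>a \<in> E1. \<phi> (f1 a) = \<psi>1 a" "\<forall>b \<in> E2. \<phi> (f2 b) = \<psi>2 b"
    and L: "regular_language (f1 ` E1 \<union> f2 ` E2) ((\<lambda>(u, v). map f1 u @ map f2 v) ` (L1 \<times> L2))"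
    "bij_betw (word_value G \<phi>) ((\<lambda>(u, v). map f1 u @ map f2 v) ` (L1 \<times> L2))
       ((\<lambda>(x, y). x \<otimes> y) ` (X \<times> Y))"
    by (rule product_normal_form[OF 1(1) 2(1) 1(2) 2(2) 1(3) 2(3) 1(4) 2(4) assms(3)])
  have "\<phi> \<in> f1 ` E1 \<union> f2 ` E2 \<rightarrow> carrier G"
    using \<phi> 1(2) 2(2) by (auto simp: Pi_iff)
  moreover have "finite (f1 ` E1 \<union> f2 ` E2)" using 1 2 by simp
  ultimately show ?thesis by (intro has_regular_normal_formI[OF L(2,1)])
qed

lemma (in group) has_regular_normal_form_finite:
  assumes "finite T" "T \<subseteq> carrier G"
  shows "has_regular_normal_form G T"
proof -
  obtain f :: "'a \<Rightarrow> nat" where f: "inj_on f T"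
    using finite_imp_inj_to_nat_seg[OF assms(1)] by metis
  let ?\<psi> = "inv_into T f"
  have inv: "?\<psi> (f t) = t" if "t \<in> T" for t using f that by simp
  have "bij_betw (word_value G ?\<psi>) ((\<lambda>n. [n]) ` f ` T) T"
    by (rule bij_betw_byWitness[where f' = "\<lambda>t. [f t]"]) (use assms(2) inv in auto)
  moreover have "?\<psi> \<in> f ` T \<rightarrow> carrier G" using assms(2) inv by auto
  ultimately show ?thesis
    using assms(1) by (intro has_regular_normal_formI[OF _ regular_language_letters]) simp_all
qed

text \<open>
  The letters \<open>0\<close> and \<open>1\<close> stand for \<open>x\<close> and its inverse, and a normal form uses only one of them.
\<close>

lemma (in group) has_regular_normal_form_powers:
  assumes x: "x \<in> carrier G" and inf: "\<And>n :: int. x [^] n = \<one> \<Longrightarrow> n = 0"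
  shows "has_regular_normal_form G (range (\<lambda>n :: int. x [^] n))"
proof -
  define \<psi> where "\<psi> n = (if n = 0 then x else inv x)" for n :: nat
  let ?L = "range (\<lambda>n. replicate n (0 :: nat)) \<union> range (\<lambda>n. replicate n 1)"
  have pos: "word_value G \<psi> (replicate n 0) = x [^] int n" for n
  proof (induction n)
    case (Suc n)
    have "x [^] int (Suc n) = x [^] (1 + int n :: int)" by simp
    also have "\<dots> = x [^] (1 :: int) \<otimes> x [^] int n" using x by (rule int_pow_mult)
    finally show ?case using Suc x by (simp add: \<psi>_def)
  qed simp
  have neg: "word_value G \<psi> (replicate n 1) = x [^] (- int n)" for n
  proof (induction n)
    case (Suc n)
    have "x [^] (- int (Suc n)) = x [^] (- 1 + - int n :: int)" by (simp add: algebra_simps)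
    also have "\<dots> = x [^] (- 1 :: int) \<otimes> x [^] (- int n)" using x by (rule int_pow_mult)
    finally show ?case using Suc x by (simp add: \<psi>_def int_pow_neg)
  qed simp
  have inj: "m = n" if "x [^] m = x [^] n" for m n :: int
  proof -
    have "x [^] (m - n) = \<one>" using that x by (simp add: int_pow_diff)
    then show ?thesis using inf by fastforce
  qed
  have "bij_betw (word_value G \<psi>) ?L (range (\<lambda>n :: int. x [^] n))"
    unfolding bij_betw_def
  proof
    show "inj_on (word_value G \<psi>) ?L"
      by (auto simp: inj_on_def pos neg[unfolded One_nat_def] simp del: replicate_Suc dest!: inj)
    show "word_value G \<psi> ` ?L = range (\<lambda>n :: int. x [^] n)"
    proof (intro equalityI subsetI)
      fix g assume "g \<in> range (\<lambda>n :: int. x [^] n)"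
      then obtain n :: int where n: "g = x [^] n" by blast
      show "g \<in> word_value G \<psi> ` ?L"
      proof (cases "n \<ge> 0")
        case True
        then have "g = word_value G \<psi> (replicate (nat n) 0)" using n pos[of "nat n"] by simp
        then show ?thesis by (rule image_eqI) simp
      next
        case False
        then have "g = word_value G \<psi> (replicate (nat (- n)) 1)" using n neg[of "nat (- n)"] by simp
        then show ?thesis by (rule image_eqI) simp
      qed
    qed (auto simp: pos neg[unfolded One_nat_def])
  qed
  then show ?thesis
  proof (rule has_regular_normal_formI)
    show "regular_language {0, 1} ?L" by (rule regular_language_powers) simp
    show "\<psi> \<in> {0, 1} \<rightarrow> carrier G" using x by (simp add: \<psi>_def)
  qed simp
qed

text \<open>
  In other words, \<open>C\<close> embeds the subgroup \<open>F\<close> into a power of the integers, so that \<open>F\<close> is free abelian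
  of finite rank. Each coordinate can be followed by one counter, and all of them together
  distinguish the elements of \<open>F\<close>.
\<close>

definition integer_coordinates :: "('g, 'm) monoid_scheme \<Rightarrow> 'g set \<Rightarrow> ('g \<Rightarrow> int) set \<Rightarrow> bool" where
  "integer_coordinates G F C \<longleftrightarrow> subgroup F G \<and> finite C \<and>
     (\<forall>c \<in> C. \<forall>f \<in> F. \<forall>g \<in> F. c (f \<otimes>\<^bsub>G\<^esub> g) = c f + c g) \<and>
     (\<forall>f \<in> F. (\<forall>c \<in> C. c f = 0) \<longrightarrow> f = \<one>\<^bsub>G\<^esub>)"

lemma (in comm_group) generate_insert:
  assumes "y \<in> carrier G" "X \<subseteq> carrier G" "g \<in> generate G (insert y X)"
  shows "\<exists>n :: int. \<exists>k \<in> generate G X. g = y [^] n \<otimes> k"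
  using assms(3)
proof induction
  case one
  show ?case using assms(1) generate.one[of G X] by (intro exI[of _ 0] bexI[of _ \<one>]) auto
next
  case (incl h)
  show ?case
  proof (cases "h = y")
    case True
    then show ?thesis using assms(1) generate.one[of G X] by (intro exI[of _ 1] bexI[of _ \<one>]) auto
  next
    case False
    then have "h \<in> X" using incl by simp
    then show ?thesis using assms(2) by (intro exI[of _ 0] bexI[of _ h]) (auto intro: generate.incl)
  qed
next
  case (inv h)
  show ?case
  proof (cases "h = y")
    case True
    then show ?thesis using assms(1) generate.one[of G X]
      by (intro exI[of _ "- 1"] bexI[of _ \<one>]) (auto simp: int_pow_neg)
  next
    case False
    then have "h \<in> X" using inv by simp
    then show ?thesis using assms(2) by (intro exI[of _ 0] bexI[of _ "inv h"]) (auto intro: generate.inv)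
  qed
next
  case (eng h1 h2)
  then obtain n1 n2 :: int and k1 k2 where *: "k1 \<in> generate G X" "h1 = y [^] n1 \<otimes> k1"
    "k2 \<in> generate G X" "h2 = y [^] n2 \<otimes> k2" by blast
  have "k1 \<in> carrier G" "k2 \<in> carrier G" using * generate_in_carrier[OF assms(2)] by auto
  then have "h1 \<otimes> h2 = y [^] (n1 + n2) \<otimes> (k1 \<otimes> k2)"
    using * assms(1) by (simp add: int_pow_mult m_ac)
  moreover have "k1 \<otimes> k2 \<in> generate G X" using * by (auto intro: generate.eng)
  ultimately show ?case by blast
qed

lemma (in comm_group) powers_times_subgroup:
  assumes y: "y \<in> carrier G" and F: "subgroup F G"
  shows "subgroup ((\<lambda>(x, f). x \<otimes> f) ` (range (\<lambda>n :: int. y [^] n) \<times> F)) G"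
proof -
  interpret F: subgroup F G by fact
  have pow: "y [^] n \<in> carrier G" for n :: int using y by simp
  show ?thesis
  proof (rule subgroupI)
    show "(\<lambda>(x, f). x \<otimes> f) ` (range (\<lambda>n :: int. y [^] n) \<times> F) \<subseteq> carrier G"
      using pow F.subset by auto
    show "(\<lambda>(x, f). x \<otimes> f) ` (range (\<lambda>n :: int. y [^] n) \<times> F) \<noteq> {}"
      using F.one_closed by blast
  next
    fix g assume "g \<in> (\<lambda>(x, f). x \<otimes> f) ` (range (\<lambda>n :: int. y [^] n) \<times> F)"
    then obtain n :: int and f where g: "g = y [^] n \<otimes> f" "f \<in> F" by auto
    have "inv g = y [^] (- n) \<otimes> inv f"
      using g pow F.mem_carrier y by (simp add: inv_mult_group int_pow_neg m_comm)
    then show "inv g \<in> (\<lambda>(x, f). x \<otimes> f) ` (range (\<lambda>n :: int. y [^] n) \<times> F)"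
      using g(2) by auto
  next
    fix g h
    assume "g \<in> (\<lambda>(x, f). x \<otimes> f) ` (range (\<lambda>n :: int. y [^] n) \<times> F)"
      "h \<in> (\<lambda>(x, f). x \<otimes> f) ` (range (\<lambda>n :: int. y [^] n) \<times> F)"
    then obtain m n :: int and f f' where gh: "g = y [^] m \<otimes> f" "f \<in> F" "h = y [^] n \<otimes> f'" "f' \<in> F"
      by auto
    then have "g \<otimes> h = y [^] (m + n) \<otimes> (f \<otimes> f')"
      using y F.mem_carrier by (simp add: int_pow_mult m_ac)
    then show "g \<otimes> h \<in> (\<lambda>(x, f). x \<otimes> f) ` (range (\<lambda>n :: int. y [^] n) \<times> F)"
      using gh by auto
  qed
qed

text \<open>
  By induction on the generators. A new generator \<open>y\<close> either has a nonzero power \<open>y\<^sup>m\<close> in \<open>F\<close>, and then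
  finitely many new cosets \<open>y\<^sup>i t\<close> with \<open>0 \<le> i < m\<close> suffice; or no nonzero power of \<open>y\<close> lies in \<open>F\<close>, and
  then \<open>F\<close> grows by the infinite cyclic direct factor generated by \<open>y\<close>, which adds one coordinate.
\<close>

lemma (in comm_group) finitely_generated_virtually_free:
  assumes "finite X" "X \<subseteq> carrier G"
  shows "\<exists>F C T. integer_coordinates G F C \<and> has_regular_normal_form G F \<and>
    finite T \<and> T \<subseteq> carrier G \<and> (\<forall>g \<in> generate G X. \<exists>f \<in> F. \<exists>t \<in> T. g = f \<otimes> t)"
  using assms
proof (induction X rule: finite_induct)
  case empty
  have "integer_coordinates G {\<one>} {}"
    by (simp add: integer_coordinates_def triv_subgroup)
  moreover have "has_regular_normal_form G {\<one>}"
    by (rule has_regular_normal_form_finite) simp_all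
  ultimately show ?case
    by (intro exI[of _ "{\<one>}"] exI[of _ "{}"]) (simp add: generate_empty)
next
  case (insert y X)
  then have y: "y \<in> carrier G" and X: "X \<subseteq> carrier G" by auto
  obtain F C T where C: "integer_coordinates G F C" and nf: "has_regular_normal_form G F"
    and T: "finite T" "T \<subseteq> carrier G" and gen: "\<forall>g \<in> generate G X. \<exists>f \<in> F. \<exists>t \<in> T. g = f \<otimes> t"
    using insert.IH[OF X] by (elim exE conjE) (rule that)
  interpret F: subgroup F G using C by (simp add: integer_coordinates_def)
  have pow: "y [^] n \<in> carrier G" for n :: int using y by simp
  have gen': "\<exists>n :: int. \<exists>f \<in> F. \<exists>t \<in> T. g = y [^] n \<otimes> (f \<otimes> t)"
    if g: "g \<in> generate G (insert y X)" for g
  proof -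
    obtain n :: int and k where "k \<in> generate G X" "g = y [^] n \<otimes> k"
      using generate_insert[OF y X g] by blast
    moreover then obtain f t where "f \<in> F" "t \<in> T" "k = f \<otimes> t" using gen by blast
    ultimately show ?thesis by blast
  qed
  show ?case
  proof (cases "\<exists>m :: int. m \<noteq> 0 \<and> y [^] m \<in> F")
    case True
    then obtain m0 :: int where m0: "m0 \<noteq> 0" "y [^] m0 \<in> F" by blast
    define m where "m = \<bar>m0\<bar>"
    have m: "m > 0" "y [^] m \<in> F"
      using m0 y F.m_inv_closed[OF m0(2)] by (auto simp: m_def abs_if int_pow_neg)
    define T' where "T' = (\<lambda>(i, t). y [^] i \<otimes> t) ` ({0..<m} \<times> T)"
    have "\<exists>f \<in> F. \<exists>t \<in> T'. g = f \<otimes> t" if g: "g \<in> generate G (insert y X)" for g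
    proof -
      obtain n :: int and f t where n: "f \<in> F" "t \<in> T" "g = y [^] n \<otimes> (f \<otimes> t)"
        using gen'[OF g] by blast
      have tc: "t \<in> carrier G" using n T by auto
      have "y [^] n = y [^] (m * (n div m) + n mod m)" by simp
      also have "\<dots> = (y [^] m) [^] (n div m) \<otimes> y [^] (n mod m)"
        using y by (simp only: int_pow_mult int_pow_pow)
      finally have "g = ((y [^] m) [^] (n div m) \<otimes> f) \<otimes> (y [^] (n mod m) \<otimes> t)"
        using n pow tc F.mem_carrier by (simp add: m_ac)
      moreover have "(y [^] m) [^] (n div m) \<otimes> f \<in> F"
        using m(2) n(1) subgroup_int_pow_closed[OF F.subgroup_axioms] by simp
      moreover have "y [^] (n mod m) \<otimes> t \<in> T'"
        using n(2) m(1) by (force simp: T'_def)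
      ultimately show ?thesis by blast
    qed
    moreover have "finite T'" "T' \<subseteq> carrier G" using T pow by (auto simp: T'_def)
    ultimately show ?thesis using C nf by blast
  next
    case False
    then have indep: "n = 0" if "y [^] n \<in> F" for n :: int using that by blast
    define F' where "F' = (\<lambda>(x, f). x \<otimes> f) ` (range (\<lambda>n :: int. y [^] n) \<times> F)"
    have uniq: "m = n \<and> f = f'"
      if "y [^] m \<otimes> f = y [^] n \<otimes> f'" "f \<in> F" "f' \<in> F" for m n :: int and f f'
    proof -
      have "y [^] (m - n) = f' \<otimes> inv f"
      proof -
        have "y [^] m = y [^] n \<otimes> f' \<otimes> inv f"
          using that pow F.mem_carrier by (metis inv_solve_right F.m_closed m_closed)
        then show ?thesis using that pow F.mem_carrier y
          by (simp add: int_pow_diff m_assoc[symmetric] m_comm[of _ "inv (y [^] n)"])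
      qed
      then have "y [^] (m - n) \<in> F" using that by simp
      then have "m = n" using indep by fastforce
      then show ?thesis using that pow F.mem_carrier by simp
    qed
    \<comment> \<open>Exponent of \<open>y\<close> and factor in \<open>F\<close>, for an element of \<open>F'\<close>.\<close>
    define expo where "expo g = (THE n :: int. \<exists>f \<in> F. g = y [^] n \<otimes> f)" for g
    define rest where "rest g = (THE f. f \<in> F \<and> (\<exists>n :: int. g = y [^] n \<otimes> f))" for g
    have expo: "expo (y [^] n \<otimes> f) = n" if "f \<in> F" for n :: int and f
      unfolding expo_def using that uniq by (intro the_equality) blast+
    have rest: "rest (y [^] n \<otimes> f) = f" if "f \<in> F" for n :: int and f
      unfolding rest_def using that uniq by (intro the_equality) blast+
    define C' where "C' = insert expo ((\<lambda>c. c \<circ> rest) ` C)"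
    have C': "integer_coordinates G F' C'"
    proof -
      have mult: "expo (g \<otimes> h) = expo g + expo h" "rest (g \<otimes> h) = rest g \<otimes> rest h"
        "rest g \<in> F" if gh: "g \<in> F'" "h \<in> F'" for g h
      proof -
        obtain m n :: int and f f' where *: "g = y [^] m \<otimes> f" "f \<in> F" "h = y [^] n \<otimes> f'" "f' \<in> F"
          using gh unfolding F'_def by auto
        then have eq: "g \<otimes> h = y [^] (m + n) \<otimes> (f \<otimes> f')"
          using y F.mem_carrier by (simp add: int_pow_mult m_ac)
        have ff: "f \<otimes> f' \<in> F" using * by simp
        show "expo (g \<otimes> h) = expo g + expo h"
          unfolding eq expo[OF ff] using * expo by simp
        show "rest (g \<otimes> h) = rest g \<otimes> rest h"
          unfolding eq rest[OF ff] using * rest by simp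
        show "rest g \<in> F" using * rest by simp
      qed
      have zero: "g = \<one>" if g: "g \<in> F'" and c: "\<forall>c \<in> C'. c g = 0" for g
      proof -
        obtain n :: int and f where *: "g = y [^] n \<otimes> f" "f \<in> F"
          using g unfolding F'_def by auto
        have "n = 0" using c expo[OF *(2)] * by (auto simp: C'_def)
        moreover have "\<forall>c \<in> C. c f = 0" using c rest[OF *(2)] * by (auto simp: C'_def)
        then have "f = \<one>" using C *(2) by (auto simp: integer_coordinates_def)
        ultimately show ?thesis using * by simp
      qed
      have "subgroup F' G" unfolding F'_def by (rule powers_times_subgroup[OF y F.subgroup_axioms])
      moreover have "finite C'" using C by (simp add: C'_def integer_coordinates_def)
      moreover have "c (f \<otimes> g) = c f + c g" if "c \<in> C'" "f \<in> F'" "g \<in> F'" for c f g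
        using that mult[OF that(2,3)] mult(3)[OF that(3,2)] C
        by (auto simp: C'_def integer_coordinates_def)
      ultimately show ?thesis using zero unfolding integer_coordinates_def by blast
    qed
    have nf': "has_regular_normal_form G F'"
      unfolding F'_def
    proof (rule has_regular_normal_form_product[OF has_regular_normal_form_powers[OF y] nf])
      show "n = 0" if "y [^] n = \<one>" for n :: int using that indep F.one_closed by metis
      show "inj_on (\<lambda>(x, f). x \<otimes> f) (range (\<lambda>n :: int. y [^] n) \<times> F)"
        by (auto simp: inj_on_def dest!: uniq)
    qed
    have "\<exists>f \<in> F'. \<exists>t \<in> T. g = f \<otimes> t" if g: "g \<in> generate G (insert y X)" for g
    proof -
      obtain n :: int and f t where n: "f \<in> F" "t \<in> T" "g = y [^] n \<otimes> (f \<otimes> t)"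
        using gen'[OF g] by blast
      then have "g = (y [^] n \<otimes> f) \<otimes> t" using pow T F.mem_carrier by (simp add: m_assoc subset_iff)
      moreover have "y [^] n \<otimes> f \<in> F'" using n(1) by (auto simp: F'_def)
      ultimately show ?thesis using n(2) by blast
    qed
    then show ?thesis using C' nf' T by blast
  qed
qed

text \<open>
  The set \<open>T\<close> of the preceding lemma may meet a coset of \<open>F\<close> more than once; choosing one of its
  elements in each coset makes the decomposition unique and yields normal forms for \<open>K\<close>.
\<close>

theorem finitely_generated_abelian_structure:
  assumes "comm_group K" "finitely_generated_group K"
  obtains F C T where "integer_coordinates K F C" "finite T" "T \<subseteq> carrier K"
    "\<forall>k \<in> carrier K. \<exists>f \<in> F. \<exists>t \<in> T. k = f \<otimes>\<^bsub>K\<^esub> t"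
    "has_regular_normal_form K (carrier K)"
proof -
  interpret comm_group K by fact
  obtain X where X: "finite X" "X \<subseteq> carrier K" "generate K X = carrier K"
    using assms(2) unfolding finitely_generated_group_def by blast
  obtain F C T where C: "integer_coordinates K F C" and nf: "has_regular_normal_form K F"
    and T: "finite T" "T \<subseteq> carrier K"
    and gen: "\<forall>k \<in> carrier K. \<exists>f \<in> F. \<exists>t \<in> T. k = f \<otimes>\<^bsub>K\<^esub> t"
    using finitely_generated_virtually_free[OF X(1,2)] unfolding X(3) by (elim exE conjE) (rule that)
  interpret F: subgroup F K using C by (simp add: integer_coordinates_def)
  \<comment> \<open>Depends on \<open>k\<close> only through its coset, so the choice below is constant on cosets.\<close>
  define R where "R k t \<longleftrightarrow> t \<in> T \<and> k \<otimes>\<^bsub>K\<^esub> inv\<^bsub>K\<^esub> t \<in> F" for k t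
  define rep where "rep k = (SOME t. R k t)" for k
  have ex: "\<exists>t. R k t" if k: "k \<in> carrier K" for k
  proof -
    obtain f t where "f \<in> F" "t \<in> T" "k = f \<otimes>\<^bsub>K\<^esub> t" using gen k by blast
    then have "R k t" using T F.mem_carrier by (auto simp: R_def m_assoc subset_iff)
    then show ?thesis by blast
  qed
  have rep: "R k (rep k)" if "k \<in> carrier K" for k
    unfolding rep_def using ex[OF that] by (rule someI_ex)
  have rep_times: "rep (f \<otimes>\<^bsub>K\<^esub> k) = rep k" if fk: "f \<in> F" "k \<in> carrier K" for f k
  proof -
    have "R (f \<otimes>\<^bsub>K\<^esub> k) t \<longleftrightarrow> R k t" for t
    proof (cases "t \<in> T")
      case True
      then have t: "t \<in> carrier K" using T by blast
      have eq: "f \<otimes>\<^bsub>K\<^esub> k \<otimes>\<^bsub>K\<^esub> inv\<^bsub>K\<^esub> t = f \<otimes>\<^bsub>K\<^esub> (k \<otimes>\<^bsub>K\<^esub> inv\<^bsub>K\<^esub> t)"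
        using fk t F.mem_carrier by (simp add: m_assoc)
      have "f \<otimes>\<^bsub>K\<^esub> x \<in> F \<longleftrightarrow> x \<in> F" if x: "x \<in> carrier K" for x
      proof
        assume "f \<otimes>\<^bsub>K\<^esub> x \<in> F"
        then have "inv\<^bsub>K\<^esub> f \<otimes>\<^bsub>K\<^esub> (f \<otimes>\<^bsub>K\<^esub> x) \<in> F" using fk by simp
        then show "x \<in> F" using fk x F.mem_carrier by (simp add: m_assoc[symmetric])
      qed (use fk in simp)
      then show ?thesis using fk t by (simp add: R_def eq)
    qed (simp add: R_def)
    then show ?thesis by (simp add: rep_def)
  qed
  define T' where "T' = rep ` carrier K"
  have T': "T' \<subseteq> T" using rep by (auto simp: T'_def R_def)
  then have T'2: "finite T'" "T' \<subseteq> carrier K" using T by (auto intro: finite_subset)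
  have dec: "k = (k \<otimes>\<^bsub>K\<^esub> inv\<^bsub>K\<^esub> rep k) \<otimes>\<^bsub>K\<^esub> rep k" "k \<otimes>\<^bsub>K\<^esub> inv\<^bsub>K\<^esub> rep k \<in> F" "rep k \<in> T'"
    if k: "k \<in> carrier K" for k
    using rep[OF k] k T by (auto simp: R_def T'_def m_assoc subset_iff)
  have rep_id: "rep t = t" if t: "t \<in> T'" for t
  proof -
    obtain k where k: "k \<in> carrier K" "t = rep k" using t by (auto simp: T'_def)
    have "rep k \<in> carrier K" using dec(3)[OF k(1)] T'2 by blast
    then show ?thesis using rep_times[OF dec(2)[OF k(1)], of "rep k"] dec(1)[OF k(1)] k by simp
  qed
  have inj: "inj_on (\<lambda>(f, t). f \<otimes>\<^bsub>K\<^esub> t) (F \<times> T')"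
  proof (rule inj_onI, clarify)
    fix f t f' t' assume *: "f \<in> F" "t \<in> T'" "f' \<in> F" "t' \<in> T'" "f \<otimes>\<^bsub>K\<^esub> t = f' \<otimes>\<^bsub>K\<^esub> t'"
    have tt: "t \<in> carrier K" "t' \<in> carrier K" using * T'2 by auto
    have "t = t'" using rep_times[OF *(1) tt(1)] rep_times[OF *(3) tt(2)] * rep_id by simp
    moreover then have "f = f'" using * tt F.mem_carrier by simp
    ultimately show "f = f' \<and> t = t'" by simp
  qed
  have "(\<lambda>(f, t). f \<otimes>\<^bsub>K\<^esub> t) ` (F \<times> T') = carrier K"
  proof (intro equalityI subsetI)
    fix k assume "k \<in> carrier K"
    from dec[OF this] show "k \<in> (\<lambda>(f, t). f \<otimes>\<^bsub>K\<^esub> t) ` (F \<times> T')"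
      by (intro image_eqI[of _ _ "(k \<otimes>\<^bsub>K\<^esub> inv\<^bsub>K\<^esub> rep k, rep k)"]) auto
  qed (use T'2 F.mem_carrier in auto)
  with has_regular_normal_form_product[OF nf has_regular_normal_form_finite[OF T'2] inj]
  have "has_regular_normal_form K (carrier K)" by simp
  with C T gen show thesis by (intro that) auto
qed

section \<open>Central extensions\<close>

lemma take_convolution: "take n (convolution u v) = convolution (take n u) (take n v)"
proof (induction u v arbitrary: n rule: convolution.induct)
  case (1 a u b v)
  then show ?case by (cases n) simp_all
next
  case (2 v)
  then show ?case by (simp add: take_map)
next
  case (3 a u)
  then show ?case by (cases n) (simp_all add: take_map)
qed

text \<open>
  Reading two words letter by letter, an automaton can follow the difference \<open>g\<close> of their values up to
  \<open>F\<close> as long as it stays in the finitely many cosets \<open>r F\<close> with \<open>r \<in> R\<close>. The chosen coset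
  representative \<open>rep g\<close> is kept in the state, and the remaining factor \<open>offset g \<in> F\<close> is followed
  through its coordinates. As \<open>F\<close> is central, multiplying \<open>g\<close> by letters on both sides changes the
  offset by an amount that depends only on the representative and the letters.
\<close>

locale coset_tracking = group G for G :: "('g, 'm) monoid_scheme" (structure) +
  fixes A :: "'a set" and \<phi> :: "'a \<Rightarrow> 'g" and F :: "'g set" and R :: "'g set"
  assumes \<phi>: "\<phi> \<in> A \<rightarrow> carrier G" and F: "subgroup F G"
    and central: "\<And>f g. f \<in> F \<Longrightarrow> g \<in> carrier G \<Longrightarrow> f \<otimes> g = g \<otimes> f"
    and finite_R: "finite R" and R_carrier: "R \<subseteq> carrier G" and one_R: "\<one> \<in> R"
begin

sublocale F: subgroup F G by (rule F)

definition represents :: "'g \<Rightarrow> 'g \<Rightarrow> bool" where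
  "represents r g \<longleftrightarrow> r \<in> R \<and> inv r \<otimes> g \<in> F"

definition near :: "'g \<Rightarrow> bool" where
  "near g \<longleftrightarrow> (\<exists>r. represents r g)"

definition rep :: "'g \<Rightarrow> 'g" where
  "rep g = (SOME r. represents r g)"

definition offset :: "'g \<Rightarrow> 'g" where
  "offset g = inv (rep g) \<otimes> g"

lemma represents_rep: "near g \<Longrightarrow> represents (rep g) g"
  unfolding near_def rep_def by (rule someI_ex)

lemma rep_in_R: "near g \<Longrightarrow> rep g \<in> R"
  using represents_rep by (simp add: represents_def)

lemma rep_closed: "near g \<Longrightarrow> rep g \<in> carrier G"
  using rep_in_R R_carrier by blast

lemma offset_in_F: "near g \<Longrightarrow> offset g \<in> F"
  using represents_rep by (simp add: represents_def offset_def)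

lemma rep_offset: "near g \<Longrightarrow> g \<in> carrier G \<Longrightarrow> rep g \<otimes> offset g = g"
  using rep_closed by (simp add: offset_def m_assoc[symmetric])

lemma nearI: "r \<in> R \<Longrightarrow> f \<in> F \<Longrightarrow> near (r \<otimes> f)"
  unfolding near_def represents_def using R_carrier
  by (intro exI[of _ r]) (auto simp: m_assoc[symmetric] subset_iff)

lemma near_one: "near \<one>"
  using nearI[OF one_R F.one_closed] by simp

lemma represents_mult:
  assumes "g \<in> carrier G" "f \<in> F"
  shows "represents r (g \<otimes> f) \<longleftrightarrow> represents r g"
proof (cases "r \<in> R")
  case True
  then have r: "r \<in> carrier G" using R_carrier by blast
  then have eq: "inv r \<otimes> (g \<otimes> f) = (inv r \<otimes> g) \<otimes> f" using assms by (simp add: m_assoc)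
  have "(inv r \<otimes> g) \<otimes> f \<in> F \<longleftrightarrow> inv r \<otimes> g \<in> F"
  proof
    assume "(inv r \<otimes> g) \<otimes> f \<in> F"
    then have "(inv r \<otimes> g) \<otimes> f \<otimes> inv f \<in> F" using assms(2) by simp
    then show "inv r \<otimes> g \<in> F" using r assms by (simp add: m_assoc)
  qed (use assms(2) in simp)
  then show ?thesis by (simp add: represents_def eq)
qed (simp add: represents_def)

lemma near_mult: "g \<in> carrier G \<Longrightarrow> f \<in> F \<Longrightarrow> near (g \<otimes> f) \<longleftrightarrow> near g"
  by (simp add: near_def represents_mult)

lemma rep_mult: "g \<in> carrier G \<Longrightarrow> f \<in> F \<Longrightarrow> rep (g \<otimes> f) = rep g"
  by (simp add: rep_def represents_mult)

lemma offset_mult: "near g \<Longrightarrow> g \<in> carrier G \<Longrightarrow> f \<in> F \<Longrightarrow> offset (g \<otimes> f) = offset g \<otimes> f"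
  using rep_closed[of g] by (simp add: offset_def rep_mult m_assoc)

definition letter_value :: "'a option \<Rightarrow> 'g" where
  "letter_value x = (case x of None \<Rightarrow> \<one> | Some a \<Rightarrow> \<phi> a)"

definition move :: "'g \<Rightarrow> 'a option \<times> 'a option \<Rightarrow> 'g" where
  "move g p = inv (letter_value (fst p)) \<otimes> g \<otimes> letter_value (snd p)"

lemma letter_value_simps [simp]: "letter_value None = \<one>" "letter_value (Some a) = \<phi> a"
  by (simp_all add: letter_value_def)

lemma move_pair [simp]: "move g (x, y) = inv (letter_value x) \<otimes> g \<otimes> letter_value y"
  by (simp add: move_def)

lemma letter_value_closed:
  assumes "p \<in> pair_letters A"
  shows "letter_value (fst p) \<in> carrier G" "letter_value (snd p) \<in> carrier G"
proof -
  have "letter_value x \<in> carrier G" if "x \<in> insert None (Some ` A)" for x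
    using that \<phi> by auto
  moreover have "fst p \<in> insert None (Some ` A)" "snd p \<in> insert None (Some ` A)"
    using assms by (auto simp: pair_letters_def)
  ultimately show "letter_value (fst p) \<in> carrier G" "letter_value (snd p) \<in> carrier G"
    by blast+
qed

lemma move_closed: "p \<in> pair_letters A \<Longrightarrow> g \<in> carrier G \<Longrightarrow> move g p \<in> carrier G"
  using letter_value_closed[of p] by (simp add: move_def)

lemma move_mult:
  assumes "p \<in> pair_letters A" "g \<in> carrier G" "f \<in> F"
  shows "move (g \<otimes> f) p = move g p \<otimes> f"
proof -
  note letter_value_closed[OF assms(1)]
  then show ?thesis using assms central[of f "letter_value (snd p)"] F.mem_carrier
    by (simp add: move_def m_assoc)
qed

lemma foldl_move_convolution:
  assumes "g \<in> carrier G" "u \<in> lists A" "v \<in> lists A"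
  shows "foldl move g (convolution u v) = inv (word_value G \<phi> u) \<otimes> g \<otimes> word_value G \<phi> v"
  using assms
proof (induction u v arbitrary: g rule: convolution.induct)
  case (1 a u b v)
  then have *: "\<phi> a \<in> carrier G" "\<phi> b \<in> carrier G" "word_value G \<phi> u \<in> carrier G" "word_value G \<phi> v \<in> carrier G"
    using \<phi> word_value_closed[OF \<phi>] by auto
  then have "foldl move g (convolution (a # u) (b # v)) =
      inv (word_value G \<phi> u) \<otimes> (inv (\<phi> a) \<otimes> g \<otimes> \<phi> b) \<otimes> word_value G \<phi> v"
    using 1 by simp
  also have "\<dots> = inv (word_value G \<phi> (a # u)) \<otimes> g \<otimes> word_value G \<phi> (b # v)"
    using * 1(2) by (simp add: inv_mult_group m_assoc)
  finally show ?case .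
next
  case (2 v)
  have "g \<in> carrier G \<Longrightarrow> foldl move g (map (\<lambda>b. (None, Some b)) v) = g \<otimes> word_value G \<phi> v" for g
    using 2(3)
  proof (induction v arbitrary: g rule: list.induct)
    case (Cons b v)
    then have "\<phi> b \<in> carrier G" "word_value G \<phi> v \<in> carrier G"
      using \<phi> word_value_closed[OF \<phi>] by auto
    then show ?case using Cons by (simp add: m_assoc)
  qed simp
  with 2 show ?case using word_value_closed[OF \<phi>] by simp
next
  case (3 a u)
  have "g \<in> carrier G \<Longrightarrow> w \<in> lists A \<Longrightarrow>
      foldl move g (map (\<lambda>b. (Some b, None)) w) = inv (word_value G \<phi> w) \<otimes> g" for g w
  proof (induction w arbitrary: g rule: list.induct)
    case (Cons b v)
    then have "\<phi> b \<in> carrier G" "word_value G \<phi> v \<in> carrier G"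
      using \<phi> word_value_closed[OF \<phi>] by auto
    then show ?case using Cons by (simp add: m_assoc inv_mult_group)
  qed simp
  from this[OF 3(1,2)] show ?case using 3 word_value_closed[OF \<phi> 3(2)] by simp
qed

definition coset_step :: "'g option \<Rightarrow> 'a option \<times> 'a option \<Rightarrow> 'g option" where
  "coset_step s p = (case s of None \<Rightarrow> None | Some r \<Rightarrow>
     if near (move r p) then Some (rep (move r p)) else None)"

definition coset_output :: "('g \<Rightarrow> int) \<Rightarrow> 'g option \<Rightarrow> 'a option \<times> 'a option \<Rightarrow> int" where
  "coset_output c s p = (case s of None \<Rightarrow> 0 | Some r \<Rightarrow> c (offset (move r p)))"

lemma coset_step_rep:
  assumes "near g" "g \<in> carrier G" "p \<in> pair_letters A"
  shows "coset_step (Some (rep g)) p = (if near (move g p) then Some (rep (move g p)) else None)"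
    and "near (move g p) \<Longrightarrow> offset (move g p) = offset (move (rep g) p) \<otimes> offset g"
    and "near (move g p) \<longleftrightarrow> near (move (rep g) p)"
proof -
  have r: "rep g \<in> carrier G" "offset g \<in> F" using assms(1) rep_closed offset_in_F by auto
  have m: "move g p = move (rep g) p \<otimes> offset g"
    using move_mult[OF assms(3) r] rep_offset[OF assms(1,2)] by simp
  have c: "move (rep g) p \<in> carrier G" using assms(3) r(1) by (rule move_closed)
  show 1: "near (move g p) \<longleftrightarrow> near (move (rep g) p)"
    unfolding m by (rule near_mult[OF c r(2)])
  show "coset_step (Some (rep g)) p = (if near (move g p) then Some (rep (move g p)) else None)"
    unfolding coset_step_def m using near_mult[OF c r(2)] rep_mult[OF c r(2)] by simp
  show "offset (move g p) = offset (move (rep g) p) \<otimes> offset g" if "near (move g p)"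
    unfolding m using that offset_mult[OF _ c r(2)] 1 by simp
qed

lemma foldl_coset_step_None: "foldl coset_step None ps = None"
  by (induction ps) (simp_all add: coset_step_def)

text \<open>
  A run that has not failed has computed the coset of the final difference, and its outputs have
  summed to the change of the coordinate \<open>c\<close> of the offset.
\<close>

lemma coset_run:
  assumes add: "\<And>f g. f \<in> F \<Longrightarrow> g \<in> F \<Longrightarrow> c (f \<otimes> g) = c f + c g"
    and "near g" "g \<in> carrier G" "ps \<in> lists (pair_letters A)"
    and "foldl coset_step (Some (rep g)) ps \<noteq> None"
  shows "near (foldl move g ps) \<and>
    foldl coset_step (Some (rep g)) ps = Some (rep (foldl move g ps)) \<and>
    total_output coset_step (coset_output c) (Some (rep g)) ps = c (offset (foldl move g ps)) - c (offset g)"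
  using assms(2-)
proof (induction ps arbitrary: g rule: list.induct)
  case (Cons p ps)
  then have p: "p \<in> pair_letters A" "ps \<in> lists (pair_letters A)" by auto
  have near: "near (move g p)"
  proof (rule ccontr)
    assume "\<not> near (move g p)"
    then have "coset_step (Some (rep g)) p = None" using coset_step_rep(1)[OF Cons.prems(1,2) p(1)] by simp
    then show False using Cons.prems(4) by (simp add: foldl_coset_step_None)
  qed
  then have step: "coset_step (Some (rep g)) p = Some (rep (move g p))"
    using coset_step_rep(1)[OF Cons.prems(1,2) p(1)] by simp
  have near': "near (move (rep g) p)" using near coset_step_rep(3)[OF Cons.prems(1,2) p(1)] by simp
  have out: "coset_output c (Some (rep g)) p = c (offset (move g p)) - c (offset g)"
    using coset_step_rep(2)[OF Cons.prems(1,2) p(1) near] add[OF offset_in_F[OF near'] offset_in_F[OF Cons.prems(1)]]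
    by (simp add: coset_output_def)
  have "foldl coset_step (Some (rep (move g p))) ps \<noteq> None" using Cons.prems(4) step by simp
  from Cons.IH[OF near move_closed[OF p(1) Cons.prems(2)] p(2) this]
  show ?case using step out by simp
qed simp

lemma coset_run_alive:
  assumes "near g" "g \<in> carrier G" "ps \<in> lists (pair_letters A)"
    and "\<And>n. near (foldl move g (take n ps))"
  shows "foldl coset_step (Some (rep g)) ps \<noteq> None"
  using assms
proof (induction ps arbitrary: g rule: list.induct)
  case (Cons p ps)
  then have p: "p \<in> pair_letters A" "ps \<in> lists (pair_letters A)" by auto
  have near: "near (move g p)" using Cons.prems(4)[of 1] by simp
  have "near (foldl move (move g p) (take n ps))" for n using Cons.prems(4)[of "Suc n"] by simp
  from Cons.IH[OF near move_closed[OF p(1) Cons.prems(2)] p(2) this]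
  show ?case using coset_step_rep(1)[OF Cons.prems(1,2) p(1)] near by simp
qed simp

text \<open>
  Only finitely many representatives occur, so this is a finite control with integer output.
\<close>

lemma is_two_tape_language_coset:
  assumes "finite A"
  shows "is_two_tape_language A {(u, v) \<in> lists A \<times> lists A.
    foldl coset_step (Some (rep \<one>)) (convolution u v) \<in> {Some r} \<and>
    total_output coset_step (coset_output c) (Some (rep \<one>)) (convolution u v) = n}"
proof (rule synchronous_counter_relation[OF assms])
  show "finite (insert None (Some ` R))" using finite_R by simp
  show "Some (rep \<one>) \<in> insert None (Some ` R)" using rep_in_R[OF near_one] by simp
  show "coset_step s p \<in> insert None (Some ` R)" if "s \<in> insert None (Some ` R)" for s p
    using rep_in_R by (auto simp: coset_step_def split: option.splits)
qed

lemma equal_if_same_coordinates: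
  assumes C: "integer_coordinates G F C" and "near g" "near h" "g \<in> carrier G" "h \<in> carrier G"
    and "rep g = rep h" "\<And>c. c \<in> C \<Longrightarrow> c (offset g) = c (offset h)"
  shows "g = h"
proof -
  have F': "offset g \<in> F" "offset h \<in> F" using assms offset_in_F by auto
  have "c (offset g \<otimes> inv (offset h)) = 0" if "c \<in> C" for c
  proof -
    have "c (offset g \<otimes> inv (offset h) \<otimes> offset h) = c (offset g \<otimes> inv (offset h)) + c (offset h)"
      using C that F' by (auto simp: integer_coordinates_def)
    moreover have "offset g \<otimes> inv (offset h) \<otimes> offset h = offset g"
      using F' F.mem_carrier by (simp add: m_assoc)
    ultimately show ?thesis using assms(7)[OF that] by simp
  qed
  then have "offset g \<otimes> inv (offset h) = \<one>"
    using C F' by (auto simp: integer_coordinates_def)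
  then have "offset g = offset h" using F' F.mem_carrier by (metis inv_equality inv_inv F.m_inv_closed)
  then show ?thesis using rep_offset assms by metis
qed

end

text \<open>
  The multiplier relation of a letter \<open>a\<close> says that the final difference of the two words is \<open>\<phi> a\<close>. Its
  coset and each coordinate of its offset are tested by separate automata, and these conditions
  together determine the difference. Pairs in the relation are never lost on the way because all
  their differences lie in the cosets that are followed.
\<close>

theorem (in group) P_group_of_normal_form:
  fixes A :: "nat set"
  assumes "finite A" and \<phi>: "\<phi> \<in> A \<rightarrow> carrier G" and L: "regular_language A L"
    and bij: "bij_betw (word_value G \<phi>) L (carrier G)"
    and C: "integer_coordinates G F C"
    and central: "\<And>f g. f \<in> F \<Longrightarrow> g \<in> carrier G \<Longrightarrow> f \<otimes> g = g \<otimes> f"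
    and R: "finite R" "R \<subseteq> carrier G" "\<one> \<in> R"
    and fellow: "\<And>u v a t. u \<in> L \<Longrightarrow> v \<in> L \<Longrightarrow> a \<in> A \<Longrightarrow>
      word_value G \<phi> v = word_value G \<phi> u \<otimes> \<phi> a \<Longrightarrow>
      \<exists>r \<in> R. \<exists>f \<in> F. inv (word_value G \<phi> (take t u)) \<otimes> word_value G \<phi> (take t v) = r \<otimes> f"
  shows "P_group G"
proof -
  interpret coset_tracking G A \<phi> F R
    by (intro coset_tracking.intro coset_tracking_axioms.intro group_axioms \<phi> R central)
      (use C in \<open>simp_all add: integer_coordinates_def\<close>)
  have LA: "L \<subseteq> lists A" using L by (rule regular_language_subset)
  have val_closed: "word_value G \<phi> w \<in> carrier G" if "w \<in> lists A" for w
    using \<phi> that by (rule word_value_closed)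
  have diff: "foldl move \<one> (take n (convolution u v)) =
      inv (word_value G \<phi> (take n u)) \<otimes> word_value G \<phi> (take n v)"
    if "u \<in> lists A" "v \<in> lists A" for u v n
    using foldl_move_convolution[OF one_closed, of "take n u" "take n v"] that val_closed
    by (simp add: take_convolution)
  have diff': "foldl move \<one> (convolution u v) = inv (word_value G \<phi> u) \<otimes> word_value G \<phi> v"
    if "u \<in> lists A" "v \<in> lists A" for u v
    using foldl_move_convolution[OF one_closed that] that val_closed by simp
  have near_prefix: "near (foldl move \<one> (take n (convolution u v)))"
    if uv: "u \<in> L" "v \<in> L" and a: "a \<in> A" "word_value G \<phi> v = word_value G \<phi> u \<otimes> \<phi> a" for u v a n
  proof -
    obtain r f where "r \<in> R" "f \<in> F"
      "inv (word_value G \<phi> (take n u)) \<otimes> word_value G \<phi> (take n v) = r \<otimes> f"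
      using fellow[OF uv a] by blast
    then show ?thesis using diff[of u v n] uv LA nearI by (metis subsetD)
  qed
  have multiplier: "is_ATP A {(w, w') \<in> L \<times> L. word_value G \<phi> w' = word_value G \<phi> (w @ [a])}"
    if a: "a \<in> A" for a
  proof -
    have ac: "\<phi> a \<in> carrier G" using \<phi> a by auto
    have snoc: "word_value G \<phi> (w @ [a]) = word_value G \<phi> w \<otimes> \<phi> a" if "w \<in> lists A" for w
      using word_value_append[OF \<phi> that, of "[a]"] a ac by simp
    have near_a: "near (\<phi> a)"
    proof -
      obtain u v where uv: "u \<in> L" "word_value G \<phi> u = \<one>" "v \<in> L" "word_value G \<phi> v = \<phi> a"
        using bij ac one_closed unfolding bij_betw_def by (metis imageE)
      then have eq: "word_value G \<phi> v = word_value G \<phi> u \<otimes> \<phi> a" using ac by simp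
      \<comment> \<open>The representatives of \<open>\<one>\<close> and \<open>\<phi> a\<close> have \<open>\<phi> a\<close> as their final difference.\<close>
      have "near (foldl move \<one> (convolution u v))"
        using near_prefix[OF uv(1,3) a eq, of "length (convolution u v)"] by simp
      then show ?thesis using diff'[of u v] uv LA ac by (simp add: subset_iff)
    qed
    define M where "M c = {(u, v) \<in> lists A \<times> lists A.
      foldl coset_step (Some (rep \<one>)) (convolution u v) \<in> {Some (rep (\<phi> a))} \<and>
      total_output coset_step (coset_output c) (Some (rep \<one>)) (convolution u v) =
        c (offset (\<phi> a)) - c (offset \<one>)}" for c :: "'a \<Rightarrow> int"
    \<comment> \<open>The zero function keeps the family nonempty when \<open>F\<close> is trivial; it tests the coset alone.\<close>
    let ?C = "insert (\<lambda>_. 0) C"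
    have add: "c (f \<otimes> g) = c f + c g" if "c \<in> ?C" "f \<in> F" "g \<in> F" for c f g
      using that C by (auto simp: integer_coordinates_def)
    have "is_ATP A (\<Inter>c \<in> ?C. M c)"
    proof (rule is_ATP_INT)
      show "finite ?C" using C by (simp add: integer_coordinates_def)
      show "is_two_tape_language A (M c)" for c
        unfolding M_def by (rule is_two_tape_language_coset[OF assms(1)])
    qed simp
    with is_ATP_regular_components[OF assms(1) L]
    have "is_ATP A ({(u, v) \<in> lists A \<times> lists A. u \<in> L} \<inter>
        ({(u, v) \<in> lists A \<times> lists A. v \<in> L} \<inter> (\<Inter>c \<in> ?C. M c)))"
      by (intro is_ATP_Int)
    also have "{(u, v) \<in> lists A \<times> lists A. u \<in> L} \<inter>
        ({(u, v) \<in> lists A \<times> lists A. v \<in> L} \<inter> (\<Inter>c \<in> ?C. M c)) =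
      {(w, w') \<in> L \<times> L. word_value G \<phi> w' = word_value G \<phi> (w @ [a])}" (is "?l = ?r")
    proof -
      have mem: "(\<forall>c \<in> ?C. (u, v) \<in> M c) \<longleftrightarrow> word_value G \<phi> v = word_value G \<phi> (u @ [a])"
        if uv: "u \<in> L" "v \<in> L" for u v
      proof -
        have uvA: "u \<in> lists A" "v \<in> lists A" using uv LA by auto
        have conv: "convolution u v \<in> lists (pair_letters A)" by (rule convolution_in_lists[OF uvA])
        let ?g = "foldl move \<one> (convolution u v)"
        have g: "?g = inv (word_value G \<phi> u) \<otimes> word_value G \<phi> v" by (rule diff'[OF uvA])
        have gc: "?g \<in> carrier G" unfolding g using uvA val_closed by simp
        have ga: "?g = \<phi> a \<longleftrightarrow> word_value G \<phi> v = word_value G \<phi> (u @ [a])"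
          unfolding g snoc[OF uvA(1)] using uvA val_closed ac
          by (metis inv_solve_left m_closed inv_closed)
        let ?s = "Some (rep \<one>)"
        have run: "near ?g \<and> foldl coset_step ?s (convolution u v) = Some (rep ?g) \<and>
            total_output coset_step (coset_output c) ?s (convolution u v) =
              c (offset ?g) - c (offset \<one>)"
          if "c \<in> ?C" "foldl coset_step ?s (convolution u v) \<noteq> None" for c
          by (rule coset_run[OF add[OF that(1)] near_one one_closed conv that(2)])
        show ?thesis
        proof
          assume all: "\<forall>c \<in> ?C. (u, v) \<in> M c"
          then have final: "foldl coset_step ?s (convolution u v) = Some (rep (\<phi> a))"
            unfolding M_def by blast
          then have alive: "foldl coset_step ?s (convolution u v) \<noteq> None" by simp
          have "near ?g" "rep ?g = rep (\<phi> a)"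
            using run[OF insertI1 alive] final by simp_all
          moreover have "c (offset ?g) = c (offset (\<phi> a))" if "c \<in> C" for c
          proof -
            have c: "c \<in> ?C" using that by simp
            have "(u, v) \<in> M c" using all c by blast
            then show ?thesis using run[OF c alive] by (simp add: M_def)
          qed
          ultimately have "?g = \<phi> a"
            using equal_if_same_coordinates[OF C _ near_a gc ac] by blast
          then show "word_value G \<phi> v = word_value G \<phi> (u @ [a])" using ga by simp
        next
          assume eq: "word_value G \<phi> v = word_value G \<phi> (u @ [a])"
          then have ga': "?g = \<phi> a" using ga by simp
          have "foldl coset_step (Some (rep \<one>)) (convolution u v) \<noteq> None"
            using near_prefix[OF uv a] eq snoc[OF uvA(1)]
            by (intro coset_run_alive[OF near_one one_closed conv]) simp
          note alive = this
          show "\<forall>c \<in> ?C. (u, v) \<in> M c"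
          proof
            fix c assume "c \<in> ?C"
            from run[OF this alive] show "(u, v) \<in> M c"
              using uvA by (simp add: M_def ga')
          qed
        qed
      qed
      have "(u, v) \<in> ?l \<longleftrightarrow> (u, v) \<in> ?r" for u v
      proof (cases "u \<in> L \<and> v \<in> L")
        case True
        then have "u \<in> lists A" "v \<in> lists A" using LA by blast+
        then show ?thesis
          unfolding Int_iff INT_iff mem_Collect_eq prod.case mem_Times_iff fst_conv snd_conv
          using True mem[of u v] by (simp only: simp_thms)
      qed auto
      then show ?thesis by (intro equalityI subrelI) (simp_all only:)
    qed
    finally show ?thesis .
  qed
  have "is_P_structure G A \<phi> L"
    unfolding is_P_structure_def
    using LA bij regular_imp_P_language[OF assms(1) L] multiplier by blast
  moreover have "word_value G \<phi> ` lists A = carrier G"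
  proof (intro equalityI)
    show "carrier G \<subseteq> word_value G \<phi> ` lists A"
      using image_mono[OF LA, of "word_value G \<phi>"] bij by (simp add: bij_betw_def)
  qed (use val_closed in blast)
  ultimately show ?thesis
    unfolding P_group_def using group_axioms assms(1) \<phi> by blast
qed

text \<open>
  The normal form of an element of \<open>G\<close> is a lift of the unique representative \<open>u\<close> of its image in \<open>H\<close>,
  followed by a normal form of the remaining factor in \<open>K\<close>. Letters from \<open>K\<close> do not move the image in
  \<open>H\<close>, so the differences of two such words lie over the finite set \<open>B\<close> of differences in \<open>H\<close>, that
  is, in finitely many cosets of the central subgroup \<open>F\<close> of finite index in \<open>K\<close>.
\<close>

theorem theorem5p2:
  fixes K :: "('k, 'l) monoid_scheme"
    and G :: "('g, 'm) monoid_scheme"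
    and H :: "('h, 'n) monoid_scheme"
    and \<iota> :: "'k \<Rightarrow> 'g" and \<pi> :: "'g \<Rightarrow> 'h"
  assumes "comm_group K" and "finitely_generated_group K"
    and "automatic_group H"
    and "central_extension K G H \<iota> \<pi>"
  shows "P_group G"
proof -
  note ext = assms(4)[unfolded central_extension_def]
  interpret K: comm_group K by fact
  interpret G: group G using ext by simp
  interpret H: group H using ext by simp
  interpret \<iota>: group_hom K G \<iota>
    using ext by unfold_locales (simp add: mon_def)
  interpret \<pi>: group_hom G H \<pi>
    using ext by unfold_locales (simp add: epi_def)
  have inj: "inj_on \<iota> (carrier K)" using ext by (simp add: mon_def)
  have onto: "\<pi> ` carrier G = carrier H" using ext by (simp add: epi_def)
  have kern: "kernel G H \<pi> = \<iota> ` carrier K" using ext by simp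
  have central: "\<iota> k \<otimes>\<^bsub>G\<^esub> g = g \<otimes>\<^bsub>G\<^esub> \<iota> k" if "k \<in> carrier K" "g \<in> carrier G" for k g
    using ext that by blast
  have \<pi>\<iota>: "\<pi> (\<iota> k) = \<one>\<^bsub>H\<^esub>" if "k \<in> carrier K" for k
    using kern that by (auto simp: kernel_def)

  obtain A L B where LH: "fellow_travelling_language H A L B"
    and bijH: "bij_betw (word_value H id) L (carrier H)"
    by (rule automatic_group_unique_representatives[OF assms(3)])
  interpret LH: fellow_travelling_language H A L B by fact
  have LA: "L \<subseteq> lists A" by (rule regular_language_subset[OF LH.regular_L])
  obtain F C T where C: "integer_coordinates K F C" and T: "finite T" "T \<subseteq> carrier K"
    and FT: "\<forall>k \<in> carrier K. \<exists>f \<in> F. \<exists>t \<in> T. k = f \<otimes>\<^bsub>K\<^esub> t"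
    and nfK: "has_regular_normal_form K (carrier K)"
    by (rule finitely_generated_abelian_structure[OF assms(1,2)])
  interpret F: subgroup F K using C by (simp add: integer_coordinates_def)
  obtain E :: "nat set" and \<psi> LK where E: "finite E" "\<psi> \<in> E \<rightarrow> carrier K"
    and LK: "regular_language E LK" "bij_betw (word_value K \<psi>) LK (carrier K)"
    using nfK unfolding has_regular_normal_form_def by (elim exE conjE) (rule that)

  \<comment> \<open>A lift of \<open>H\<close> to \<open>G\<close>, in general not a homomorphism.\<close>
  define \<sigma> where "\<sigma> h = inv_into (carrier G) \<pi> h" for h
  have \<sigma>: "\<sigma> h \<in> carrier G" "\<pi> (\<sigma> h) = h" if "h \<in> carrier H" for h
    using that onto unfolding \<sigma>_def by (auto intro: inv_into_into f_inv_into_f)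
  have \<sigma>A: "\<sigma> \<in> A \<rightarrow> carrier G" using LH.A_carrier \<sigma> by blast
  have \<pi>\<sigma>: "\<pi> (word_value G \<sigma> w) = word_value H id w" if "w \<in> lists A" for w
  proof -
    have "\<pi> (word_value G \<sigma> w) = word_value H (\<pi> \<circ> \<sigma>) w" by (rule \<pi>.hom_word_value[OF \<sigma>A that])
    also have "\<dots> = word_value H id w"
      using that LH.A_carrier \<sigma>(2) by (intro word_value_cong) auto
    finally show ?thesis .
  qed
  have \<iota>\<psi>: "\<iota> (word_value K \<psi> w) = word_value G (\<iota> \<circ> \<psi>) w" if "w \<in> lists E" for w
    by (rule \<iota>.hom_word_value[OF E(2) that])
  have LKE: "LK \<subseteq> lists E" by (rule regular_language_subset[OF LK(1)])

  define X where "X = word_value G \<sigma> ` L"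
  have bij1: "bij_betw (word_value G \<sigma>) L X"
    unfolding bij_betw_def
  proof
    show "inj_on (word_value G \<sigma>) L"
    proof (rule inj_onI)
      fix u v assume uv: "u \<in> L" "v \<in> L" "word_value G \<sigma> u = word_value G \<sigma> v"
      then have "word_value H id u = word_value H id v"
        using \<pi>\<sigma>[of u] \<pi>\<sigma>[of v] LA by (simp add: subset_iff)
      then show "u = v" using bijH uv by (auto simp: bij_betw_def dest: inj_onD)
    qed
  qed (simp add: X_def)
  have bij2: "bij_betw (word_value G (\<iota> \<circ> \<psi>)) LK (\<iota> ` carrier K)"
  proof -
    have bij: "bij_betw (\<iota> \<circ> word_value K \<psi>) LK (\<iota> ` carrier K)"
      by (rule bij_betw_trans[OF LK(2)]) (simp add: bij_betw_def inj)
    have eq: "(\<iota> \<circ> word_value K \<psi>) w = word_value G (\<iota> \<circ> \<psi>) w" if "w \<in> LK" for w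
      using \<iota>\<psi>[OF subsetD[OF LKE that]] by (simp only: o_apply)
    from bij show ?thesis by (rule bij_betw_cong[THEN iffD1, rotated]) (rule eq)
  qed
  have unique: "inj_on (\<lambda>(x, y). x \<otimes>\<^bsub>G\<^esub> y) (X \<times> \<iota> ` carrier K)"
  proof (rule inj_onI)
    fix p q assume p: "p \<in> X \<times> \<iota> ` carrier K" and q: "q \<in> X \<times> \<iota> ` carrier K"
      and eq: "(case p of (x, y) \<Rightarrow> x \<otimes>\<^bsub>G\<^esub> y) = (case q of (x, y) \<Rightarrow> x \<otimes>\<^bsub>G\<^esub> y)"
    obtain u k where p': "p = (word_value G \<sigma> u, \<iota> k)" "u \<in> L" "k \<in> carrier K"
      using p unfolding X_def by auto
    obtain v l where q': "q = (word_value G \<sigma> v, \<iota> l)" "v \<in> L" "l \<in> carrier K"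
      using q unfolding X_def by auto
    have uv: "u \<in> lists A" "v \<in> lists A" using p' q' LA by auto
    have c: "word_value G \<sigma> u \<in> carrier G" "word_value G \<sigma> v \<in> carrier G"
      using uv G.word_value_closed[OF \<sigma>A] by auto
    have e: "word_value G \<sigma> u \<otimes>\<^bsub>G\<^esub> \<iota> k = word_value G \<sigma> v \<otimes>\<^bsub>G\<^esub> \<iota> l"
      using eq p' q' by simp
    then have "\<pi> (word_value G \<sigma> u \<otimes>\<^bsub>G\<^esub> \<iota> k) = \<pi> (word_value G \<sigma> v \<otimes>\<^bsub>G\<^esub> \<iota> l)" by simp
    then have "word_value H id u = word_value H id v"
      using c p' q' uv by (simp add: \<pi>\<iota> \<pi>\<sigma>)
    then have "u = v" using bijH p' q' by (auto simp: bij_betw_def dest: inj_onD)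
    with e c p' q' show "p = q" by simp
  qed
  have onto_G: "(\<lambda>(x, y). x \<otimes>\<^bsub>G\<^esub> y) ` (X \<times> \<iota> ` carrier K) = carrier G"
  proof (intro equalityI subsetI)
    fix g assume "g \<in> (\<lambda>(x, y). x \<otimes>\<^bsub>G\<^esub> y) ` (X \<times> \<iota> ` carrier K)"
    then show "g \<in> carrier G"
      using G.word_value_closed[OF \<sigma>A] LA by (auto simp: X_def subset_iff)
  next
    fix g assume g: "g \<in> carrier G"
    then have "\<pi> g \<in> word_value H id ` L" using bijH by (simp add: bij_betw_def)
    then obtain u where u: "u \<in> L" "\<pi> g = word_value H id u" by blast
    let ?x = "word_value G \<sigma> u"
    have uA: "u \<in> lists A" using u LA by blast
    have x: "?x \<in> carrier G" "\<pi> ?x = \<pi> g"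
      using uA u(2) \<pi>\<sigma>[OF uA] G.word_value_closed[OF \<sigma>A uA] by simp_all
    then have "inv\<^bsub>G\<^esub> ?x \<otimes>\<^bsub>G\<^esub> g \<in> kernel G H \<pi>" using g by (simp add: kernel_def)
    then have "inv\<^bsub>G\<^esub> ?x \<otimes>\<^bsub>G\<^esub> g \<in> \<iota> ` carrier K" unfolding kern .
    moreover have "g = ?x \<otimes>\<^bsub>G\<^esub> (inv\<^bsub>G\<^esub> ?x \<otimes>\<^bsub>G\<^esub> g)" using x g by (simp add: G.m_assoc[symmetric])
    ultimately show "g \<in> (\<lambda>(x, y). x \<otimes>\<^bsub>G\<^esub> y) ` (X \<times> \<iota> ` carrier K)"
      using u(1) unfolding X_def by (intro image_eqI[of _ _ "(?x, inv\<^bsub>G\<^esub> ?x \<otimes>\<^bsub>G\<^esub> g)"]) auto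
  qed
  have \<iota>\<psi>E: "\<iota> \<circ> \<psi> \<in> E \<rightarrow> carrier G"
  proof
    fix b assume "b \<in> E"
    then have "\<psi> b \<in> carrier K" using E(2) by blast
    then show "(\<iota> \<circ> \<psi>) b \<in> carrier G" by simp
  qed
  obtain f1 f2 and \<phi> :: "nat \<Rightarrow> 'g" where \<phi>: "\<forall>a \<in> A. \<phi> (f1 a) = \<sigma> a" "\<forall>b \<in> E. \<phi> (f2 b) = (\<iota> \<circ> \<psi>) b"
    and reg: "regular_language (f1 ` A \<union> f2 ` E) ((\<lambda>(u, v). map f1 u @ map f2 v) ` (L \<times> LK))"
    and bijG: "bij_betw (word_value G \<phi>) ((\<lambda>(u, v). map f1 u @ map f2 v) ` (L \<times> LK))
       ((\<lambda>(x, y). x \<otimes>\<^bsub>G\<^esub> y) ` (X \<times> \<iota> ` carrier K))"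
    by (rule G.product_normal_form[OF LH.finite_A E(1) \<sigma>A \<iota>\<psi>E LH.regular_L LK(1) bij1 bij2 unique])
  let ?N = "f1 ` A \<union> f2 ` E"
  have \<phi>N: "\<phi> \<in> ?N \<rightarrow> carrier G" using \<phi> \<sigma>A \<iota>\<psi>E by (auto simp: Pi_iff)
  have \<pi>_word: "word_value G \<phi> (map f1 u @ map f2 v) \<in> carrier G"
    "\<pi> (word_value G \<phi> (map f1 u @ map f2 v)) = word_value H id u"
    if uv: "u \<in> lists A" "v \<in> lists E" for u v
  proof -
    have N: "map f1 u \<in> lists ?N" "map f2 v \<in> lists ?N" using uv by (auto simp: in_lists_conv_set)
    have 1: "word_value G \<phi> (map f1 u) = word_value G \<sigma> u"
      unfolding word_value_map using uv \<phi>(1) by (intro word_value_cong) auto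
    have "word_value G \<phi> (map f2 v) = word_value G (\<iota> \<circ> \<psi>) v"
      unfolding word_value_map using uv \<phi>(2) by (intro word_value_cong) auto
    then have 2: "word_value G \<phi> (map f2 v) = \<iota> (word_value K \<psi> v)" using \<iota>\<psi>[OF uv(2)] by simp
    have c: "word_value G \<sigma> u \<in> carrier G" "word_value K \<psi> v \<in> carrier K"
      using G.word_value_closed[OF \<sigma>A uv(1)] K.word_value_closed[OF E(2) uv(2)] by simp_all
    have 3: "word_value G \<phi> (map f1 u @ map f2 v) = word_value G \<sigma> u \<otimes>\<^bsub>G\<^esub> \<iota> (word_value K \<psi> v)"
      unfolding G.word_value_append[OF \<phi>N N] 1 2 ..
    show "word_value G \<phi> (map f1 u @ map f2 v) \<in> carrier G" unfolding 3 using c by simp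
    show "\<pi> (word_value G \<phi> (map f1 u @ map f2 v)) = word_value H id u"
      unfolding 3 using c uv by (simp add: \<pi>\<iota> \<pi>\<sigma>)
  qed

  define R where "R = insert \<one>\<^bsub>G\<^esub> ((\<lambda>(b, t). \<sigma> b \<otimes>\<^bsub>G\<^esub> \<iota> t) ` ((B \<inter> carrier H) \<times> T))"
  have R: "finite R" "R \<subseteq> carrier G" "\<one>\<^bsub>G\<^esub> \<in> R"
    using LH.finite_B T \<sigma>(1) by (auto simp: R_def)
  have over_B: "\<exists>r \<in> R. \<exists>f \<in> \<iota> ` F. g = r \<otimes>\<^bsub>G\<^esub> f" if g: "g \<in> carrier G" "\<pi> g \<in> B" for g
  proof -
    have b: "\<pi> g \<in> carrier H" using g by simp
    let ?s = "\<sigma> (\<pi> g)"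
    have s: "?s \<in> carrier G" "\<pi> ?s = \<pi> g" using \<sigma>[OF b] by auto
    then have "inv\<^bsub>G\<^esub> ?s \<otimes>\<^bsub>G\<^esub> g \<in> \<iota> ` carrier K"
      unfolding kern[symmetric] using g by (simp add: kernel_def)
    then obtain k where k: "k \<in> carrier K" "inv\<^bsub>G\<^esub> ?s \<otimes>\<^bsub>G\<^esub> g = \<iota> k" by auto
    obtain f t where ft: "f \<in> F" "t \<in> T" "k = f \<otimes>\<^bsub>K\<^esub> t" using FT k(1) by blast
    have c: "f \<in> carrier K" "t \<in> carrier K" using ft T F.mem_carrier by auto
    have "g = ?s \<otimes>\<^bsub>G\<^esub> \<iota> k" unfolding k(2)[symmetric] using s g by (simp add: G.m_assoc[symmetric])
    also have "\<dots> = (?s \<otimes>\<^bsub>G\<^esub> \<iota> t) \<otimes>\<^bsub>G\<^esub> \<iota> f"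
      using c s central[OF c(1), of "\<iota> t"] by (simp add: ft(3) G.m_assoc)
    finally have "g = (?s \<otimes>\<^bsub>G\<^esub> \<iota> t) \<otimes>\<^bsub>G\<^esub> \<iota> f" .
    moreover have "?s \<otimes>\<^bsub>G\<^esub> \<iota> t \<in> R" using g b ft(2) by (auto simp: R_def)
    ultimately show ?thesis using ft(1) by blast
  qed
  have coords: "integer_coordinates G (\<iota> ` F) ((\<lambda>c. c \<circ> inv_into (carrier K) \<iota>) ` C)"
  proof -
    have "inv_into (carrier K) \<iota> (\<iota> f) = f" if "f \<in> carrier K" for f using inj that by simp
    moreover have "\<iota> f \<otimes>\<^bsub>G\<^esub> \<iota> g = \<iota> (f \<otimes>\<^bsub>K\<^esub> g)" if "f \<in> carrier K" "g \<in> carrier K" for f g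
      using that by simp
    moreover have "subgroup (\<iota> ` F) G" by (rule \<iota>.subgroup_img_is_subgroup[OF F.subgroup_axioms])
    ultimately show ?thesis
      using C F.mem_carrier unfolding integer_coordinates_def
      by (auto simp del: \<iota>.hom_mult)
  qed
  show ?thesis
  proof (rule G.P_group_of_normal_form[OF _ \<phi>N reg bijG[unfolded onto_G] coords _ R])
    show "finite ?N" using LH.finite_A E(1) by simp
    show "f \<otimes>\<^bsub>G\<^esub> g = g \<otimes>\<^bsub>G\<^esub> f" if "f \<in> \<iota> ` F" "g \<in> carrier G" for f g
      using that central F.mem_carrier by auto
  next
    fix w w' a t
    assume "w \<in> (\<lambda>(u, v). map f1 u @ map f2 v) ` (L \<times> LK)"
      "w' \<in> (\<lambda>(u, v). map f1 u @ map f2 v) ` (L \<times> LK)"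
      and a: "a \<in> ?N" and eq: "word_value G \<phi> w' = word_value G \<phi> w \<otimes>\<^bsub>G\<^esub> \<phi> a"
    then obtain u k u' k' where w: "w = map f1 u @ map f2 k" "u \<in> L" "k \<in> LK"
      and w': "w' = map f1 u' @ map f2 k'" "u' \<in> L" "k' \<in> LK" by auto
    have uk: "u \<in> lists A" "k \<in> lists E" "u' \<in> lists A" "k' \<in> lists E"
      using w w' LA LKE by auto
    have ac: "\<phi> a \<in> carrier G" using \<phi>N a by blast
    have \<pi>eq: "word_value H id u' = word_value H id u \<otimes>\<^bsub>H\<^esub> \<pi> (\<phi> a)"
      using arg_cong[OF eq, of \<pi>] \<pi>_word[OF uk(1,2)] \<pi>_word[OF uk(3,4)] ac by (simp add: w w')
    have inB: "inv\<^bsub>H\<^esub> (word_value H id (take t u)) \<otimes>\<^bsub>H\<^esub> word_value H id (take t u') \<in> B"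
    proof -
      from a consider x where "x \<in> A" "a = f1 x" | y where "y \<in> E" "a = f2 y" by blast
      then show ?thesis
      proof cases
        case 1
        then have "\<pi> (\<phi> a) = x" using \<phi>(1) \<sigma>(2) LH.A_carrier by auto
        then show ?thesis using LH.fellow_letter[OF w(2) w'(2) 1(1)] \<pi>eq by simp
      next
        case 2
        then have "\<pi> (\<phi> a) = \<one>\<^bsub>H\<^esub>" using \<phi>(2) \<pi>\<iota> E(2) by auto
        then have "word_value H id u' = word_value H id u"
          using \<pi>eq LH.val_closed[OF uk(1)] by simp
        then show ?thesis by (rule LH.fellow_equal[OF w(2) w'(2)])
      qed
    qed
    have take: "take t w = map f1 (take t u) @ map f2 (take (t - length u) k)"
      "take t w' = map f1 (take t u') @ map f2 (take (t - length u') k')"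
      by (simp_all add: w w' take_map)
    note p = \<pi>_word[OF take_in_lists[OF uk(1)] take_in_lists[OF uk(2)], of t "t - length u"]
    note p' = \<pi>_word[OF take_in_lists[OF uk(3)] take_in_lists[OF uk(4)], of t "t - length u'"]
    show "\<exists>r \<in> R. \<exists>f \<in> \<iota> ` F.
      inv\<^bsub>G\<^esub> (word_value G \<phi> (take t w)) \<otimes>\<^bsub>G\<^esub> word_value G \<phi> (take t w') = r \<otimes>\<^bsub>G\<^esub> f"
      unfolding take
    proof (rule over_B)
      let ?g = "inv\<^bsub>G\<^esub> (word_value G \<phi> (map f1 (take t u) @ map f2 (take (t - length u) k))) \<otimes>\<^bsub>G\<^esub>
        word_value G \<phi> (map f1 (take t u') @ map f2 (take (t - length u') k'))"
      show "?g \<in> carrier G" using p p' by simp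
      show "\<pi> ?g \<in> B" using p p' inB by simp
    qed
  qed
qed

end
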